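(* Let $G$ and $H$ be finite simple graphs whose edge ideals $I_G$ and $I_H$ have jump sequences $\mathbf a$ and $\mathbf b$ respectively. Then there is a finite simple graph $K$ such that $I_K$ has jump sequence $\mathbf a\oplus\mathbf b$, the corner sum of $\mathbf a$ and $\mathbf b$.
   Context: Let $\Bbbk$ be a field of characteristic zero. For a finite simple graph $G=(V,E)$ on $n$ vertices with at least one edge, let $R=\Bbbk[x_1,\dots,x_n]$ have one variable per vertex, and let the edge ideal be $I_G=(x_ix_j:\{i,j\}\in E)$. Convention: $\beta_{i,j}=\beta_{i,j}(I_G)$ denotes the graded Betti number of the quotient $R/I_G$ in homological degree $i$ and internal degree $j$ (so $\beta_{1,2}$ is the number of edges of $G$), and $\mathrm{reg}(I_G)=\max\{j-i+1:\beta_{i,j}\ne 0\}$. If $\mathrm{reg}(I_G)=k+1$, the jump sequence of $I_G$ is $[k;a_1,\dots,a_{k-1}]$, where $a_r=\min\{i:\beta_{i,i+r+1}\neq 0\}-1$ for $1\le r\le k-1$; if $I_G$ has a linear resolution ($k=1$) the jump sequence is $[1;\emptyset]$. The corner sum of two jump sequences $\mathbf a=[k;a_1,\dots,a_{k-1}]$ and $\mathbf b=[l;b_1,\dots,b_{l-1}]$ with $k\le l$ is $\mathbf a\oplus\mathbf b=[l;c_1,\dots,c_{k-1},b_k,\dots,b_{l-1}]$, where $c_i=\min\{a_i,b_i\}$ for $1\le i\le k-1$ (and $\oplus$ is symmetric in its arguments). *)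

theory Defs
  imports "HOL-Library.Poly_Mapping" "Jordan_Normal_Form.Matrix"
begin

text \<open>
  A polynomial with coefficients in \<open>'k\<close> and variables in \<open>'v\<close> is a finitely supported map from
  monomials to coefficients. The ring \<open>R\<close> with one variable per element of \<open>V\<close> is the subset
  \<open>polys V\<close>.
\<close>

type_synonym ('v, 'k) mpoly = "('v \<Rightarrow>\<^sub>0 nat) \<Rightarrow>\<^sub>0 'k"

definition polys :: "'v set \<Rightarrow> ('v, 'k::zero) mpoly set" where
  "polys V = {f. \<forall>m \<in> Poly_Mapping.keys f. Poly_Mapping.keys m \<subseteq> V}"

definition Var :: "'v \<Rightarrow> ('v, 'k::zero_neq_one) mpoly" where
  "Var v = Poly_Mapping.single (Poly_Mapping.single v 1) 1"

definition monom_degree :: "('v \<Rightarrow>\<^sub>0 nat) \<Rightarrow> nat" where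
  "monom_degree m = (\<Sum>v \<in> Poly_Mapping.keys m. Poly_Mapping.lookup m v)"

definition ideal_generated :: "'v set \<Rightarrow> ('v, 'k::comm_ring_1) mpoly set \<Rightarrow> ('v, 'k) mpoly set" where
  "ideal_generated V S =
     {\<Sum>s\<in>T. c s * s | T c. finite T \<and> T \<subseteq> S \<and> (\<forall>s\<in>T. c s \<in> polys V)}"


definition simple_graph :: "'v set \<Rightarrow> 'v set set \<Rightarrow> bool" where
  "simple_graph V E \<longleftrightarrow> finite V \<and> (\<forall>e\<in>E. e \<subseteq> V \<and> card e = 2)"

definition edge_ideal :: "'v set \<Rightarrow> 'v set set \<Rightarrow> ('v, 'k::comm_ring_1) mpoly set" where
  "edge_ideal V E = ideal_generated V ((\<lambda>e. \<Prod>v\<in>e. Var v) ` E)"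


definition free_module :: "'v set \<Rightarrow> nat \<Rightarrow> ('v, 'k::zero) mpoly vec set" where
  "free_module V r = {h \<in> carrier_vec r. \<forall>p<r. h $ p \<in> polys V}"

text \<open>
  A graded free resolution
    \<open>\<dots> \<longrightarrow> F\<^sub>2 \<longrightarrow> F\<^sub>1 \<longrightarrow> F\<^sub>0 \<longrightarrow> R/I \<longrightarrow> 0\<close>
  is given by the following data. The list \<open>ds i\<close> contains the degrees of the basis elements of
  \<open>F\<^sub>i\<close>, so that \<open>F\<^sub>i\<close> is the direct sum of the modules \<open>R(-d)\<close> for \<open>d\<close> in \<open>ds i\<close>
  (no basis element of negative degree occurs in a minimal resolution of \<open>R/I\<close>). The matrix \<open>D i\<close>
  represents the map from \<open>F\<^sub>i\<^sub>+\<^sub>1\<close> to \<open>F\<^sub>i\<close>, and the classes modulo \<open>I\<close> of the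
  entries of \<open>g\<close> are the images of the basis elements of \<open>F\<^sub>0\<close> in \<open>R/I\<close>. The first two conjuncts
  say that these maps are homogeneous of degree 0, the last three that the sequence is exact at
  \<open>R/I\<close>, at \<open>F\<^sub>0\<close>, and at \<open>F\<^sub>i\<^sub>+\<^sub>1\<close>.
\<close>

definition graded_free_resolution ::
  "'v set \<Rightarrow> ('v, 'k::comm_ring_1) mpoly set \<Rightarrow> (nat \<Rightarrow> nat list) \<Rightarrow> ('v, 'k) mpoly vec \<Rightarrow>
     (nat \<Rightarrow> ('v, 'k) mpoly mat) \<Rightarrow> bool" where
  "graded_free_resolution V I ds g D \<longleftrightarrow>
     (let F = (\<lambda>i. free_module V (length (ds i))) in
      (g \<in> F 0 \<and>
        (\<forall>p < length (ds 0). \<forall>m \<in> Poly_Mapping.keys (g $ p). monom_degree m = ds 0 ! p)) \<and>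
      (\<forall>i. D i \<in> carrier_mat (length (ds i)) (length (ds (Suc i))) \<and>
        (\<forall>p < length (ds i). \<forall>q < length (ds (Suc i)).
           D i $$ (p, q) \<in> polys V \<and>
           (\<forall>m \<in> Poly_Mapping.keys (D i $$ (p, q)).
              monom_degree m + ds i ! p = ds (Suc i) ! q))) \<and>
      (\<forall>f \<in> polys V. \<exists>h \<in> F 0. f - g \<bullet> h \<in> I) \<and>
      {h \<in> F 0. g \<bullet> h \<in> I} = (\<lambda>h. D 0 *\<^sub>v h) ` F 1 \<and>
      (\<forall>i. {h \<in> F (Suc i). D i *\<^sub>v h = 0\<^sub>v (length (ds i))} =
             (\<lambda>h. D (Suc i) *\<^sub>v h) ` F (Suc (Suc i))))"

text \<open>
  Minimality: all entries of the matrices \<open>D i\<close> lie in the ideal generated by the variables, i.e.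
  they have constant term 0.
\<close>

definition minimal_graded_free_resolution ::
  "'v set \<Rightarrow> ('v, 'k::comm_ring_1) mpoly set \<Rightarrow> (nat \<Rightarrow> nat list) \<Rightarrow> ('v, 'k) mpoly vec \<Rightarrow>
     (nat \<Rightarrow> ('v, 'k) mpoly mat) \<Rightarrow> bool" where
  "minimal_graded_free_resolution V I ds g D \<longleftrightarrow>
     graded_free_resolution V I ds g D \<and>
     (\<forall>i. \<forall>p < length (ds i). \<forall>q < length (ds (Suc i)).
        Poly_Mapping.lookup (D i $$ (p, q)) 0 = 0)"

text \<open>
  The graded Betti number of the quotient \<open>R/I\<close> in homological degree \<open>i\<close> and internal degree \<open>j\<close>.
\<close>

definition graded_betti :: "'v set \<Rightarrow> ('v, 'k::comm_ring_1) mpoly set \<Rightarrow> nat \<Rightarrow> nat \<Rightarrow> nat" where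
  "graded_betti V I i j =
     (THE b. \<exists>ds g D. minimal_graded_free_resolution V I ds g D \<and> b = count_list (ds i) j)"


text \<open>
  \<open>has_regularity V I \<rho>\<close> says that the regularity of the ideal \<open>I\<close> is \<open>\<rho>\<close>; since the Betti
  numbers are those of \<open>R/I\<close>, it is the maximum of \<open>j - i + 1\<close> rather than \<open>j - i\<close>.
\<close>

definition has_regularity :: "'v set \<Rightarrow> ('v, 'k::comm_ring_1) mpoly set \<Rightarrow> int \<Rightarrow> bool" where
  "has_regularity V I \<rho> \<longleftrightarrow>
     (let S = {int j - int i + 1 | i j. graded_betti V I i j \<noteq> 0} in
      \<rho> \<in> S \<and> (\<forall>s\<in>S. s \<le> \<rho>))"

text \<open>
  The pair \<open>(k, [a\<^sub>1, \<dots>, a\<^sub>k\<^sub>-\<^sub>1])\<close> stands for the jump sequence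
  \<open>[k; a\<^sub>1, \<dots>, a\<^sub>k\<^sub>-\<^sub>1]\<close>. List indices start at 0, so \<open>a\<^sub>r\<close> is \<open>as ! (r - 1)\<close>.
\<close>

type_synonym jump_seq = "nat \<times> nat list"

definition has_jump_sequence :: "'v set \<Rightarrow> ('v, 'k::comm_ring_1) mpoly set \<Rightarrow> jump_seq \<Rightarrow> bool" where
  "has_jump_sequence V I js \<longleftrightarrow>
     (case js of (k, as) \<Rightarrow>
        has_regularity V I (int k + 1) \<and> length as + 1 = k \<and>
        (\<forall>r. 1 \<le> r \<and> r \<le> k - 1 \<longrightarrow>
          (let S = {i. graded_betti V I i (i + r + 1) \<noteq> 0} in
           as ! (r - 1) + 1 \<in> S \<and> (\<forall>i\<in>S. as ! (r - 1) + 1 \<le> i))))"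

definition corner_sum :: "jump_seq \<Rightarrow> jump_seq \<Rightarrow> jump_seq" where
  "corner_sum a b =
     (case a of (k, as) \<Rightarrow> case b of (l, bs) \<Rightarrow>
        if k \<le> l then (l, map2 min as bs @ drop (k - 1) bs)
        else (k, map2 min as bs @ drop (l - 1) as))"

end

theory Submission
  imports Defs "HOL-Library.Function_Algebras"
begin

text \<open>
  The graph \<open>K\<close> is the join of \<open>G\<close> and \<open>H\<close>: its independence complex is the disjoint union of those of \<open>G\<close>
  and \<open>H\<close>. By Hochster's formula the Betti number of \<open>R/I\<^sub>K\<close> in a squarefree multidegree \<open>W\<close> and homological
  degree \<open>i\<close> is the dimension of a reduced cohomology group of the complex restricted to \<open>W\<close>, and in positive
  cohomological degrees the cohomology of a disjoint union is a direct sum. So, above the linear strand, the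
  Betti numbers of \<open>K\<close> that do not come from \<open>G\<close> or \<open>H\<close> themselves lie on the same strand as, and to the
  right of, a nonzero one of \<open>G\<close> or \<open>H\<close>.

  The Betti numbers are computed from squarefree resolutions. If all generators have squarefree multidegrees,
  then the strand in multidegree \<open>a\<close> depends only on the support of \<open>a\<close>, so a multigraded resolution of
  \<open>R/I\<close> amounts to scalar matrices together with a subset of the variables for each basis element, and it is
  exact if and only if finitely many complexes of vector spaces are. Such resolutions are built by choosing
  minimal generators in each squarefree degree; restricting one for \<open>K\<close> to an induced subgraph yields one for
  the subgraph.
\<close>

section \<open>Minimal generators of squarefree multigraded modules\<close>

text \<open>Only nonvanishing of Betti numbers matters for jump sequences, so Hochster's formula is
  needed only in this form: a generator of degree \<open>W\<close> exists iff a Koszul complex fails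
  to be exact at one position. The link is Tor computed in two ways: generators of a syzygy module
  are detected by its Koszul complex at the top set \<open>W\<close>, and each resolution step
  shifts exactness by one position, down to the ideal. The Koszul complex of the ideal in a nonempty
  degree \<open>W\<close> consists of cochains of the full simplex that vanish on faces; at sets of
  size \<open>m + 1\<close> its cohomology is the reduced cohomology of the restricted complex in
  degree \<open>m - 1\<close>. The strand \<open>j - i = r + 1\<close> thus belongs to cohomological
  degree \<open>r\<close>. In degree 0 a disjoint union gains a class, but this is the linear
  strand, which jump sequences do not record. Since Betti numbers are defined through arbitrary
  graded resolutions, with total degrees only, a separate uniqueness argument is required.\<close>

definition graded_part :: "nat set \<Rightarrow> (nat \<Rightarrow> 'v set) \<Rightarrow> 'v set \<Rightarrow> (nat \<Rightarrow> 'k::zero) set" where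
  "graded_part J s W = {x. \<forall>q. x q \<noteq> 0 \<longrightarrow> q \<in> J \<and> s q \<subseteq> W}"

text \<open>The vector \<open>c q\<close> is the image of the \<open>q\<close>-th basis element;
  this is the map of free modules in one multidegree, with the monomial factors dropped.\<close>

definition lin_comb :: "nat set \<Rightarrow> (nat \<Rightarrow> nat \<Rightarrow> 'k) \<Rightarrow> (nat \<Rightarrow> 'k) \<Rightarrow> nat \<Rightarrow> 'k::comm_ring_1" where
  "lin_comb J c y p = (\<Sum>q\<in>J. y q * c q p)"

lemma graded_partD: "x \<in> graded_part J s W \<Longrightarrow> x q \<noteq> 0 \<Longrightarrow> q \<in> J \<and> s q \<subseteq> W"
  by (simp add: graded_part_def)

lemma graded_part_mono: "U \<subseteq> W \<Longrightarrow> graded_part J s U \<subseteq> graded_part J s W"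
  by (auto simp: graded_part_def)

text \<open>Stated over commutative rings, where much of the Koszul argument works; over a field it
  is translated to the library's notion when bases are needed.\<close>

definition subsp :: "(nat \<Rightarrow> 'k::comm_ring_1) set \<Rightarrow> bool" where
  "subsp S \<longleftrightarrow> (\<lambda>_. 0) \<in> S \<and> (\<forall>x\<in>S. \<forall>y\<in>S. (\<lambda>p. x p + y p) \<in> S) \<and> (\<forall>a. \<forall>x\<in>S. (\<lambda>p. a * x p) \<in> S)"

lemma subsp_zero: "subsp S \<Longrightarrow> (\<lambda>_. 0) \<in> S"
  and subsp_add: "subsp S \<Longrightarrow> x \<in> S \<Longrightarrow> y \<in> S \<Longrightarrow> (\<lambda>p. x p + y p) \<in> S"
  and subsp_scale: "subsp S \<Longrightarrow> x \<in> S \<Longrightarrow> (\<lambda>p. a * x p) \<in> S"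
  by (auto simp: subsp_def)

lemma subsp_diff:
  assumes "subsp S" "x \<in> S" "y \<in> S"
  shows "(\<lambda>p. x p - y p) \<in> S"
  using subsp_add[OF assms(1,2) subsp_scale[OF assms(1,3), of "-1"]] by simp

lemma subsp_sum:
  assumes "subsp S" "\<And>i. i \<in> A \<Longrightarrow> f i \<in> S"
  shows "(\<lambda>p. \<Sum>i\<in>A. a i * f i p) \<in> S"
  using assms(2)
proof (induction A rule: infinite_finite_induct)
  case (insert i A)
  then show ?case
    using subsp_add[OF assms(1) subsp_scale[OF assms(1), of "f i" "a i"], of "\<lambda>p. \<Sum>i\<in>A. a i * f i p"]
    by simp
qed (auto simp: subsp_zero[OF assms(1)])

lemma subsp_graded_part: "subsp (graded_part J s W :: (nat \<Rightarrow> 'a::comm_ring_1) set)"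
proof -
  have "x q \<noteq> 0 \<or> y q \<noteq> 0" if "x q + y q \<noteq> 0" for x y :: "nat \<Rightarrow> 'a" and q
    using that by auto
  then show ?thesis unfolding subsp_def graded_part_def by (auto dest: mult_not_zero) blast+
qed

lemma lin_comb_diff: "lin_comb J c (\<lambda>q. x q - y q) p = lin_comb J c x p - lin_comb J c y p"
  by (simp add: lin_comb_def algebra_simps sum_subtractf)

lemma lin_comb_add: "lin_comb J c (\<lambda>q. x q + y q) p = lin_comb J c x p + lin_comb J c y p"
  by (simp add: lin_comb_def algebra_simps sum.distrib)

lemma lin_comb_scale: "lin_comb J c (\<lambda>q. a * y q) p = a * lin_comb J c y p"
  by (simp add: lin_comb_def sum_distrib_left mult.assoc)

lemma lin_comb_zero [simp]: "lin_comb J c (\<lambda>q. 0) p = 0"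
  by (simp add: lin_comb_def)

lemma lin_comb_sum: "lin_comb J c (\<lambda>q. \<Sum>i\<in>A. a i * f i q) p = (\<Sum>i\<in>A. a i * lin_comb J c (f i) p)"
  by (simp add: lin_comb_def sum_distrib_left sum_distrib_right mult.assoc sum.swap[of _ A J])

lemma subsp_lin_comb:
  assumes "subsp S" "\<And>q. q \<in> J \<Longrightarrow> y q \<noteq> 0 \<Longrightarrow> c q \<in> S"
  shows "lin_comb J c y \<in> S"
proof (cases "finite J")
  case True
  have "lin_comb J c y = (\<lambda>p. \<Sum>q\<in>{q\<in>J. y q \<noteq> 0}. y q * c q p)"
    unfolding lin_comb_def by (rule ext, rule sum.mono_neutral_right) (use True in auto)
  then show ?thesis
    using subsp_sum[OF assms(1), of "{q\<in>J. y q \<noteq> 0}" c y] assms(2) by simp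
next
  case False
  then have "lin_comb J c y = (\<lambda>_. 0)" by (auto simp: lin_comb_def)
  then show ?thesis using subsp_zero[OF assms(1)] by simp
qed

section \<open>Complements of subspaces and minimal generators\<close>

interpretation fvs: vector_space "\<lambda>(c::'k::field) (f::nat \<Rightarrow> 'k) i. c * f i"
  by unfold_locales (auto simp: fun_eq_iff algebra_simps)

lemma subspace_iff_subsp: "fvs.subspace S \<longleftrightarrow> subsp S"
  by (auto simp: fvs.subspace_def subsp_def zero_fun_def plus_fun_def)

lemma sum_fun_apply: "(\<Sum>b\<in>B. f b) p = (\<Sum>b\<in>B. f b p)"
  by (induction B rule: infinite_finite_induct) auto

text \<open>A basis of \<open>L\<close> is extended to one of \<open>S\<close>, and the added
  vectors represent a basis of the quotient. The last two conclusions express spanning and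
  independence modulo \<open>L\<close> without forming quotient spaces.\<close>

lemma extend_to_span:
  fixes S L :: "(nat \<Rightarrow> 'k::field) set"
  assumes "finite J" "subsp L" "subsp S" "L \<subseteq> S" and supp: "\<And>x p. x \<in> S \<Longrightarrow> x p \<noteq> 0 \<Longrightarrow> p \<in> J"
  obtains B where "finite B" "B \<subseteq> S"
    "\<And>x. x \<in> S \<Longrightarrow> \<exists>u. (\<lambda>p. x p - (\<Sum>b\<in>B. u b * b p)) \<in> L"
    "\<And>u. (\<lambda>p. \<Sum>b\<in>B. u b * b p) \<in> L \<Longrightarrow> (\<forall>b\<in>B. u b = 0)"
proof -
  obtain B0 where B0: "B0 \<subseteq> L" "fvs.independent B0" "L \<subseteq> fvs.span B0"
    by (rule fvs.maximal_independent_subset)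
  obtain B1 where B1: "B0 \<subseteq> B1" "B1 \<subseteq> S" "fvs.independent B1" "S \<subseteq> fvs.span B1"
    by (rule fvs.maximal_independent_subset_extend[OF subset_trans[OF B0(1) assms(4)] B0(2)])
  \<comment> \<open>Elements of \<open>S\<close> are supported on the finite set \<open>J\<close>,
    so the unit vectors at \<open>J\<close> span them; this bounds every independent subset and
    makes \<open>B\<close> finite.\<close>
  define E where "E = (\<lambda>j (p::nat). if p = j then 1 else 0 :: 'k) ` J"
  have "x \<in> fvs.span E" if "x \<in> S" for x
  proof -
    have "x = (\<Sum>j\<in>J. (\<lambda>i. x j * (if i = j then 1 else 0)))"
    proof
      fix p show "x p = (\<Sum>j\<in>J. (\<lambda>i. x j * (if i = j then 1 else 0))) p"
        using supp[OF that, of p] assms(1) by (auto simp: sum_fun_apply if_distrib cong: if_cong)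
    qed
    also have "\<dots> \<in> fvs.span E"
      by (intro fvs.span_sum fvs.span_scale fvs.span_base) (auto simp: E_def)
    finally show ?thesis .
  qed
  then have finB1: "finite B1"
    using fvs.independent_span_bound[of E B1] B1 assms(1) by (auto simp: E_def)
  define B where "B = B1 - B0"
  have fin0: "finite B0" using finB1 B1 finite_subset by blast
  have LS: "L = fvs.span B0"
    using B0 assms(2) by (metis fvs.span_subspace subspace_iff_subsp)
  have B1U: "B1 = B0 \<union> B" using B1 by (auto simp: B_def)
  show ?thesis
  proof (rule that[of B])
    show "finite B" "B \<subseteq> S" using finB1 B1 by (auto simp: B_def)
    fix x assume "x \<in> S"
    then have "x \<in> fvs.span (B0 \<union> B)" using B1(4) unfolding B1U by blast
    then obtain y z where yz: "x = y + z" "y \<in> fvs.span B0" "z \<in> fvs.span B"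
      unfolding fvs.span_Un by blast
    obtain u where "z = (\<Sum>b\<in>B. (\<lambda>p. u b * b p))"
      using yz(3) fvs.span_finite[OF \<open>finite B\<close>] by auto
    then have "(\<lambda>p. x p - (\<Sum>b\<in>B. u b * b p)) = y" using yz(1) by (auto simp: sum_fun_apply)
    then show "\<exists>u. (\<lambda>p. x p - (\<Sum>b\<in>B. u b * b p)) \<in> L"
      unfolding LS using yz(2) by (intro exI[of _ u]) simp
  next
    fix u assume "(\<lambda>p. \<Sum>b\<in>B. u b * b p) \<in> L"
    then obtain w where w: "(\<lambda>p. \<Sum>b\<in>B. u b * b p) = (\<Sum>b\<in>B0. (\<lambda>p. w b * b p))"
      using LS fvs.span_finite[OF fin0] by auto
    define t where "t b = (if b \<in> B then u b else - w b)" for b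
    have "(\<Sum>b\<in>B1. (\<lambda>p. t b * b p)) = 0"
    proof
      fix p
      have "(\<Sum>b\<in>B1. (\<lambda>p. t b * b p)) p = (\<Sum>b\<in>B0. t b * b p) + (\<Sum>b\<in>B. t b * b p)"
        unfolding B1U sum_fun_apply by (rule sum.union_disjoint) (use fin0 finB1 in \<open>auto simp: B_def\<close>)
      also have "(\<Sum>b\<in>B0. t b * b p) = - (\<Sum>b\<in>B0. w b * b p)"
        unfolding sum_negf[symmetric] by (rule sum.cong) (auto simp: t_def B_def)
      also have "(\<Sum>b\<in>B. t b * b p) = (\<Sum>b\<in>B0. w b * b p)"
        using fun_cong[OF w, of p] by (simp add: sum_fun_apply t_def)
      finally show "(\<Sum>b\<in>B1. (\<lambda>p. t b * b p)) p = 0 p" by simp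
    qed
    then have "\<forall>b\<in>B1. t b = 0"
      using fvs.independentD[OF B1(3) finB1] by blast
    then show "\<forall>b\<in>B. u b = 0" by (auto simp: t_def B_def)
  qed
qed

text \<open>In each degree \<open>W\<close> the new generators form a basis of a complement of the span of the spaces in
  smaller degrees. This is what makes the resulting resolution minimal.\<close>

lemma minimal_generators:
  fixes Z :: "'v set \<Rightarrow> (nat \<Rightarrow> 'k::field) set"
  assumes V: "finite V" and J: "finite J"
    and sub: "\<And>W. W \<subseteq> V \<Longrightarrow> subsp (Z W)"
    and supp: "\<And>W x p. W \<subseteq> V \<Longrightarrow> x \<in> Z W \<Longrightarrow> x p \<noteq> 0 \<Longrightarrow> p \<in> J"
    and mono: "\<And>U W. U \<subseteq> W \<Longrightarrow> W \<subseteq> V \<Longrightarrow> Z U \<subseteq> Z W"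
  obtains m :: nat and t :: "nat \<Rightarrow> 'v set" and c :: "nat \<Rightarrow> nat \<Rightarrow> 'k" where
    "\<And>q. q < m \<Longrightarrow> t q \<subseteq> V" "\<And>q. q < m \<Longrightarrow> c q \<in> Z (t q)"
    "\<And>W. W \<subseteq> V \<Longrightarrow> Z W = lin_comb {..<m} c ` graded_part {..<m} t W"
    "\<And>W y q. W \<subseteq> V \<Longrightarrow> y \<in> graded_part {..<m} t W \<Longrightarrow> lin_comb {..<m} c y = (\<lambda>_. 0) \<Longrightarrow>
        y q \<noteq> 0 \<Longrightarrow> t q \<noteq> W"
proof -
  \<comment> \<open>The sum of all \<open>Z U\<close> with \<open>U\<close> a proper subset of
    \<open>W\<close>: what is already generated in smaller degrees.\<close>
  define L where "L W = {x. \<exists>f. (\<forall>U\<in>{U. U \<subset> W}. f U \<in> Z U) \<and> x = (\<lambda>p. \<Sum>U\<in>{U. U \<subset> W}. f U p)}" for W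
  have finsub: "finite {U. U \<subset> W}" if "W \<subseteq> V" for W
    by (rule finite_subset[of _ "Pow V"]) (use that V in auto)
  have Lsub: "subsp (L W)" if W: "W \<subseteq> V" for W
    unfolding subsp_def
  proof (intro conjI ballI allI)
    show "(\<lambda>_. 0) \<in> L W" unfolding L_def
      using W sub by (auto intro!: exI[of _ "\<lambda>_ _. 0"] subsp_zero)
  next
    fix x y assume "x \<in> L W" "y \<in> L W"
    then obtain f g where "\<forall>U\<in>{U. U \<subset> W}. f U \<in> Z U" "x = (\<lambda>p. \<Sum>U\<in>{U. U \<subset> W}. f U p)"
      "\<forall>U\<in>{U. U \<subset> W}. g U \<in> Z U" "y = (\<lambda>p. \<Sum>U\<in>{U. U \<subset> W}. g U p)" unfolding L_def by blast
    then show "(\<lambda>p. x p + y p) \<in> L W" unfolding L_def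
      using W sub by (auto intro!: exI[of _ "\<lambda>U p. f U p + g U p"] subsp_add simp: sum.distrib)
  next
    fix x a assume "x \<in> L W"
    then obtain f where "\<forall>U\<in>{U. U \<subset> W}. f U \<in> Z U" "x = (\<lambda>p. \<Sum>U\<in>{U. U \<subset> W}. f U p)" unfolding L_def by blast
    then show "(\<lambda>p. a * x p) \<in> L W" unfolding L_def
      using W sub by (auto intro!: exI[of _ "\<lambda>U p. a * f U p"] subsp_scale simp: sum_distrib_left)
  qed
  have LZ: "L W \<subseteq> Z W" if W: "W \<subseteq> V" for W
  proof
    fix x assume "x \<in> L W"
    then obtain f where f: "\<forall>U\<in>{U. U \<subset> W}. f U \<in> Z U" "x = (\<lambda>p. \<Sum>U\<in>{U. U \<subset> W}. f U p)" unfolding L_def by blast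
    have "(\<lambda>p. \<Sum>U\<in>{U. U \<subset> W}. 1 * f U p) \<in> Z W"
      by (rule subsp_sum[OF sub[OF W]]) (use f mono W in blast)
    then show "x \<in> Z W" using f by simp
  qed
  have ZL: "x \<in> L W" if "x \<in> Z U" "U \<subset> W" "W \<subseteq> V" for x U W
  proof -
    let ?f = "\<lambda>U' p. if U' = U then x p else 0"
    have "?f U' \<in> Z U'" if "U' \<subset> W" for U'
    proof (cases "U' = U")
      case True
      then show ?thesis using \<open>x \<in> Z U\<close> by simp
    next
      case False
      then show ?thesis using subsp_zero[OF sub[of U']] that \<open>W \<subseteq> V\<close> by auto
    qed
    moreover have "x = (\<lambda>p. \<Sum>U'\<in>{U. U \<subset> W}. ?f U' p)"
      using that finsub[of W] by (simp add: sum.delta)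
    ultimately show ?thesis unfolding L_def by (intro CollectI exI[of _ ?f]) simp
  qed
  define P where "P W B \<longleftrightarrow> finite B \<and> B \<subseteq> Z W \<and>
    (\<forall>x\<in>Z W. \<exists>u. (\<lambda>p. x p - (\<Sum>b\<in>B. u b * b p)) \<in> L W) \<and>
    (\<forall>u. (\<lambda>p. \<Sum>b\<in>B. u b * b p) \<in> L W \<longrightarrow> (\<forall>b\<in>B. u b = 0))" for W B
  have "\<exists>B. P W B" if W: "W \<subseteq> V" for W
  proof -
    have supp': "\<And>x p. x \<in> Z W \<Longrightarrow> x p \<noteq> 0 \<Longrightarrow> p \<in> J" using supp that by blast
    obtain B where "finite B" "B \<subseteq> Z W"
      "\<And>x. x \<in> Z W \<Longrightarrow> \<exists>u. (\<lambda>p. x p - (\<Sum>b\<in>B. u b * b p)) \<in> L W"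
      "\<And>u. (\<lambda>p. \<Sum>b\<in>B. u b * b p) \<in> L W \<Longrightarrow> (\<forall>b\<in>B. u b = 0)"
      by (rule extend_to_span[OF J Lsub[OF W] sub[OF W] LZ[OF W] supp']) iprover+
    then have "P W B" unfolding P_def by simp
    then show ?thesis by (rule exI)
  qed
  then obtain B where B: "\<And>W. W \<subseteq> V \<Longrightarrow> P W (B W)" by metis
  \<comment> \<open>A generator records its degree as well as its vector, because the same vector
    may be chosen in incomparable degrees.\<close>
  define S where "S = Sigma (Pow V) B"
  have "finite S" using V B by (auto simp: S_def P_def)
  then obtain e where e: "bij_betw e {..<card S} S"
    using ex_bij_betw_nat_finite[of S] by (auto simp: lessThan_atLeast0)
  define m where "m = card S"
  define t where "t q = fst (e q)" for q
  define c where "c q = snd (e q)" for q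
  have eS: "e q \<in> S" if "q < m" for q using e that by (auto simp: m_def bij_betw_def)
  have tV: "t q \<subseteq> V" and cB: "c q \<in> B (t q)" if "q < m" for q
    using eS[OF that] by (auto simp: S_def t_def c_def)
  have cZ: "c q \<in> Z (t q)" if "q < m" for q
    using B[OF tV[OF that]] cB[OF that] by (auto simp: P_def)
  have sumW: "(\<Sum>q\<in>{q\<in>{..<m}. t q = W}. h (c q)) = (\<Sum>b\<in>B W. h b)" if "W \<subseteq> V" for W and h :: "_ \<Rightarrow> 'k"
  proof (rule sum.reindex_bij_betw, rule bij_betw_imageI)
    show "inj_on c {q \<in> {..<m}. t q = W}"
      using e by (auto simp: inj_on_def bij_betw_def t_def c_def m_def prod_eq_iff)
    show "c ` {q \<in> {..<m}. t q = W} = B W"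
    proof safe
      fix q assume "q < m" "W = t q" then show "c q \<in> B (t q)" using cB by auto
    next
      fix b assume "b \<in> B W"
      then have "(W, b) \<in> e ` {..<m}" using e that by (auto simp: S_def m_def bij_betw_def)
      then obtain q where "q < m" "e q = (W,b)" by auto
      then show "b \<in> c ` {q \<in> {..<m}. t q = W}" by (force simp: t_def c_def)
    qed
  qed
  let ?I = "\<lambda>W. lin_comb {..<m} c ` graded_part {..<m} t W"
  have Isub: "subsp (?I W)" for W
    unfolding subsp_def
  proof (intro conjI ballI allI)
    show "(\<lambda>_. 0) \<in> ?I W"
      by (rule image_eqI[of _ _ "\<lambda>_. 0"]) (auto simp: graded_part_def)
  next
    fix x y assume "x \<in> ?I W" "y \<in> ?I W"
    then obtain x' y' where xy: "x' \<in> graded_part {..<m} t W" "y' \<in> graded_part {..<m} t W"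
       "x = lin_comb {..<m} c x'" "y = lin_comb {..<m} c y'" by blast
    show "(\<lambda>p. x p + y p) \<in> ?I W"
      by (rule image_eqI[OF _ subsp_add[OF subsp_graded_part xy(1,2)]]) (auto simp: xy lin_comb_add)
  next
    fix a x assume "x \<in> ?I W"
    then obtain x' where xy: "x' \<in> graded_part {..<m} t W" "x = lin_comb {..<m} c x'" by blast
    show "(\<lambda>p. a * x p) \<in> ?I W"
      by (rule image_eqI[OF _ subsp_scale[OF subsp_graded_part xy(1)]]) (auto simp: xy lin_comb_scale)
  qed
  have IZ: "?I W \<subseteq> Z W" if W: "W \<subseteq> V" for W
  proof safe
    fix y :: "nat \<Rightarrow> 'k"
    assume y: "y \<in> graded_part {..<m} t W"
    show "lin_comb {..<m} c y \<in> Z W"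
      by (rule subsp_lin_comb[OF sub[OF W]]) (use graded_partD[OF y] cZ mono[OF _ W] in blast)
  qed
  have Imono: "?I U \<subseteq> ?I W" if "U \<subseteq> W" for U W
    using graded_part_mono[OF that] by auto
  \<comment> \<open>By the induction hypothesis the generators of smaller degree produce
    \<open>L W\<close>; those of degree exactly \<open>W\<close> supply the complement.\<close>
  have ZI: "Z W \<subseteq> ?I W" if "W \<subseteq> V" for W
    using finite_subset[OF that V] that
  proof (induction W rule: finite_psubset_induct)
    case (psubset W)
    have LI: "L W \<subseteq> ?I W"
    proof
      fix x assume "x \<in> L W"
      then obtain f where f: "\<forall>U\<in>{U. U \<subset> W}. f U \<in> Z U" "x = (\<lambda>p. \<Sum>U\<in>{U. U \<subset> W}. f U p)" unfolding L_def by blast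
      have "(\<lambda>p. \<Sum>U\<in>{U. U \<subset> W}. 1 * f U p) \<in> ?I W"
      proof (rule subsp_sum[OF Isub])
        fix U assume "U \<in> {U. U \<subset> W}"
        then have "U \<subset> W" "f U \<in> Z U" using f by auto
        moreover from this have "U \<subseteq> W" "U \<subseteq> V" using psubset.prems by auto
        ultimately show "f U \<in> ?I W"
          using subsetD[OF psubset.IH[of U]] subsetD[OF Imono[of U W]] by blast
      qed
      then show "x \<in> ?I W" using f by simp
    qed
    show ?case
    proof
      fix x assume x: "x \<in> Z W"
      then obtain u where u: "(\<lambda>p. x p - (\<Sum>b\<in>B W. u b * b p)) \<in> L W"
        using B[OF psubset.prems] by (auto simp: P_def)
      define y where "y q = (if q < m \<and> t q = W then u (c q) else 0)" for q
      have "lin_comb {..<m} c y = (\<lambda>p. \<Sum>b\<in>B W. u b * b p)"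
      proof
        fix p
        have "lin_comb {..<m} c y p = (\<Sum>q\<in>{q\<in>{..<m}. t q = W}. u (c q) * c q p)"
          unfolding lin_comb_def by (rule sum.mono_neutral_cong_right) (auto simp: y_def)
        then show "lin_comb {..<m} c y p = (\<Sum>b\<in>B W. u b * b p)"
          using sumW[OF psubset.prems, of "\<lambda>b. u b * b p"] by simp
      qed
      then have "(\<lambda>p. \<Sum>b\<in>B W. u b * b p) \<in> ?I W"
        by (intro image_eqI[of _ _ y]) (auto simp: graded_part_def y_def)
      from subsp_add[OF Isub subsetD[OF LI u] this] show "x \<in> ?I W" by simp
    qed
  qed
  \<comment> \<open>The terms of degree exactly \<open>W\<close> in a relation equal minus the terms
    of smaller degree, which lie in \<open>L W\<close>. Independence of \<open>B W\<close> modulo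
    \<open>L W\<close> then kills their coefficients.\<close>
  have min: "t q \<noteq> W" if W: "W \<subseteq> V" and y: "y \<in> graded_part {..<m} t W"
    and 0: "lin_comb {..<m} c y = (\<lambda>_. 0)" and q: "y q \<noteq> 0" for W y q
  proof
    assume tq: "t q = W"
    have qm: "q < m" using y q by (auto simp: graded_part_def)
    define u where "u b = y (the_inv_into {q\<in>{..<m}. t q = W} c b)" for b
    have inj: "inj_on c {q \<in> {..<m}. t q = W}"
      using e by (auto simp: inj_on_def bij_betw_def t_def c_def m_def prod_eq_iff)
    have uc: "u (c r) = y r" if "r < m" "t r = W" for r
      using the_inv_into_f_f[OF inj, of r] that by (simp add: u_def)
    have split: "(\<Sum>b\<in>B W. u b * b p) = - lin_comb {..<m} c (\<lambda>r. if t r = W then 0 else y r) p" for p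
    proof -
      have "(\<Sum>b\<in>B W. u b * b p) = (\<Sum>q\<in>{q\<in>{..<m}. t q = W}. u (c q) * c q p)"
        using sumW[OF W, of "\<lambda>b. u b * b p"] by simp
      also have "\<dots> = (\<Sum>q\<in>{..<m}. (if t q = W then y q else 0) * c q p)"
        by (rule sum.mono_neutral_cong_left) (auto simp: uc)
      also have "\<dots> = lin_comb {..<m} c (\<lambda>q. y q - (if t q = W then 0 else y q)) p"
        unfolding lin_comb_def by (rule sum.cong) auto
      also have "\<dots> = - lin_comb {..<m} c (\<lambda>r. if t r = W then 0 else y r) p"
        unfolding lin_comb_diff using fun_cong[OF 0, of p] by simp
      finally show ?thesis .
    qed
    have "lin_comb {..<m} c (\<lambda>r. if t r = W then 0 else y r) \<in> L W"
    proof (rule subsp_lin_comb[OF Lsub[OF W]])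
      fix r assume "r \<in> {..<m}" "(if t r = W then 0 else y r) \<noteq> 0"
      then have "t r \<subset> W" "c r \<in> Z (t r)" using y cZ by (auto simp: graded_part_def split: if_splits)
      then show "c r \<in> L W" using ZL W by auto
    qed
    from subsp_scale[OF Lsub[OF W] this, of "-1"]
    have "(\<lambda>p. \<Sum>b\<in>B W. u b * b p) \<in> L W" unfolding split by simp
    then have "\<forall>b\<in>B W. u b = 0" using B[OF W] unfolding P_def by blast
    then have "u (c q) = 0" using cB[OF qm] tq by auto
    then show False using uc[OF qm tq] q by simp
  qed
  show ?thesis
  proof (rule that[of m t c])
    show "Z W = ?I W" if "W \<subseteq> V" for W using ZI[OF that] IZ[OF that] by (rule equalityI)
  qed (fact tV cZ min)+
qed

section \<open>The Koszul complex\<close>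

text \<open>The sign of \<open>v\<close> in an exterior product. It needs an ordered vertex set,
  which is why the Koszul part uses natural numbers as vertices.\<close>

definition ksign :: "nat \<Rightarrow> nat set \<Rightarrow> 'k::comm_ring_1" where
  "ksign v A = (-1) ^ card {t\<in>A. t < v}"

text \<open>The argument \<open>p\<close> is a coordinate of the coefficient vector. Multiplication
  by a variable is an inclusion of subspaces here, so only signs remain of the Koszul
  differential.\<close>

definition cobd :: "(nat set \<Rightarrow> nat \<Rightarrow> 'k) \<Rightarrow> nat set \<Rightarrow> nat \<Rightarrow> 'k::comm_ring_1" where
  "cobd f T p = (\<Sum>v\<in>T. ksign v (T - {v}) * f (T - {v}) p)"

lemma ksign_square: "ksign v A * ksign v A = 1"
  by (simp add: ksign_def power_mult_distrib[symmetric])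

lemma ksign_insert:
  assumes "finite A" "u \<notin> A"
  shows "ksign v (insert u A) = (if u < v then - ksign v A else ksign v A)"
proof (cases "u < v")
  case True
  then have "{t \<in> insert u A. t < v} = insert u {t\<in>A. t < v}" by auto
  then show ?thesis using True assms by (simp add: ksign_def)
next
  case False
  then have "{t \<in> insert u A. t < v} = {t\<in>A. t < v}" by auto
  then show ?thesis using False by (simp add: ksign_def)
qed

lemma ksign_anticommute:
  assumes "finite A" "u \<notin> A" "v \<notin> A" "u \<noteq> v"
  shows "ksign v (insert u A) * ksign u (insert v A :: nat set) = - (ksign u A * ksign v A :: 'a::comm_ring_1)"
    and "ksign v (insert u A) * ksign u A = - (ksign u (insert v A) * ksign v A :: 'a)"
  using assms by (auto simp: ksign_insert mult.commute)

lemma cobd_diff: "cobd (\<lambda>T q. f T q - g T q) T p = cobd f T p - cobd g T p"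
  by (simp add: cobd_def algebra_simps sum_subtractf)

lemma cobd_cong: "(\<And>v. v \<in> T \<Longrightarrow> f (T - {v}) p = g (T - {v}) p) \<Longrightarrow> cobd f T p = cobd g T p"
  by (simp add: cobd_def)

lemma cobd_eq_0: "(\<And>v. v \<in> T \<Longrightarrow> f (T - {v}) p = 0) \<Longrightarrow> cobd f T p = 0"
  by (simp add: cobd_def)

lemma cobd_cobd:
  fixes f :: "nat set \<Rightarrow> nat \<Rightarrow> 'k::field_char_0"
  assumes "finite T"
  shows "cobd (cobd f) T p = 0"
proof -
  \<comment> \<open>Setting the diagonal to zero makes \<open>g\<close> antisymmetric on all of
    \<open>T\<close>; the double sum equals its own negative, and 2 is nonzero in characteristic
    zero.\<close>
  define g where "g v u = (if u = v then 0 else ksign v (T - {v}) * (ksign u (T - {v} - {u}) * f (T - {v} - {u}) p))" for v u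
  have sum: "cobd (cobd f) T p = (\<Sum>v\<in>T. \<Sum>u\<in>T. g v u)"
    unfolding cobd_def sum_distrib_left
    by (intro sum.cong refl sum.mono_neutral_cong_left) (use assms in \<open>auto simp: g_def\<close>)
  have anti: "g v u = - g u v" if "u \<in> T" "v \<in> T" for u v
  proof (cases "u = v")
    case False
    let ?A = "T - {v} - {u}"
    have eq: "T - {v} = insert u ?A" "T - {u} = insert v ?A" "T - {u} - {v} = ?A" using False that by auto
    have "ksign v (insert u ?A) * ksign u ?A = - (ksign u (insert v ?A) * ksign v ?A :: 'k)"
      by (rule ksign_anticommute(2)) (use False assms in auto)
    then have "ksign v (insert u ?A) * (ksign u ?A * f ?A p) = - (ksign u (insert v ?A) * (ksign v ?A * f ?A p))"
      by (simp add: mult.assoc[symmetric])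
    then show ?thesis
      unfolding g_def eq(3) eq(1,2)[symmetric] using False by simp
  qed (simp add: g_def)
  have neg: "(\<Sum>v\<in>T. \<Sum>u\<in>T. g v u) = - (\<Sum>v\<in>T. \<Sum>u\<in>T. g v u)"
  proof -
    have "(\<Sum>v\<in>T. \<Sum>u\<in>T. g v u) = (\<Sum>v\<in>T. \<Sum>u\<in>T. - g u v)"
      by (intro sum.cong refl anti)
    also have "\<dots> = - (\<Sum>u\<in>T. \<Sum>v\<in>T. g u v)" by (subst sum.swap) (simp add: sum_negf)
    finally show ?thesis .
  qed
  have "2 * (\<Sum>v\<in>T. \<Sum>u\<in>T. g v u) = 0"
    using neg unfolding eq_neg_iff_add_eq_0 mult_2 .
  then show ?thesis unfolding sum by simp
qed

text \<open>The full simplex is a cone with apex \<open>v\<close>; inserting the apex, with sign, is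
  the contracting homotopy.\<close>

lemma cone_homotopy:
  fixes f :: "nat set \<Rightarrow> nat \<Rightarrow> 'k::comm_ring_1"
  defines "h \<equiv> \<lambda>v f T p. if v \<in> T then 0 else ksign v T * f (insert v T) p"
  assumes T: "finite T"
  shows "cobd (h v f) T p + h v (cobd f) T p = f T p"
proof (cases "v \<in> T")
  case True
  have "cobd (h v f) T p = (\<Sum>u\<in>{v}. ksign u (T - {u}) * h v f (T - {u}) p)"
    unfolding cobd_def by (rule sum.mono_neutral_right) (use T True in \<open>auto simp: h_def\<close>)
  also have "\<dots> = f T p"
    using True by (simp add: h_def mult.assoc[symmetric] ksign_square insert_absorb)
  finally show ?thesis using True by (simp add: h_def)
next
  case False
  have "h v (cobd f) T p = ksign v T * (\<Sum>u\<in>insert v T. ksign u (insert v T - {u}) * f (insert v T - {u}) p)"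
    using False by (simp add: h_def cobd_def)
  also have "\<dots> = ksign v T * (ksign v T * f T p + (\<Sum>u\<in>T. ksign u (insert v T - {u}) * f (insert v T - {u}) p))"
    using False T by simp
  also have "\<dots> = f T p + (\<Sum>u\<in>T. ksign v T * (ksign u (insert v T - {u}) * f (insert v T - {u}) p))"
    by (simp add: distrib_left mult.assoc[symmetric] ksign_square sum_distrib_left)
  also have "(\<Sum>u\<in>T. ksign v T * (ksign u (insert v T - {u}) * f (insert v T - {u}) p)) = - cobd (h v f) T p"
    unfolding cobd_def sum_negf[symmetric]
  proof (rule sum.cong[OF refl])
    fix u assume u: "u \<in> T"
    let ?A = "T - {u}"
    have eq: "insert v T - {u} = insert v ?A" "T = insert u ?A" using u False by auto
    have "ksign v (insert u ?A) * ksign u (insert v ?A) = - (ksign u ?A * ksign v ?A :: 'k)"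
      by (rule ksign_anticommute(1)) (use u False T in auto)
    then have "ksign v T * ksign u (insert v ?A) = - (ksign u ?A * ksign v ?A :: 'k)"
      unfolding eq(2)[symmetric] .
    then show "ksign v T * (ksign u (insert v T - {u}) * f (insert v T - {u}) p) =
      - (ksign u (T - {u}) * h v f (T - {u}) p)"
      using False unfolding eq(1) by (simp add: h_def mult.assoc[symmetric])
  qed
  finally show ?thesis by simp
qed

definition cochain :: "(nat set \<Rightarrow> (nat \<Rightarrow> 'k) set) \<Rightarrow> nat set \<Rightarrow> nat \<Rightarrow> (nat set \<Rightarrow> nat \<Rightarrow> 'k) \<Rightarrow> bool" where
  "cochain Z W m f \<longleftrightarrow> (\<forall>T\<subseteq>W. card T = m \<longrightarrow> f T \<in> Z T)"

text \<open>Exactness at sets of size \<open>m + 1\<close> of the Koszul complex of \<open>Z\<close> in multidegree \<open>W\<close>; a set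
  \<open>T \<subseteq> W\<close> stands for the exterior monomial with support \<open>W - T\<close>.\<close>

definition acyclic_at :: "(nat set \<Rightarrow> (nat \<Rightarrow> 'k::comm_ring_1) set) \<Rightarrow> nat set \<Rightarrow> nat \<Rightarrow> bool" where
  "acyclic_at Z W m \<longleftrightarrow> (\<forall>f. cochain Z W (Suc m) f \<longrightarrow>
     (\<forall>T\<subseteq>W. card T = Suc (Suc m) \<longrightarrow> (\<forall>p. cobd f T p = 0)) \<longrightarrow>
     (\<exists>g. cochain Z W m g \<and> (\<forall>T\<subseteq>W. card T = Suc m \<longrightarrow> (\<forall>p. cobd g T p = f T p))))"

lemma acyclic_atD:
  assumes "acyclic_at Z W m" "cochain Z W (Suc m) f"
    "\<And>T p. T \<subseteq> W \<Longrightarrow> card T = Suc (Suc m) \<Longrightarrow> cobd f T p = 0"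
  obtains g where "cochain Z W m g" "\<And>T p. T \<subseteq> W \<Longrightarrow> card T = Suc m \<Longrightarrow> cobd g T p = f T p"
  using assms unfolding acyclic_at_def by metis

lemma cobd_in_subsp:
  assumes "subsp S" "\<And>v. v \<in> T \<Longrightarrow> f (T - {v}) \<in> S"
  shows "cobd f T \<in> S"
  using subsp_sum[OF assms(1), of T "\<lambda>v. f (T - {v})" "\<lambda>v. ksign v (T - {v})"] assms(2)
  by (simp add: cobd_def[abs_def])

lemma cochain_cobd:
  assumes "cochain Z W m f" "finite W" "\<And>T. T \<subseteq> W \<Longrightarrow> subsp (Z T)"
    "\<And>U T. U \<subseteq> T \<Longrightarrow> T \<subseteq> W \<Longrightarrow> Z U \<subseteq> Z T"
  shows "cochain Z W (Suc m) (cobd f)"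
  unfolding cochain_def
proof (intro allI impI)
  fix T assume T: "T \<subseteq> W" "card T = Suc m"
  show "cobd f T \<in> Z T"
  proof (rule cobd_in_subsp[OF assms(3)[OF T(1)]])
    fix v assume "v \<in> T"
    then have "f (T - {v}) \<in> Z (T - {v})" using assms(1) T unfolding cochain_def
      by (metis Diff_subset card_Diff_singleton diff_Suc_1 subset_trans)
    then show "f (T - {v}) \<in> Z T" using assms(4)[of "T - {v}" T] T by auto
  qed
qed

lemma lin_comb_cobd: "lin_comb J c (cobd f T) p = cobd (\<lambda>U. lin_comb J c (f U)) T p"
  unfolding cobd_def[abs_def] lin_comb_sum ..

lemma cochain_lift:
  assumes "cochain Z W m f" "\<And>T. T \<subseteq> W \<Longrightarrow> Z T = lin_comb J c ` graded_part J s T"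
  obtains F where "\<And>T. T \<subseteq> W \<Longrightarrow> card T = m \<Longrightarrow> F T \<in> graded_part J s T \<and> lin_comb J c (F T) = f T"
proof -
  have "\<exists>y. y \<in> graded_part J s T \<and> lin_comb J c y = f T" if T: "T \<subseteq> W" "card T = m" for T
  proof -
    have "f T \<in> lin_comb J c ` graded_part J s T"
      using assms(1) T unfolding cochain_def assms(2)[OF T(1), symmetric] by simp
    then show ?thesis by auto
  qed
  then show ?thesis using that by metis
qed

section \<open>Koszul complexes of free modules and dimension shifting\<close>

lemma free_acyclic:
  fixes f :: "nat set \<Rightarrow> nat \<Rightarrow> 'k::comm_ring_1"
  assumes W: "finite W" and f: "cochain (graded_part J s) W (Suc m) f"
    and cocycle: "\<And>T p. T \<subseteq> W \<Longrightarrow> card T = Suc (Suc m) \<Longrightarrow> cobd f T p = 0"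
    and top: "\<And>T q. T \<subseteq> W \<Longrightarrow> card T = Suc m \<Longrightarrow> f T q \<noteq> 0 \<Longrightarrow> s q \<noteq> W"
  obtains g where "cochain (graded_part J s) W m g"
    "\<And>T p. T \<subseteq> W \<Longrightarrow> card T = Suc m \<Longrightarrow> cobd g T p = f T p"
proof -
  have "\<exists>v. v \<in> W - s q" if "s q \<subset> W" for q using that by auto
  \<comment> \<open>In the summand of generator \<open>q\<close> only sets containing
    \<open>s q\<close> occur, which is a full simplex on \<open>W - s q\<close>. If that is
    nonempty, any vertex of it serves as apex; the assumption \<open>top\<close> excludes the case
    \<open>s q = W\<close>.\<close>
  then obtain v where v: "\<And>q. s q \<subset> W \<Longrightarrow> v q \<in> W - s q" by metis
  define g where "g T q = (if s q \<subset> W \<and> v q \<notin> T then ksign (v q) T * f (insert (v q) T) q else 0)" for T q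
  show ?thesis
  proof (rule that[of g])
    show "cochain (graded_part J s) W m g"
      unfolding cochain_def
    proof (intro allI impI)
      fix T assume T: "T \<subseteq> W" "card T = m"
      have "q \<in> J \<and> s q \<subseteq> T" if q: "g T q \<noteq> 0" for q
      proof -
        have a: "s q \<subset> W" "v q \<notin> T" "f (insert (v q) T) q \<noteq> 0" using q by (auto simp: g_def split: if_splits)
        have "insert (v q) T \<subseteq> W" "card (insert (v q) T) = Suc m"
          using T v[OF a(1)] a(2) finite_subset[OF T(1) W] by auto
        then have "f (insert (v q) T) \<in> graded_part J s (insert (v q) T)"
          using f by (simp add: cochain_def)
        then have "q \<in> J \<and> s q \<subseteq> insert (v q) T" using a(3) by (rule graded_partD)
        \<comment> \<open>The apex is not in \<open>s q\<close>, so removing it from the set keeps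
          \<open>s q\<close> inside.\<close>
        then show ?thesis using v[OF a(1)] by auto
      qed
      then show "g T \<in> graded_part J s T" by (auto simp: graded_part_def)
    qed
  next
    fix T q assume T: "T \<subseteq> W" "card T = Suc m"
    have fT: "finite T" using finite_subset[OF T(1) W] .
    show "cobd g T q = f T q"
    proof (cases "s q \<subset> W")
      case True
      have "cobd g T q = cobd (\<lambda>T p. if v q \<in> T then 0 else ksign (v q) T * f (insert (v q) T) p) T q"
        by (rule cobd_cong) (use True in \<open>simp add: g_def\<close>)
      moreover have "(if v q \<in> T then 0 else ksign (v q) T * cobd f (insert (v q) T) q) = 0"
        using cocycle[of "insert (v q) T" q] v[OF True] T fT by auto
      ultimately show ?thesis using cone_homotopy[OF fT, of "v q" f q] by simp
    next
      case False
      then have "f T q = 0"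
        using f T top[OF T, of q] by (auto simp: cochain_def graded_part_def)
      moreover have "cobd g T q = 0" by (rule cobd_eq_0) (use False in \<open>auto simp: g_def\<close>)
      ultimately show ?thesis by simp
    qed
  qed
qed

text \<open>The chase for the connecting map of \<open>0 -> Z' -> F -> Z -> 0\<close> with
  \<open>F\<close> free. In degree \<open>W\<close> the complex of \<open>F\<close> has homology
  only from generators of degree \<open>W\<close>, located at the set \<open>W\<close>;
  \<open>min\<close> keeps them out of one direction, \<open>Suc m < card W\<close> out of the
  other.\<close>

lemma acyclic_shift:
  fixes Z :: "nat set \<Rightarrow> (nat \<Rightarrow> 'k::field_char_0) set"
  assumes W: "finite W" and m: "Suc m < card W"
    and Z: "\<And>T. T \<subseteq> W \<Longrightarrow> Z T = lin_comb J c ` graded_part J s T"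
    and Z': "\<And>T. Z' T = {y \<in> graded_part J s T. \<forall>p. lin_comb J c y p = 0}"
    and min: "\<And>y q. y \<in> Z' W \<Longrightarrow> y q \<noteq> 0 \<Longrightarrow> s q \<noteq> W"
  shows "acyclic_at Z W m \<longleftrightarrow> acyclic_at Z' W (Suc m)"
proof
  assume ac: "acyclic_at Z W m"
  show "acyclic_at Z' W (Suc m)"
    unfolding acyclic_at_def
  proof (intro allI impI)
    fix f assume f: "cochain Z' W (Suc (Suc m)) f"
      and coc: "\<forall>T\<subseteq>W. card T = Suc (Suc (Suc m)) \<longrightarrow> (\<forall>p. cobd f T p = 0)"
    have f': "cochain (graded_part J s) W (Suc (Suc m)) f" using f by (simp add: cochain_def Z')
    have top: "s q \<noteq> W" if "T \<subseteq> W" "card T = Suc (Suc m)" "f T q \<noteq> 0" for T q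
    proof
      assume sq: "s q = W"
      have "f T \<in> Z' T" using f that by (auto simp: cochain_def)
      moreover then have "s q \<subseteq> T" using that by (auto simp: Z' graded_part_def)
      ultimately show False using min[of "f T" q] that sq by auto
    qed
    obtain g where g: "cochain (graded_part J s) W (Suc m) g"
      "\<And>T p. T \<subseteq> W \<Longrightarrow> card T = Suc (Suc m) \<Longrightarrow> cobd g T p = f T p"
      by (rule free_acyclic[OF W f' coc[rule_format]]) (assumption | erule (2) top | (rule that; blast))+
    have cg: "cochain Z W (Suc m) (\<lambda>T. lin_comb J c (g T))"
      using g(1) Z by (auto simp: cochain_def)
    obtain h where h: "cochain Z W m h" "\<And>T p. T \<subseteq> W \<Longrightarrow> card T = Suc m \<Longrightarrow> cobd h T p = lin_comb J c (g T) p"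
    proof (rule acyclic_atD[OF ac cg])
      fix T p assume T: "T \<subseteq> W" "card T = Suc (Suc m)"
      have "f T \<in> Z' T" using f T by (auto simp: cochain_def)
      moreover have "cobd g T = f T" using g(2)[OF T] by auto
      ultimately show "cobd (\<lambda>T. lin_comb J c (g T)) T p = 0"
        by (simp add: lin_comb_cobd[symmetric] Z')
    qed blast
    obtain H where H: "\<And>T. T \<subseteq> W \<Longrightarrow> card T = m \<Longrightarrow> H T \<in> graded_part J s T \<and> lin_comb J c (H T) = h T"
      by (rule cochain_lift[OF h(1) Z]) (assumption | (rule that; blast))+
    have Hc: "cochain (graded_part J s) W m H" using H by (simp add: cochain_def)
    have dH: "cochain (graded_part J s) W (Suc m) (cobd H)"
      by (rule cochain_cobd[OF Hc W subsp_graded_part graded_part_mono])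
    \<comment> \<open>The image of \<open>g\<close> is a cocycle of \<open>Z\<close>, hence the
      coboundary of \<open>h\<close>. Subtracting the coboundary of a lift of \<open>h\<close> moves
      \<open>g\<close> into the kernel without changing its coboundary.\<close>
    define G where "G T q = g T q - cobd H T q" for T q
    have "cochain Z' W (Suc m) G" unfolding cochain_def
    proof (intro allI impI)
      fix T assume T: "T \<subseteq> W" "card T = Suc m"
      have "G T \<in> graded_part J s T"
        using subsp_diff[OF subsp_graded_part, of "g T" J s T "cobd H T"] g(1) dH T
        by (auto simp: cochain_def G_def[abs_def])
      moreover have "lin_comb J c (G T) p = 0" for p
      proof -
        have "cobd (\<lambda>U. lin_comb J c (H U)) T p = cobd h T p"
        proof (rule cobd_cong)
          fix v assume "v \<in> T"
          then have "T - {v} \<subseteq> W" "card (T - {v}) = m" using T by auto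
          then show "lin_comb J c (H (T - {v})) p = h (T - {v}) p" using H by simp
        qed
        then show ?thesis using h(2)[OF T] by (simp add: G_def[abs_def] lin_comb_diff lin_comb_cobd)
      qed
      ultimately show "G T \<in> Z' T" by (simp add: Z')
    qed
    moreover have "cobd G T p = f T p" if "T \<subseteq> W" "card T = Suc (Suc m)" for T p
      using g(2)[OF that] cobd_cobd[OF finite_subset[OF that(1) W]] by (simp add: G_def[abs_def] cobd_diff)
    ultimately show "\<exists>g. cochain Z' W (Suc m) g \<and> (\<forall>T\<subseteq>W. card T = Suc (Suc m) \<longrightarrow> (\<forall>p. cobd g T p = f T p))"
      by blast
  qed
next
  assume ac: "acyclic_at Z' W (Suc m)"
  show "acyclic_at Z W m"
    unfolding acyclic_at_def
  proof (intro allI impI)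
    fix f assume f: "cochain Z W (Suc m) f"
      and coc: "\<forall>T\<subseteq>W. card T = Suc (Suc m) \<longrightarrow> (\<forall>p. cobd f T p = 0)"
    obtain F where F: "\<And>T. T \<subseteq> W \<Longrightarrow> card T = Suc m \<Longrightarrow> F T \<in> graded_part J s T \<and> lin_comb J c (F T) = f T"
      by (rule cochain_lift[OF f Z]) (assumption | (rule that; blast))+
    have Fc: "cochain (graded_part J s) W (Suc m) F" using F by (simp add: cochain_def)
    have dF: "cochain (graded_part J s) W (Suc (Suc m)) (cobd F)"
      by (rule cochain_cobd[OF Fc W subsp_graded_part graded_part_mono])
    have "cochain Z' W (Suc (Suc m)) (cobd F)" unfolding cochain_def
    proof (intro allI impI)
      fix T assume T: "T \<subseteq> W" "card T = Suc (Suc m)"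
      have "lin_comb J c (cobd F T) p = 0" for p
      proof -
        have "cobd (\<lambda>U. lin_comb J c (F U)) T p = cobd f T p"
        proof (rule cobd_cong)
          fix v assume "v \<in> T"
          then have "T - {v} \<subseteq> W" "card (T - {v}) = Suc m" using T by auto
          then show "lin_comb J c (F (T - {v})) p = f (T - {v}) p" using F by simp
        qed
        then show ?thesis using coc T by (simp add: lin_comb_cobd)
      qed
      then show "cobd F T \<in> Z' T" using dF T by (auto simp: cochain_def Z')
    qed
    moreover have "cobd (cobd F) T p = 0" if "T \<subseteq> W" for T p
      by (rule cobd_cobd[OF finite_subset[OF that W]])
    ultimately obtain G where G: "cochain Z' W (Suc m) G"
      "\<And>T p. T \<subseteq> W \<Longrightarrow> card T = Suc (Suc m) \<Longrightarrow> cobd G T p = cobd F T p"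
      using acyclic_atD[OF ac, of "cobd F"] by metis
    \<comment> \<open>The lift \<open>F\<close> need not be a cocycle, but its coboundary is a
      cocycle of \<open>Z'\<close> and so the coboundary of some \<open>G\<close> there. The
      difference is a cocycle that still maps to \<open>f\<close>.\<close>
    define D where "D T q = F T q - G T q" for T q
    have D: "cochain (graded_part J s) W (Suc m) D"
      using Fc G(1) unfolding cochain_def D_def[abs_def] by (auto intro!: subsp_diff[OF subsp_graded_part] simp: Z')
    have top: "s q \<noteq> W" if "T \<subseteq> W" "card T = Suc m" "D T q \<noteq> 0" for T q
    proof
      assume "s q = W"
      then have "W \<subseteq> T" using D that by (auto simp: cochain_def graded_part_def)
      then show False using that m by auto
    qed
    obtain h where h: "cochain (graded_part J s) W m h"
      "\<And>T p. T \<subseteq> W \<Longrightarrow> card T = Suc m \<Longrightarrow> cobd h T p = D T p"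
      by (rule free_acyclic[OF W D _ top]) (use G(2) in \<open>auto simp: D_def[abs_def] cobd_diff\<close>)
    have "cochain Z W m (\<lambda>T. lin_comb J c (h T))" using h(1) Z by (auto simp: cochain_def)
    moreover have "cobd (\<lambda>T. lin_comb J c (h T)) T p = f T p" if T: "T \<subseteq> W" "card T = Suc m" for T p
    proof -
      have "cobd (\<lambda>T. lin_comb J c (h T)) T p = lin_comb J c (cobd h T) p" by (simp add: lin_comb_cobd)
      also have "cobd h T = D T" using h(2)[OF T] by auto
      also have "lin_comb J c (D T) p = f T p"
        using F[OF T] G(1) T by (auto simp: D_def[abs_def] lin_comb_diff cochain_def Z')
      finally show ?thesis .
    qed
    ultimately show "\<exists>g. cochain Z W m g \<and> (\<forall>T\<subseteq>W. card T = Suc m \<longrightarrow> (\<forall>p. cobd g T p = f T p))" by blast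
  qed
qed

text \<open>At the top position only \<open>T = W\<close> occurs, so exactness says that
  \<open>Z W\<close> is the sum of the \<open>Z (W - {v})\<close>. This is Tor in homological degree
  0, which counts minimal generators.\<close>

lemma generator_iff_not_acyclic:
  fixes Z :: "nat set \<Rightarrow> (nat \<Rightarrow> 'k::comm_ring_1) set"
  assumes W: "finite W" and m: "Suc m = card W" and J: "finite J"
    and Z: "\<And>T. T \<subseteq> W \<Longrightarrow> Z T = lin_comb J c ` graded_part J s T"
    and min: "\<And>y q. y \<in> graded_part J s W \<Longrightarrow> (\<And>p. lin_comb J c y p = 0) \<Longrightarrow> y q \<noteq> 0 \<Longrightarrow> s q \<noteq> W"
  shows "(\<exists>q\<in>J. s q = W) \<longleftrightarrow> \<not> acyclic_at Z W m"
proof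
  assume "\<exists>q\<in>J. s q = W"
  then obtain q where q: "q \<in> J" "s q = W" by blast
  define e where "e r = (if r = q then 1 else 0 :: 'k)" for r
  have e: "e \<in> graded_part J s W" using q by (auto simp: graded_part_def e_def)
  have TW: "T = W" if "T \<subseteq> W" "card T = Suc m" for T
    using that m W by (metis card_subset_eq)
  have none: "\<not> (T \<subseteq> W \<and> card T = Suc (Suc m))" for T
    using card_mono[OF W, of T] m by auto
  show "\<not> acyclic_at Z W m"
  proof
    assume ac: "acyclic_at Z W m"
    have "cochain Z W (Suc m) (\<lambda>_. lin_comb J c e)"
      using e Z[of W] TW by (auto simp: cochain_def)
    then obtain g where g: "cochain Z W m g" "\<And>T p. T \<subseteq> W \<Longrightarrow> card T = Suc m \<Longrightarrow> cobd g T p = lin_comb J c e p"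
      by (rule acyclic_atD[OF ac]) (use none in blast)+
    obtain H where H: "\<And>T. T \<subseteq> W \<Longrightarrow> card T = m \<Longrightarrow> H T \<in> graded_part J s T \<and> lin_comb J c (H T) = g T"
      by (rule cochain_lift[OF g(1) Z]) (assumption | (rule that; blast))+
    have HW: "H (W - {v}) \<in> graded_part J s (W - {v})" "lin_comb J c (H (W - {v})) = g (W - {v})" if "v \<in> W" for v
      using H[of "W - {v}"] that m by auto
    have dH: "cobd H W \<in> graded_part J s W"
      by (rule cobd_in_subsp[OF subsp_graded_part]) (use HW(1) graded_part_mono[of _ W J s] in blast)
    \<comment> \<open>This would be a relation in degree \<open>W\<close> with coefficient 1 at
      \<open>q\<close>, against minimality: the correction has no coordinate at \<open>q\<close>,
      because \<open>s q = W\<close> does not fit into any \<open>W - {v}\<close>.\<close>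
    define y where "y r = e r - cobd H W r" for r
    have y: "y \<in> graded_part J s W"
      unfolding y_def[abs_def] by (rule subsp_diff[OF subsp_graded_part e dH])
    have "lin_comb J c y p = 0" for p
    proof -
      have "cobd (\<lambda>U. lin_comb J c (H U)) W p = cobd g W p"
        by (rule cobd_cong) (simp add: HW)
      then show ?thesis using g(2)[of W p] m by (simp add: y_def[abs_def] lin_comb_diff lin_comb_cobd)
    qed
    moreover have "cobd H W q = 0"
    proof (rule cobd_eq_0)
      fix v assume v: "v \<in> W"
      then have "\<not> s q \<subseteq> W - {v}" using q by auto
      then show "H (W - {v}) q = 0" using HW(1)[OF v] by (auto simp: graded_part_def)
    qed
    ultimately show False using min[OF y, of q] q(2) by (simp add: y_def e_def)
  qed
next
  assume "\<not> acyclic_at Z W m"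
  then obtain f where f: "cochain Z W (Suc m) f"
    and nog: "\<not> (\<exists>g. cochain Z W m g \<and> (\<forall>T\<subseteq>W. card T = Suc m \<longrightarrow> (\<forall>p. cobd g T p = f T p)))"
    unfolding acyclic_at_def not_all not_imp by (elim exE conjE) (rule that)
  have no: "\<And>g. cochain Z W m g \<Longrightarrow> \<exists>T\<subseteq>W. card T = Suc m \<and> (\<exists>p. cobd g T p \<noteq> f T p)"
    using nog by blast
  have "f W \<in> lin_comb J c ` graded_part J s W" using f m Z[of W] by (auto simp: cochain_def)
  then obtain y where y: "y \<in> graded_part J s W" "f W = lin_comb J c y" by blast
  show "\<exists>q\<in>J. s q = W"
  proof (rule ccontr)
    assume none: "\<not> (\<exists>q\<in>J. s q = W)"
    have TW: "T = W" if "T \<subseteq> W" "card T = Suc m" for T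
      using that m W by (metis card_subset_eq)
    have c: "cochain (graded_part J s) W (Suc m) (\<lambda>_. y)"
      using y TW by (auto simp: cochain_def)
    obtain g where g: "cochain (graded_part J s) W m g"
      "\<And>T p. T \<subseteq> W \<Longrightarrow> card T = Suc m \<Longrightarrow> cobd g T p = y p"
    proof (rule free_acyclic[OF W c])
      fix T p assume "T \<subseteq> W" "card T = Suc (Suc m)"
      then show "cobd (\<lambda>_. y) T p = 0" using card_mono[OF W, of T] m by auto
    next
      fix q assume "y q \<noteq> 0" then show "s q \<noteq> W" using none y(1) by (auto simp: graded_part_def)
    qed blast
    have "cochain Z W m (\<lambda>T. lin_comb J c (g T))" using g(1) Z by (auto simp: cochain_def)
    from no[OF this] obtain p where "cobd (\<lambda>T. lin_comb J c (g T)) W p \<noteq> f W p" using TW by blast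
    moreover have "cobd (\<lambda>T. lin_comb J c (g T)) W p = f W p"
    proof -
      have "cobd g W = y" using g(2)[of W] m by auto
      then show ?thesis by (simp add: lin_comb_cobd[symmetric] y)
    qed
    ultimately show False by simp
  qed
qed

text \<open>The ideal inside the ring, where coordinate 0 stands for the basis element 1. Cochains
  with these values are the relative cochains of the simplex modulo the complex of faces.\<close>

definition nonface_part :: "('v set \<Rightarrow> bool) \<Rightarrow> 'v set \<Rightarrow> (nat \<Rightarrow> 'k::zero) set" where
  "nonface_part N W = {x. \<forall>p. x p \<noteq> 0 \<longrightarrow> p = 0 \<and> N W}"

lemma subsp_nonface_part: "subsp (nonface_part N W :: (nat \<Rightarrow> 'a::comm_ring_1) set)"
proof -
  have "x q \<noteq> 0 \<or> y q \<noteq> 0" if "x q + y q \<noteq> 0" for x y :: "nat \<Rightarrow> 'a" and q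
    using that by auto
  then show ?thesis unfolding subsp_def nonface_part_def by (auto dest: mult_not_zero) blast+
qed

text \<open>The reduced cohomology of a disjoint union of two complexes is the direct sum of their cohomologies
  in positive degrees.\<close>

lemma acyclic_join:
  fixes N :: "nat set \<Rightarrow> bool"
  defines "Z \<equiv> nonface_part N :: nat set \<Rightarrow> (nat \<Rightarrow> 'k::field_char_0) set"
  assumes fin: "finite W1" "finite W2" and ne: "W1 \<noteq> {}" "W2 \<noteq> {}" and disj: "W1 \<inter> W2 = {}"
    and join: "\<And>T. T \<subseteq> W1 \<union> W2 \<Longrightarrow> \<not> T \<subseteq> W1 \<Longrightarrow> \<not> T \<subseteq> W2 \<Longrightarrow> N T"
    and ac: "acyclic_at Z W1 (Suc (Suc m))" "acyclic_at Z W2 (Suc (Suc m))"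
  shows "acyclic_at Z (W1 \<union> W2) (Suc (Suc m))"
  unfolding acyclic_at_def
proof (intro allI impI)
  \<comment> \<open>\<open>?k\<close> is the ring itself, so its cochains are all cochains of the
    full simplex, which is acyclic. The primitive \<open>g\<close> of \<open>f\<close> restricts to
    a cocycle on faces, as in the isomorphism between relative and ordinary cohomology.\<close>
  let ?W = "W1 \<union> W2" and ?k = "graded_part {0} (\<lambda>_. {}) :: nat set \<Rightarrow> (nat \<Rightarrow> 'k) set"
  have Zk: "Z T \<subseteq> ?k T" for T by (auto simp: Z_def nonface_part_def graded_part_def)
  fix f assume f: "cochain Z ?W (Suc (Suc (Suc m))) f"
    and coc: "\<forall>T\<subseteq>?W. card T = Suc (Suc (Suc (Suc m))) \<longrightarrow> (\<forall>p. cobd f T p = 0)"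
  have fk: "cochain ?k ?W (Suc (Suc (Suc m))) f" using f Zk unfolding cochain_def by blast
  obtain g where g: "cochain ?k ?W (Suc (Suc m)) g"
      "\<And>T p. T \<subseteq> ?W \<Longrightarrow> card T = Suc (Suc (Suc m)) \<Longrightarrow> cobd g T p = f T p"
  proof (rule free_acyclic[OF _ fk coc[rule_format]])
    show "finite ?W" using fin by simp
    show "{} \<noteq> ?W" using ne by simp
  qed blast+
  have part: "\<exists>h. cochain ?k W (Suc m) h \<and>
      (\<forall>T\<subseteq>W. card T = Suc (Suc m) \<longrightarrow> (\<lambda>p. g T p - cobd h T p) \<in> Z T)"
    if W: "finite W" "W \<noteq> {}" "W \<subseteq> ?W" and acW: "acyclic_at Z W (Suc (Suc m))" for W
  proof -
    have sub: "T \<subseteq> ?W" if "T \<subseteq> W" for T using W that by blast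
    obtain g1 where g1: "cochain Z W (Suc (Suc m)) g1"
       "\<And>T p. T \<subseteq> W \<Longrightarrow> card T = Suc (Suc (Suc m)) \<Longrightarrow> cobd g1 T p = f T p"
    proof (rule acyclic_atD[OF acW])
      show "cochain Z W (Suc (Suc (Suc m))) f" using f sub unfolding cochain_def by blast
    next
      fix T p assume "T \<subseteq> W" "card T = Suc (Suc (Suc (Suc m)))"
      then show "cobd f T p = 0" using coc sub by blast
    qed blast
    have c: "cochain ?k W (Suc (Suc m)) (\<lambda>T p. g T p - g1 T p)"
      unfolding cochain_def using g(1) g1(1) Zk sub
      by (auto intro!: subsp_diff[OF subsp_graded_part] simp: cochain_def dest: subsetD[OF Zk])
    obtain h where h: "cochain ?k W (Suc m) h"
      "\<And>T p. T \<subseteq> W \<Longrightarrow> card T = Suc (Suc m) \<Longrightarrow> cobd h T p = g T p - g1 T p"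
    proof (rule free_acyclic[OF W(1) c])
      fix T p assume T: "T \<subseteq> W" "card T = Suc (Suc (Suc m))"
      show "cobd (\<lambda>T p. g T p - g1 T p) T p = 0"
        unfolding cobd_diff using g(2)[OF sub[OF T(1)] T(2)] g1(2)[OF T] by simp
    qed (use W in auto)
    have "(\<lambda>p. g T p - cobd h T p) \<in> Z T" if T: "T \<subseteq> W" "card T = Suc (Suc m)" for T
    proof -
      have "(\<lambda>p. g T p - cobd h T p) = g1 T" using h(2)[OF T] by auto
      then show ?thesis using g1(1) T by (auto simp: cochain_def)
    qed
    then show ?thesis using h(1) by blast
  qed
  obtain h1 where h1: "cochain ?k W1 (Suc m) h1"
      "\<And>T. T \<subseteq> W1 \<Longrightarrow> card T = Suc (Suc m) \<Longrightarrow> (\<lambda>p. g T p - cobd h1 T p) \<in> Z T"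
    using part[OF fin(1) ne(1) _ ac(1)] by auto
  obtain h2 where h2: "cochain ?k W2 (Suc m) h2"
      "\<And>T. T \<subseteq> W2 \<Longrightarrow> card T = Suc (Suc m) \<Longrightarrow> (\<lambda>p. g T p - cobd h2 T p) \<in> Z T"
    using part[OF fin(2) ne(2) _ ac(2)] by auto
  \<comment> \<open>On each part \<open>g\<close> becomes a relative cochain after subtracting a
    coboundary. The two choices are glued, with 0 on mixed sets; there \<open>join\<close> makes
    every value of the corrected \<open>g\<close> admissible.\<close>
  define h where "h T p = (if T \<subseteq> W1 then h1 T p else if T \<subseteq> W2 then h2 T p else 0)" for T p
  define G where "G T p = g T p - cobd h T p" for T p
  have hk: "cochain ?k ?W (Suc m) h"
    unfolding cochain_def
  proof (intro allI impI)
    fix T assume T: "T \<subseteq> ?W" "card T = Suc m"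
    have "h T = (if T \<subseteq> W1 then h1 T else if T \<subseteq> W2 then h2 T else (\<lambda>_. 0))"
      by (simp add: h_def fun_eq_iff)
    moreover have "T \<subseteq> W1 \<Longrightarrow> h1 T \<in> ?k T" "T \<subseteq> W2 \<Longrightarrow> h2 T \<in> ?k T"
      using h1(1) h2(1) T(2) by (simp_all add: cochain_def)
    moreover have "(\<lambda>_. 0) \<in> ?k T" by (rule subsp_zero[OF subsp_graded_part])
    ultimately show "h T \<in> ?k T" by simp
  qed
  have dhk: "cochain ?k ?W (Suc (Suc m)) (cobd h)"
    by (rule cochain_cobd[OF hk _ subsp_graded_part graded_part_mono]) (use fin in auto)
  have "cochain Z ?W (Suc (Suc m)) G"
    unfolding cochain_def
  proof (intro allI impI)
    fix T assume T: "T \<subseteq> ?W" "card T = Suc (Suc m)"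
    \<comment> \<open>This needs sets of size at least 2: \<open>T - {v}\<close> is nonempty, so it
      cannot lie in both parts. One position lower it could be empty, and \<open>h1\<close> and
      \<open>h2\<close> would have to agree there; that is the extra class in degree 0.\<close>
    have ne: "T - {v} \<noteq> {}" if "v \<in> T" for v
      using T that by (metis card.empty card_Diff_singleton diff_Suc_1 nat.simps(3))
    consider "T \<subseteq> W1" | "T \<subseteq> W2" "\<not> T \<subseteq> W1" | "\<not> T \<subseteq> W1" "\<not> T \<subseteq> W2" by blast
    then show "G T \<in> Z T"
    proof cases
      case 1
      have "cobd h T p = cobd h1 T p" for p
        by (rule cobd_cong) (use 1 in \<open>auto simp: h_def\<close>)
      then show ?thesis using h1(2)[OF 1 T(2)] by (simp add: G_def[abs_def])
    next
      case 2
      have "cobd h T p = cobd h2 T p" for p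
      proof (rule cobd_cong)
        fix v assume "v \<in> T"
        then have "\<not> T - {v} \<subseteq> W1" using ne[of v] 2 disj by blast
        then show "h (T - {v}) p = h2 (T - {v}) p" using 2 by (auto simp: h_def)
      qed
      then show ?thesis using h2(2)[OF 2(1) T(2)] by (simp add: G_def[abs_def])
    next
      case 3
      then have "N T" using join T by blast
      moreover have "G T \<in> ?k T" unfolding G_def[abs_def]
        by (rule subsp_diff[OF subsp_graded_part]) (use g(1) dhk T in \<open>auto simp: cochain_def\<close>)
      ultimately show ?thesis by (auto simp: Z_def nonface_part_def graded_part_def)
    qed
  qed
  moreover have "cobd G T p = f T p" if "T \<subseteq> ?W" "card T = Suc (Suc (Suc m))" for T p
  proof -
    have "finite T" using finite_subset[OF that(1)] fin by auto
    then show ?thesis using g(2)[OF that] cobd_cobd by (simp add: G_def[abs_def] cobd_diff)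
  qed
  ultimately show "\<exists>g. cochain Z ?W (Suc (Suc m)) g \<and>
      (\<forall>T\<subseteq>?W. card T = Suc (Suc (Suc m)) \<longrightarrow> (\<forall>p. cobd g T p = f T p))" by blast
qed

section \<open>Squarefree resolutions\<close>

text \<open>Level \<open>0\<close> is the monomial ideal itself, whose part in multidegree \<open>W\<close> is a line if \<open>W\<close> is a nonface and
  \<open>0\<close> otherwise.\<close>

definition syzygies :: "('v set \<Rightarrow> bool) \<Rightarrow> (nat \<Rightarrow> nat set) \<Rightarrow> (nat \<Rightarrow> nat \<Rightarrow> 'v set) \<Rightarrow>
    (nat \<Rightarrow> nat \<Rightarrow> nat \<Rightarrow> 'k) \<Rightarrow> nat \<Rightarrow> 'v set \<Rightarrow> (nat \<Rightarrow> 'k::comm_ring_1) set" where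
  "syzygies N J s C i W = (case i of 0 \<Rightarrow> nonface_part N W
     | Suc i \<Rightarrow> {y \<in> graded_part (J (Suc i)) (s (Suc i)) W. \<forall>p. lin_comb (J (Suc i)) (C i) y p = 0})"

text \<open>Level 0 is the ring, with one generator of degree the empty set. The proper inclusion in
  \<open>strict\<close> encodes both multihomogeneity and minimality: the monomial factor of a
  nonzero entry is never 1.\<close>

locale squarefree_resolution =
  fixes V :: "'v set" and N :: "'v set \<Rightarrow> bool" and J :: "nat \<Rightarrow> nat set"
    and s :: "nat \<Rightarrow> nat \<Rightarrow> 'v set" and C :: "nat \<Rightarrow> nat \<Rightarrow> nat \<Rightarrow> 'k::comm_ring_1"
  assumes finite_V: "finite V" and not_N_empty: "\<not> N {}"
    and J_0: "J 0 = {0}" and s_0: "s 0 0 = {}"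
    and finite_J: "\<And>i. finite (J i)"
    and s_subset: "\<And>i q. q \<in> J i \<Longrightarrow> s i q \<subseteq> V"
    and strict: "\<And>i q p. q \<in> J (Suc i) \<Longrightarrow> C i q p \<noteq> 0 \<Longrightarrow> p \<in> J i \<and> s i p \<subset> s (Suc i) q"
    and exact: "\<And>i W. W \<subseteq> V \<Longrightarrow> syzygies N J s C i W =
      lin_comb (J (Suc i)) (C i) ` graded_part (J (Suc i)) (s (Suc i)) W"

lemma squarefree_resolution_exists:
  fixes N :: "'v set \<Rightarrow> bool"
  assumes V: "finite V" and N: "\<not> N {}" and mono: "\<And>U W. U \<subseteq> W \<Longrightarrow> W \<subseteq> V \<Longrightarrow> N U \<Longrightarrow> N W"
  shows "\<exists>J s (C :: nat \<Rightarrow> nat \<Rightarrow> nat \<Rightarrow> 'k::field). squarefree_resolution V N J s C"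
proof -
  \<comment> \<open>A state holds the number, degrees and columns of the current generators and
    their syzygy spaces. The invariant that syzygies of degree \<open>W\<close> use only generators
    of strictly smaller degree becomes \<open>strict\<close> one level higher.\<close>
  define I :: "nat \<times> (nat \<Rightarrow> 'v set) \<times> (nat \<Rightarrow> nat \<Rightarrow> 'k) \<times> ('v set \<Rightarrow> (nat \<Rightarrow> 'k) set) \<Rightarrow> bool"
    where "I = (\<lambda>(m,t,c,Z). (\<forall>q<m. t q \<subseteq> V) \<and> (\<forall>W\<subseteq>V. subsp (Z W)) \<and>
      (\<forall>W\<subseteq>V. \<forall>x\<in>Z W. \<forall>p. x p \<noteq> 0 \<longrightarrow> p < m \<and> t p \<subset> W) \<and>
      (\<forall>W\<subseteq>V. \<forall>U\<subseteq>W. Z U \<subseteq> Z W))"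
  define Q :: "nat \<times> (nat \<Rightarrow> 'v set) \<times> (nat \<Rightarrow> nat \<Rightarrow> 'k) \<times> ('v set \<Rightarrow> (nat \<Rightarrow> 'k) set) \<Rightarrow> _ \<Rightarrow> bool"
    where "Q = (\<lambda>(m,t,c,Z) (m',t',c',Z'). (\<forall>q<m'. c' q \<in> Z (t' q)) \<and>
      (\<forall>W\<subseteq>V. Z W = lin_comb {..<m'} c' ` graded_part {..<m'} t' W) \<and>
      Z' = (\<lambda>W. {y \<in> graded_part {..<m'} t' W. \<forall>p. lin_comb {..<m'} c' y p = 0}))"
  \<comment> \<open>The ring with the ideal as its first syzygies. The columns are a dummy, so the
    columns of state \<open>Suc i\<close> play the role of \<open>C i\<close>.\<close>
  define base :: "nat \<times> (nat \<Rightarrow> 'v set) \<times> (nat \<Rightarrow> nat \<Rightarrow> 'k) \<times> ('v set \<Rightarrow> (nat \<Rightarrow> 'k) set)"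
    where "base = (1, \<lambda>_. {}, \<lambda>_ _. 0, nonface_part N)"
  have base: "I base"
  proof -
    have "p = 0 \<and> W \<noteq> {}" if "x \<in> nonface_part N W" "x p \<noteq> 0" for x :: "nat \<Rightarrow> 'k" and W p
      using that N by (auto simp: nonface_part_def)
    moreover have "nonface_part N U \<subseteq> (nonface_part N W :: (nat \<Rightarrow> 'k) set)" if "U \<subseteq> W" "W \<subseteq> V" for U W
      using mono[OF that] by (auto simp: nonface_part_def)
    ultimately show ?thesis
      unfolding I_def base_def by (simp add: subsp_nonface_part psubset_eq) blast
  qed
  have step: "\<exists>y. I y \<and> Q x y" if I: "I x" for x
  proof -
    obtain m t c Z where x: "x = (m,t,c,Z)" by (cases x)
    have i1: "\<And>W. W \<subseteq> V \<Longrightarrow> subsp (Z W)" and i2: "\<And>W x p. W \<subseteq> V \<Longrightarrow> x \<in> Z W \<Longrightarrow> x p \<noteq> 0 \<Longrightarrow> p \<in> {..<m}"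
      and i3: "\<And>U W. U \<subseteq> W \<Longrightarrow> W \<subseteq> V \<Longrightarrow> Z U \<subseteq> Z W"
      using I unfolding I_def x by auto
    obtain m' t' c' where g: "\<And>q. q < m' \<Longrightarrow> t' q \<subseteq> V" "\<And>q. q < m' \<Longrightarrow> c' q \<in> Z (t' q)"
      "\<And>W. W \<subseteq> V \<Longrightarrow> Z W = lin_comb {..<m'} c' ` graded_part {..<m'} t' W"
      "\<And>W y q. W \<subseteq> V \<Longrightarrow> y \<in> graded_part {..<m'} t' W \<Longrightarrow> lin_comb {..<m'} c' y = (\<lambda>_. 0) \<Longrightarrow>
          y q \<noteq> 0 \<Longrightarrow> t' q \<noteq> W"
      by (rule minimal_generators[OF V finite_lessThan i1 i2 i3]) (assumption | (rule that; assumption))+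
    define Z' where "Z' = (\<lambda>W. {y \<in> graded_part {..<m'} t' W. \<forall>p. lin_comb {..<m'} c' y p = 0})"
    have "Q x (m',t',c',Z')" unfolding Q_def x Z'_def using g(2,3) by simp
    moreover have "I (m',t',c',Z')"
    proof -
      have "subsp (Z' W)" for W
        using subsp_graded_part[of "{..<m'}" t' W]
        by (auto simp: Z'_def subsp_def lin_comb_add lin_comb_scale)
      moreover have "p < m' \<and> t' p \<subset> W" if W: "W \<subseteq> V" and y: "y \<in> Z' W" and p: "y p \<noteq> 0" for W y p
      proof -
        have "y \<in> graded_part {..<m'} t' W" "lin_comb {..<m'} c' y = (\<lambda>_. 0)"
          using y by (auto simp: Z'_def)
        then show ?thesis using g(4)[OF W] p graded_partD by blast
      qed
      moreover have "Z' U \<subseteq> Z' W" if "U \<subseteq> W" for U W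
        unfolding Z'_def using graded_part_mono[OF that] by blast
      ultimately show ?thesis unfolding I_def using g(1) by simp
    qed
    ultimately show ?thesis by blast
  qed
  have "\<exists>f. \<forall>n. (I (f n) \<and> (n = 0 \<longrightarrow> f n = base)) \<and> Q (f n) (f (Suc n))"
  proof (rule dependent_nat_choice)
    show "\<exists>x. I x \<and> (0 = 0 \<longrightarrow> x = base)" using base by blast
  next
    fix x and n :: nat assume "I x \<and> (n = 0 \<longrightarrow> x = base)"
    then show "\<exists>y. (I y \<and> (Suc n = 0 \<longrightarrow> y = base)) \<and> Q x y" using step by blast
  qed
  then obtain f where f: "\<And>n. I (f n)" "f 0 = base" "\<And>n. Q (f n) (f (Suc n))" by blast
  define m where "m i = fst (f i)" for i
  define t where "t i = fst (snd (f i))" for i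
  define c where "c i = fst (snd (snd (f i)))" for i
  define Z where "Z i = snd (snd (snd (f i)))" for i
  have fi: "f i = (m i, t i, c i, Z i)" for i by (simp add: m_def t_def c_def Z_def)
  have 0: "m 0 = 1" "t 0 = (\<lambda>_. {})" "Z 0 = nonface_part N"
    using f(2) by (auto simp: fi base_def)
  have inv: "\<And>i q. q < m i \<Longrightarrow> t i q \<subseteq> V"
     "\<And>i W x p. W \<subseteq> V \<Longrightarrow> x \<in> Z i W \<Longrightarrow> x p \<noteq> 0 \<Longrightarrow> p < m i \<and> t i p \<subset> W"
    using f(1) unfolding fi I_def by auto
  have step: "\<And>i q. q < m (Suc i) \<Longrightarrow> c (Suc i) q \<in> Z i (t (Suc i) q)"
    "\<And>i W. W \<subseteq> V \<Longrightarrow> Z i W = lin_comb {..<m (Suc i)} (c (Suc i)) ` graded_part {..<m (Suc i)} (t (Suc i)) W"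
    "\<And>i. Z (Suc i) = (\<lambda>W. {y \<in> graded_part {..<m (Suc i)} (t (Suc i)) W. \<forall>p. lin_comb {..<m (Suc i)} (c (Suc i)) y p = 0})"
    using f(3) unfolding fi Q_def by auto
  have Zsyz: "syzygies N (\<lambda>i. {..<m i}) t (\<lambda>i. c (Suc i)) i W = Z i W" for i W
    by (cases i) (simp_all add: syzygies_def 0 step(3))
  have "squarefree_resolution V N (\<lambda>i. {..<m i}) t (\<lambda>i. c (Suc i))"
  proof
    fix i q p assume q: "q \<in> {..<m (Suc i)}" and "c (Suc i) q p \<noteq> 0"
    then show "p \<in> {..<m i} \<and> t i p \<subset> t (Suc i) q"
      using inv(2)[OF inv(1) step(1)] by blast
  next
    fix i W assume "W \<subseteq> V"
    then show "syzygies N (\<lambda>i. {..<m i}) t (\<lambda>i. c (Suc i)) i W =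
      lin_comb {..<m (Suc i)} (c (Suc i)) ` graded_part {..<m (Suc i)} (t (Suc i)) W"
      unfolding Zsyz by (rule step(2))
  qed (use V N inv(1) in \<open>auto simp: 0\<close>)
  then show ?thesis by blast
qed

context squarefree_resolution
begin

text \<open>By exactness such an element combines columns of degree inside \<open>W\<close>, and
  each column involves only strictly smaller generators.\<close>

lemma syzygies_minimal:
  assumes "W \<subseteq> V" "x \<in> syzygies N J s C i W" "x q \<noteq> 0"
  shows "q \<in> J i \<and> s i q \<subset> W"
proof -
  obtain y where y: "y \<in> graded_part (J (Suc i)) (s (Suc i)) W" "x = lin_comb (J (Suc i)) (C i) y"
    using assms(2) unfolding exact[OF assms(1)] by blast
  have "(\<Sum>r\<in>J (Suc i). y r * C i r q) \<noteq> 0" using assms(3) y(2) by (simp add: lin_comb_def)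
  then obtain r where r: "r \<in> J (Suc i)" "y r * C i r q \<noteq> 0" by (meson sum.not_neutral_contains_not_neutral)
  then have "y r \<noteq> 0" "C i r q \<noteq> 0" by auto
  then show ?thesis using strict[OF r(1)] graded_partD[OF y(1)] by blast
qed

text \<open>A strand in a degree inside \<open>U\<close> sees only generators of degree inside
  \<open>U\<close>, so the same scalar matrices stay exact. The relabelling \<open>f\<close> allows
  the result to live over another vertex type.\<close>

lemma restrict:
  assumes U: "U \<subseteq> V" and inj: "inj_on f U" and N': "\<And>W. W \<subseteq> U \<Longrightarrow> N' (f ` W) \<longleftrightarrow> N W"
  shows "squarefree_resolution (f ` U) N' (\<lambda>i. {q \<in> J i. s i q \<subseteq> U}) (\<lambda>i q. f ` s i q) C"
proof -
  let ?J = "\<lambda>i. {q \<in> J i. s i q \<subseteq> U}" and ?s = "\<lambda>i q. f ` s i q"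
  have sub: "f ` A \<subseteq> f ` B \<longleftrightarrow> A \<subseteq> B" if "A \<subseteq> U" "B \<subseteq> U" for A B
    using that inj_on_image_mem_iff[OF inj _ that(2)] by blast
  have gp: "graded_part (?J i) (?s i) (f ` W) = (graded_part (J i) (s i) W :: (nat \<Rightarrow> 'k) set)" if "W \<subseteq> U" for i W
  proof -
    have "(q \<in> ?J i \<and> ?s i q \<subseteq> f ` W) \<longleftrightarrow> (q \<in> J i \<and> s i q \<subseteq> W)" for q
      using sub[OF _ that, of "s i q"] that by auto
    then show ?thesis unfolding graded_part_def by simp
  qed
  have cb: "lin_comb (?J (Suc i)) (C i) y = lin_comb (J (Suc i)) (C i) y"
    if "W \<subseteq> U" "y \<in> graded_part (J (Suc i)) (s (Suc i)) W" for i W y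
  proof
    have "y q = 0" if "q \<notin> ?J (Suc i)" for q
      using graded_partD[OF \<open>y \<in> _\<close>, of q] that \<open>W \<subseteq> U\<close> by auto
    then show "lin_comb (?J (Suc i)) (C i) y p = lin_comb (J (Suc i)) (C i) y p" for p
      unfolding lin_comb_def by (intro sum.mono_neutral_left) (auto simp: finite_J)
  qed
  have sz: "syzygies N' ?J ?s C i (f ` W) = syzygies N J s C i W" if "W \<subseteq> U" for i W
  proof (cases i)
    case 0
    then show ?thesis using N'[OF that] by (simp add: syzygies_def nonface_part_def)
  next
    case (Suc j)
    then show ?thesis unfolding syzygies_def using gp[OF that] cb[OF that] by auto
  qed
  show ?thesis
  proof
    show "finite (f ` U)" using finite_subset[OF U finite_V] by simp
    show "\<not> N' {}" using N'[of "{}"] not_N_empty by simp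
    show "{q \<in> J 0. s 0 q \<subseteq> U} = {0}" by (auto simp: J_0 s_0)
    show "f ` s 0 0 = {}" by (simp add: s_0)
    show "finite (?J i)" for i using finite_J by simp
    show "f ` s i q \<subseteq> f ` U" if "q \<in> ?J i" for i q using that by auto
    show "p \<in> ?J i \<and> f ` s i p \<subset> f ` s (Suc i) q" if "q \<in> ?J (Suc i)" "C i q p \<noteq> 0" for i q p
    proof -
      have "p \<in> J i" "s i p \<subset> s (Suc i) q" "s (Suc i) q \<subseteq> U" using strict[of q i p] that by auto
      moreover from this have "f ` s i p \<subset> f ` s (Suc i) q"
        by (intro image_strict_mono[OF inj_on_subset[OF inj]])
      ultimately show ?thesis by blast
    qed
    fix i W assume "W \<subseteq> f ` U"
    then obtain W' where W': "W' \<subseteq> U" "W = f ` W'" by (meson subset_imageE)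
    have "syzygies N' ?J ?s C i W = lin_comb (J (Suc i)) (C i) ` graded_part (J (Suc i)) (s (Suc i)) W'"
      using sz[OF W'(1)] exact[of W' i] W' U by auto
    also have "\<dots> = lin_comb (?J (Suc i)) (C i) ` graded_part (?J (Suc i)) (?s (Suc i)) W"
      unfolding W'(2) gp[OF W'(1)] using cb[OF W'(1)] by (auto simp: image_iff)
    finally show "syzygies N' ?J ?s C i W = lin_comb (?J (Suc i)) (C i) ` graded_part (?J (Suc i)) (?s (Suc i)) W" .
  qed
qed

end

section \<open>Hochster's formula, up to vanishing, and its consequence for joins\<close>

lemma acyclic_at_card_less:
  fixes Z :: "nat set \<Rightarrow> (nat \<Rightarrow> 'k::comm_ring_1) set"
  assumes "finite W" "card W \<le> m" "\<And>T. subsp (Z T)"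
  shows "acyclic_at Z W m"
proof -
  have "\<not> (T \<subseteq> W \<and> card T = Suc m)" for T using card_mono[OF assms(1), of T] assms(2) by auto
  moreover have "cochain Z W m (\<lambda>_ _. 0)" unfolding cochain_def using subsp_zero[OF assms(3)] by simp
  ultimately show ?thesis unfolding acyclic_at_def by blast
qed

locale squarefree_resolution_nat = squarefree_resolution V N J s C
  for V :: "nat set" and N J s and C :: "nat \<Rightarrow> nat \<Rightarrow> nat \<Rightarrow> 'k::field_char_0"
begin

lemma acyclic_syzygies:
  assumes "W \<subseteq> V" "m + i < card W"
  shows "acyclic_at (syzygies N J s C i) W (m + i) \<longleftrightarrow> acyclic_at (nonface_part N :: _ \<Rightarrow> (_ \<Rightarrow> 'k) set) W m"
  using assms(2)
proof (induction i)
  case 0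
  have "syzygies N J s C 0 = nonface_part N" by (simp add: syzygies_def fun_eq_iff)
  then show ?case by simp
next
  case (Suc i)
  have "acyclic_at (syzygies N J s C i) W (m + i) \<longleftrightarrow> acyclic_at (syzygies N J s C (Suc i)) W (Suc (m + i))"
  proof (rule acyclic_shift)
    show "finite W" using assms(1) finite_V finite_subset by blast
    show "Suc (m + i) < card W" using Suc.prems by simp
    show "syzygies N J s C i T = lin_comb (J (Suc i)) (C i) ` graded_part (J (Suc i)) (s (Suc i)) T" if "T \<subseteq> W" for T
      by (rule exact) (use that assms(1) in auto)
    show "syzygies N J s C (Suc i) T = {y \<in> graded_part (J (Suc i)) (s (Suc i)) T. \<forall>p. lin_comb (J (Suc i)) (C i) y p = 0}" for T
      by (simp add: syzygies_def)
    show "s (Suc i) q \<noteq> W" if "y \<in> syzygies N J s C (Suc i) W" "y q \<noteq> 0" for y q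
      using syzygies_minimal[OF assms(1) that] by blast
  qed
  then show ?case using Suc by simp
qed

text \<open>Generators of level \<open>i + 1\<close> are seen by the syzygies of level
  \<open>i\<close> at the top position; shifting down \<open>i\<close> levels leaves the ideal at
  position \<open>m\<close>. This is reduced cohomology in degree
  \<open>m - 1 = card W - (i + 1) - 1\<close>.\<close>

lemma Hochster_generator_iff:
  assumes W: "W \<subseteq> V" "Suc m + i = card W"
  shows "(\<exists>q\<in>J (Suc i). s (Suc i) q = W) \<longleftrightarrow> \<not> acyclic_at (nonface_part N :: _ \<Rightarrow> (_ \<Rightarrow> 'k) set) W m"
proof -
  have "(\<exists>q\<in>J (Suc i). s (Suc i) q = W) \<longleftrightarrow> \<not> acyclic_at (syzygies N J s C i) W (m + i)"
  proof (rule generator_iff_not_acyclic)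
    show "finite W" using W(1) finite_V finite_subset by blast
    show "syzygies N J s C i T = lin_comb (J (Suc i)) (C i) ` graded_part (J (Suc i)) (s (Suc i)) T" if "T \<subseteq> W" for T
      by (rule exact) (use that W(1) in auto)
    show "s (Suc i) q \<noteq> W"
      if "y \<in> graded_part (J (Suc i)) (s (Suc i)) W" "\<And>p. lin_comb (J (Suc i)) (C i) y p = 0" "y q \<noteq> 0" for y q
      using syzygies_minimal[OF W(1), of y "Suc i" q] that by (auto simp: syzygies_def)
  qed (use W finite_J in auto)
  also have "\<dots> \<longleftrightarrow> \<not> acyclic_at (nonface_part N :: _ \<Rightarrow> (_ \<Rightarrow> 'k) set) W m"
    using acyclic_syzygies[of W m i] W by simp
  finally show ?thesis .
qed

text \<open>If the degree of \<open>q\<close> meets both parts, cohomology must already be nonzero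
  for its intersection with one part, in the same cohomological degree. That degree fixes size minus
  level, so both drop by the same \<open>d\<close>.\<close>

lemma join_generator:
  assumes V: "V = V1 \<union> V2" "V1 \<inter> V2 = {}"
    and join: "\<And>T. T \<subseteq> V \<Longrightarrow> \<not> T \<subseteq> V1 \<Longrightarrow> \<not> T \<subseteq> V2 \<Longrightarrow> N T"
    and q: "q \<in> J i" and deg: "card (s i q) \<ge> i + 2"
  shows "\<exists>d\<le>i. \<exists>q'\<in>J (i - d). card (s (i - d) q') = card (s i q) - d \<and> (s (i - d) q' \<subseteq> V1 \<or> s (i - d) q' \<subseteq> V2)"
proof (cases "s i q \<subseteq> V1 \<or> s i q \<subseteq> V2")
  case True
  then show ?thesis using q by (intro exI[of _ 0]) auto
next
  case False
  define W where "W = s i q"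
  have WV: "W \<subseteq> V" using s_subset[OF q] by (simp add: W_def)
  have fW: "finite W" using WV finite_V finite_subset by blast
  obtain i' where i': "i = Suc i'" using q False J_0 s_0 by (cases i) auto
  \<comment> \<open>Hochster's formula puts level \<open>i' + 1\<close> at position
    \<open>card W - i' - 1\<close>. The bound \<open>deg\<close> makes this at least 2, that is, of
    the form \<open>Suc (Suc m)\<close> required for joins.\<close>
  define m where "m = card W - i' - 3"
  have card: "Suc (Suc (Suc m)) + i' = card W" using deg by (simp add: m_def W_def i')
  let ?Z = "nonface_part N :: nat set \<Rightarrow> (nat \<Rightarrow> 'k) set"
  have na: "\<not> acyclic_at ?Z W (Suc (Suc m))"
    using Hochster_generator_iff[OF WV, of "Suc (Suc m)" i'] card q by (auto simp: W_def i')
  have WU: "W = (W \<inter> V1) \<union> (W \<inter> V2)" using WV V(1) by blast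
  have "\<not> acyclic_at ?Z (W \<inter> V1) (Suc (Suc m)) \<or> \<not> acyclic_at ?Z (W \<inter> V2) (Suc (Suc m))"
  proof (rule ccontr)
    assume "\<not> ?thesis"
    then have "acyclic_at ?Z ((W \<inter> V1) \<union> (W \<inter> V2)) (Suc (Suc m))"
    proof (intro acyclic_join)
      fix T assume "T \<subseteq> W \<inter> V1 \<union> W \<inter> V2" "\<not> T \<subseteq> W \<inter> V1" "\<not> T \<subseteq> W \<inter> V2"
      then show "N T" using join[of T] WV by blast
    qed (use fW V False WV in \<open>auto simp: W_def\<close>)
    then show False using na WU by simp
  qed
  then obtain U where U: "U = W \<inter> V1 \<or> U = W \<inter> V2" "\<not> acyclic_at ?Z U (Suc (Suc m))" by blast
  have UV: "U \<subseteq> V" "U \<subseteq> W" "finite U" using U(1) WV fW by auto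
  \<comment> \<open>Failure of exactness requires a set of size \<open>m + 3\<close> inside
    \<open>U\<close>; the excess \<open>k\<close> of \<open>card U\<close> over this size determines
    the level of the new generator.\<close>
  have "\<not> card U \<le> Suc (Suc m)" using acyclic_at_card_less[where Z = ?Z, OF UV(3) _ subsp_nonface_part] U(2) by blast
  then obtain k where k: "Suc (Suc (Suc m)) + k = card U"
    by (metis Suc_leI le_add_diff_inverse not_le)
  obtain q' where q': "q' \<in> J (Suc k)" "s (Suc k) q' = U"
    using Hochster_generator_iff[OF UV(1) k] U(2) by blast
  have "k \<le> i'" using card_mono[OF fW UV(2)] k card by simp
  then show ?thesis
    using q' U(1) k card i' by (intro exI[of _ "i' - k"]) (auto simp: Suc_diff_le W_def intro!: bexI[of _ q'])
qed

end

section \<open>Uniqueness of minimal graded free resolutions\<close>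

abbreviation coeff0 :: "('v, 'k::zero) mpoly \<Rightarrow> 'k" where
  "coeff0 f \<equiv> Poly_Mapping.lookup f 0"

lemma keys_add_nat: "Poly_Mapping.keys (a + b :: 'v \<Rightarrow>\<^sub>0 nat) = Poly_Mapping.keys a \<union> Poly_Mapping.keys b"
  by (auto simp: in_keys_iff lookup_add)

lemma pm_nat_add_eq_0_iff: "(a + b :: 'v \<Rightarrow>\<^sub>0 nat) = 0 \<longleftrightarrow> a = 0 \<and> b = 0"
  by (auto simp: poly_mapping_eq_iff fun_eq_iff lookup_add)

lemma monom_degree_0 [simp]: "monom_degree 0 = 0"
  by (simp add: monom_degree_def)

lemma monom_degree_superset:
  assumes "finite A" "Poly_Mapping.keys m \<subseteq> A"
  shows "monom_degree m = (\<Sum>v\<in>A. Poly_Mapping.lookup m v)"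
  unfolding monom_degree_def
  by (rule sum.mono_neutral_left) (use assms in \<open>auto simp: in_keys_iff\<close>)

lemma monom_degree_add: "monom_degree (a + b) = monom_degree a + monom_degree b"
proof -
  let ?A = "Poly_Mapping.keys a \<union> Poly_Mapping.keys b"
  have "monom_degree (a + b) = (\<Sum>v\<in>?A. Poly_Mapping.lookup (a + b) v)"
    by (rule monom_degree_superset) (auto simp: keys_add_nat)
  also have "\<dots> = (\<Sum>v\<in>?A. Poly_Mapping.lookup a v) + (\<Sum>v\<in>?A. Poly_Mapping.lookup b v)"
    by (simp add: lookup_add sum.distrib)
  also have "(\<Sum>v\<in>?A. Poly_Mapping.lookup a v) = monom_degree a"
    by (rule monom_degree_superset[symmetric]) auto
  also have "(\<Sum>v\<in>?A. Poly_Mapping.lookup b v) = monom_degree b"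
    by (rule monom_degree_superset[symmetric]) auto
  finally show ?thesis .
qed

text \<open>Exponents are natural numbers, so a product of monomials is 1 only if both are; taking
  constant terms is reduction modulo the variables.\<close>

lemma coeff0_mult: "coeff0 (f * g) = coeff0 f * coeff0 (g :: ('v, 'k::comm_ring_1) mpoly)"
proof -
  have "coeff0 (f * g) = (\<Sum>l. Poly_Mapping.lookup f l * (\<Sum>q. Poly_Mapping.lookup g q when 0 = l + q))"
    by (rule lookup_mult)
  also have "\<dots> = (\<Sum>l. (Poly_Mapping.lookup f l * coeff0 g) when l = 0)"
  proof (rule arg_cong[of _ _ Sum_any], rule ext)
    fix l :: "'v \<Rightarrow>\<^sub>0 nat"
    have eq: "0 = l + q \<longleftrightarrow> q = 0 \<and> l = 0" for q
      using pm_nat_add_eq_0_iff[of l q] by auto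
    show "Poly_Mapping.lookup f l * (\<Sum>q. Poly_Mapping.lookup g q when 0 = l + q)
        = (Poly_Mapping.lookup f l * coeff0 g when l = 0)"
      unfolding eq by (cases "l = 0") simp_all
  qed
  finally show ?thesis by simp
qed

lemma coeff0_sum: "coeff0 (\<Sum>i\<in>A. f i) = (\<Sum>i\<in>A. coeff0 (f i))"
  by (rule lookup_sum)

lemma keys_multD:
  assumes "m \<in> Poly_Mapping.keys (f * g)"
  obtains a b where "m = a + b" "a \<in> Poly_Mapping.keys f" "b \<in> Poly_Mapping.keys g"
  using keys_mult[of f g] assms by blast

lemma polys_0 [simp]: "0 \<in> polys V"
  and polys_1 [simp]: "(1 :: ('v, 'k::comm_ring_1) mpoly) \<in> polys V"
  by (auto simp: polys_def)

lemma polys_add: "f \<in> polys V \<Longrightarrow> g \<in> polys V \<Longrightarrow> f + g \<in> polys V"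
  unfolding polys_def using keys_add[of f g] by blast

lemma polys_uminus: "f \<in> polys V \<Longrightarrow> - f \<in> polys V"
  by (auto simp: polys_def in_keys_iff)

lemma polys_diff: "f \<in> polys V \<Longrightarrow> g \<in> polys V \<Longrightarrow> f - g \<in> polys V" for f :: "('v, 'k::comm_ring_1) mpoly"
  using polys_add[of f V "- g"] polys_uminus[of g V] by simp

lemma polys_mult: "f \<in> polys V \<Longrightarrow> g \<in> polys V \<Longrightarrow> f * g \<in> polys V" for f :: "('v, 'k::comm_ring_1) mpoly"
  unfolding polys_def by (auto elim!: keys_multD simp: keys_add_nat) blast+

lemma polys_sum: "(\<And>i. i \<in> A \<Longrightarrow> f i \<in> polys V) \<Longrightarrow> (\<Sum>i\<in>A. f i) \<in> polys V"
  by (induction A rule: infinite_finite_induct) (auto intro: polys_add)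

text \<open>The part of total degree \<open>d\<close> in a module whose basis element has degree \<open>r\<close>.\<close>

definition hpart :: "nat \<Rightarrow> nat \<Rightarrow> ('v, 'k::zero) mpoly \<Rightarrow> ('v, 'k) mpoly" where
  "hpart r d f = Poly_Mapping.mapp (\<lambda>m c. if monom_degree m + r = d then c else 0) f"

lemma lookup_hpart: "Poly_Mapping.lookup (hpart r d f) m = (if monom_degree m + r = d then Poly_Mapping.lookup f m else 0)"
  by (simp add: hpart_def lookup_mapp when_def in_keys_iff)

lemma keys_hpart: "Poly_Mapping.keys (hpart r d f) = {m \<in> Poly_Mapping.keys f. monom_degree m + r = d}"
  by (auto simp: in_keys_iff lookup_hpart split: if_splits)

lemma hpart_polys: "f \<in> polys V \<Longrightarrow> hpart r d f \<in> polys V"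
  by (auto simp: polys_def keys_hpart)

lemma hpart_add: "hpart r d (f + g) = hpart r d f + hpart r d g"
  by (rule poly_mapping_eqI) (simp add: lookup_hpart lookup_add)

lemma hpart_diff: "hpart r d (f - g) = hpart r d f - hpart r d (g :: ('v, 'k::ab_group_add) mpoly)"
  by (rule poly_mapping_eqI) (simp add: lookup_hpart lookup_minus)

lemma hpart_sum: "hpart r d (\<Sum>i\<in>A. f i) = (\<Sum>i\<in>A. hpart r d (f i))"
  by (rule poly_mapping_eqI) (simp add: lookup_hpart lookup_sum)

lemma hpart_id: "(\<And>m. m \<in> Poly_Mapping.keys f \<Longrightarrow> monom_degree m + r = d) \<Longrightarrow> hpart r d f = f"
  by (rule poly_mapping_eqI) (auto simp: lookup_hpart in_keys_iff)

lemma hpart_0: "(\<And>m. m \<in> Poly_Mapping.keys f \<Longrightarrow> monom_degree m + r \<noteq> d) \<Longrightarrow> hpart r d f = 0"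
  by (rule poly_mapping_eqI) (auto simp: lookup_hpart in_keys_iff)

text \<open>A homogeneous factor shifts all degrees equally. Splitting \<open>b\<close> into its
  part of the matching degree and the rest, only the former contributes.\<close>

lemma hpart_mult:
  fixes a b :: "('v, 'k::comm_ring_1) mpoly"
  assumes "\<And>m. m \<in> Poly_Mapping.keys a \<Longrightarrow> monom_degree m + r = p"
  shows "hpart r d (a * b) = a * hpart p d b"
proof -
  have "hpart r d (a * hpart p d b) = a * hpart p d b"
  proof (rule hpart_id)
    fix m assume "m \<in> Poly_Mapping.keys (a * hpart p d b)"
    then show "monom_degree m + r = d"
      by (rule keys_multD) (use assms in \<open>fastforce simp: keys_hpart monom_degree_add\<close>)
  qed
  moreover have "hpart r d (a * (b - hpart p d b)) = 0"
  proof (rule hpart_0)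
    fix m assume "m \<in> Poly_Mapping.keys (a * (b - hpart p d b))"
    then show "monom_degree m + r \<noteq> d"
    proof (rule keys_multD)
      fix m1 m2 assume m: "m = m1 + m2" "m1 \<in> Poly_Mapping.keys a" "m2 \<in> Poly_Mapping.keys (b - hpart p d b)"
      then have "monom_degree m2 + p \<noteq> d"
        by (auto simp: in_keys_iff lookup_minus lookup_hpart split: if_splits)
      then show ?thesis using assms[OF m(2)] m(1) by (simp add: monom_degree_add)
    qed
  qed
  moreover have "a * b = a * hpart p d b + a * (b - hpart p d b)"
    by (simp add: algebra_simps)
  ultimately show ?thesis by (metis hpart_add add.right_neutral)
qed

definition hpart_vec :: "nat list \<Rightarrow> nat \<Rightarrow> ('v, 'k::zero) mpoly vec \<Rightarrow> ('v, 'k) mpoly vec" where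
  "hpart_vec ds d h = vec (length ds) (\<lambda>p. hpart (ds ! p) d (h $ p))"

text \<open>A row, seen as a map of degree 0 from the free module with basis degrees
  \<open>es\<close> to the one with the single basis degree \<open>r\<close>.\<close>

definition hom_vec :: "nat \<Rightarrow> nat list \<Rightarrow> ('v, 'k::zero) mpoly vec \<Rightarrow> bool" where
  "hom_vec r es v \<longleftrightarrow> dim_vec v = length es \<and>
     (\<forall>p<length es. \<forall>m\<in>Poly_Mapping.keys (v $ p). monom_degree m + r = es ! p)"

lemma dim_hpart_vec [simp]: "dim_vec (hpart_vec ds d h) = length ds"
  and index_hpart_vec [simp]: "p < length ds \<Longrightarrow> hpart_vec ds d h $ p = hpart (ds ! p) d (h $ p)"
  by (simp_all add: hpart_vec_def)

lemma hpart_scalar_prod: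
  fixes v :: "('v, 'k::comm_ring_1) mpoly vec"
  assumes "hom_vec r es v" "h \<in> carrier_vec (length es)"
  shows "hpart r d (v \<bullet> h) = v \<bullet> hpart_vec es d h"
proof -
  have "hpart r d (v \<bullet> h) = (\<Sum>i\<in>{0..<length es}. hpart r d (v $ i * h $ i))"
    using assms(2) by (simp add: scalar_prod_def hpart_sum)
  also have "\<dots> = (\<Sum>i\<in>{0..<length es}. v $ i * hpart (es ! i) d (h $ i))"
    by (intro sum.cong refl hpart_mult) (use assms(1) in \<open>simp add: hom_vec_def\<close>)
  also have "\<dots> = v \<bullet> hpart_vec es d h" by (simp add: scalar_prod_def)
  finally show ?thesis .
qed

section \<open>Homogeneous matrices and homogeneous lifts\<close>

definition hom_mat :: "'v set \<Rightarrow> nat list \<Rightarrow> nat list \<Rightarrow> ('v, 'k::zero) mpoly mat \<Rightarrow> bool" where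
  "hom_mat V ds es X \<longleftrightarrow> X \<in> carrier_mat (length ds) (length es) \<and>
     (\<forall>p < length ds. \<forall>q < length es. X $$ (p, q) \<in> polys V \<and>
        (\<forall>m \<in> Poly_Mapping.keys (X $$ (p, q)). monom_degree m + ds ! p = es ! q))"

lemma hom_matI:
  assumes "X \<in> carrier_mat (length ds) (length es)"
    "\<And>p q. p < length ds \<Longrightarrow> q < length es \<Longrightarrow> X $$ (p, q) \<in> polys V"
    "\<And>p q m. p < length ds \<Longrightarrow> q < length es \<Longrightarrow> m \<in> Poly_Mapping.keys (X $$ (p, q)) \<Longrightarrow> monom_degree m + ds ! p = es ! q"
  shows "hom_mat V ds es X"
  using assms unfolding hom_mat_def by blast

lemma hom_matD:
  assumes "hom_mat V ds es X"
  shows "X \<in> carrier_mat (length ds) (length es)" "dim_row X = length ds" "dim_col X = length es"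
    "\<And>p q. p < length ds \<Longrightarrow> q < length es \<Longrightarrow> X $$ (p, q) \<in> polys V"
    "\<And>p q m. p < length ds \<Longrightarrow> q < length es \<Longrightarrow> m \<in> Poly_Mapping.keys (X $$ (p, q)) \<Longrightarrow> monom_degree m + ds ! p = es ! q"
  using assms unfolding hom_mat_def by auto

lemma hom_mat_row: "hom_mat V ds es X \<Longrightarrow> p < length ds \<Longrightarrow> hom_vec (ds ! p) es (row X p)"
  using hom_matD[of V ds es X] by (auto simp: hom_vec_def)

lemma hom_mat_col: "hom_mat V ds es X \<Longrightarrow> q < length es \<Longrightarrow> col X q \<in> free_module V (length ds)"
  using hom_matD[of V ds es X] by (auto simp: free_module_def)

lemma free_module_carrier: "h \<in> free_module V n \<Longrightarrow> h \<in> carrier_vec n"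
  by (simp add: free_module_def)

lemma hom_mat_mult:
  fixes X Y :: "('v, 'k::comm_ring_1) mpoly mat"
  assumes X: "hom_mat V ds es X" and Y: "hom_mat V es fs Y"
  shows "hom_mat V ds fs (X * Y)"
proof (rule hom_matI)
  show "X * Y \<in> carrier_mat (length ds) (length fs)" using hom_matD(1)[OF X] hom_matD(1)[OF Y] by simp
  fix p q assume pq: "p < length ds" "q < length fs"
  have eq: "(X * Y) $$ (p, q) = (\<Sum>r\<in>{0..<length es}. X $$ (p, r) * Y $$ (r, q))"
    using pq hom_matD(2,3)[OF X] hom_matD(2,3)[OF Y] by (simp add: scalar_prod_def)
  show "(X * Y) $$ (p, q) \<in> polys V"
    unfolding eq using pq hom_matD(4)[OF X] hom_matD(4)[OF Y] by (intro polys_sum polys_mult) auto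
  have "hpart (ds ! p) (fs ! q) ((X * Y) $$ (p, q)) = (X * Y) $$ (p, q)"
    unfolding eq hpart_sum
  proof (rule sum.cong[OF refl])
    fix r assume r: "r \<in> {0..<length es}"
    have "hpart (ds ! p) (fs ! q) (X $$ (p, r) * Y $$ (r, q)) = X $$ (p, r) * hpart (es ! r) (fs ! q) (Y $$ (r, q))"
      by (rule hpart_mult) (use hom_matD(5)[OF X] pq r in auto)
    also have "hpart (es ! r) (fs ! q) (Y $$ (r, q)) = Y $$ (r, q)"
      by (rule hpart_id) (use hom_matD(5)[OF Y] pq r in auto)
    finally show "hpart (ds ! p) (fs ! q) (X $$ (p, r) * Y $$ (r, q)) = X $$ (p, r) * Y $$ (r, q)" .
  qed
  then show "monom_degree m + ds ! p = fs ! q" if "m \<in> Poly_Mapping.keys ((X * Y) $$ (p, q))" for m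
    using that keys_hpart[of "ds ! p" "fs ! q" "(X * Y) $$ (p, q)"] by auto
qed

lemma hom_mat_diff:
  fixes X Y :: "('v, 'k::comm_ring_1) mpoly mat"
  assumes X: "hom_mat V ds es X" and Y: "hom_mat V ds es Y"
  shows "hom_mat V ds es (X - Y)"
proof (rule hom_matI)
  show "X - Y \<in> carrier_mat (length ds) (length es)" using minus_carrier_mat[OF hom_matD(1)[OF Y]] .
  fix p q assume pq: "p < length ds" "q < length es"
  then have eq: "(X - Y) $$ (p, q) = X $$ (p, q) - Y $$ (p, q)"
    using hom_matD(2,3)[OF Y] by simp
  show "(X - Y) $$ (p, q) \<in> polys V"
    unfolding eq using pq hom_matD(4)[OF X] hom_matD(4)[OF Y] by (intro polys_diff) auto
  show "monom_degree m + ds ! p = es ! q" if "m \<in> Poly_Mapping.keys ((X - Y) $$ (p, q))" for m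
  proof -
    have "m \<in> Poly_Mapping.keys (X $$ (p, q)) \<or> m \<in> Poly_Mapping.keys (Y $$ (p, q))"
      using that unfolding eq by (auto simp: in_keys_iff lookup_minus)
    then show ?thesis using hom_matD(5)[OF X] hom_matD(5)[OF Y] pq by blast
  qed
qed

lemma hom_mat_one: "hom_mat V ds ds (1\<^sub>m (length ds) :: ('v, 'k::comm_ring_1) mpoly mat)"
  by (rule hom_matI) (auto split: if_splits)

lemma mult_mat_vec_col: "X \<in> carrier_mat n m \<Longrightarrow> Y \<in> carrier_mat m l \<Longrightarrow> q < l \<Longrightarrow> col (X * Y) q = X *\<^sub>v col Y q"
  by simp

lemma hpart_vec_mult:
  fixes D :: "('v, 'k::comm_ring_1) mpoly mat"
  assumes D: "hom_mat V ds es D" and h: "h \<in> carrier_vec (length es)"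
  shows "hpart_vec ds d (D *\<^sub>v h) = D *\<^sub>v hpart_vec es d h"
proof (rule eq_vecI)
  fix p assume "p < dim_vec (D *\<^sub>v hpart_vec es d h)"
  then have p: "p < length ds" using hom_matD(2)[OF D] by simp
  then show "hpart_vec ds d (D *\<^sub>v h) $ p = (D *\<^sub>v hpart_vec es d h) $ p"
    using hom_matD(2)[OF D] hpart_scalar_prod[OF hom_mat_row[OF D p] h] by simp
qed (use hom_matD(2)[OF D] in simp)

lemma hpart_vec_col:
  assumes "hom_mat V ds es X" "q < length es"
  shows "hpart_vec ds (es ! q) (col X q) = col X q"
proof (rule eq_vecI)
  fix p assume "p < dim_vec (col X q)"
  then show "hpart_vec ds (es ! q) (col X q) $ p = col X q $ p"
    using hom_matD[OF assms(1)] assms(2) by (auto intro!: hpart_id)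
qed (use hom_matD[OF assms(1)] in simp)

lemma hom_mat_of_cols:
  fixes H :: "nat \<Rightarrow> ('v, 'k::comm_ring_1) mpoly vec"
  assumes "\<And>q. q < length fs \<Longrightarrow> H q \<in> free_module V (length es)"
  defines "Y \<equiv> mat (length es) (length fs) (\<lambda>(p, q). hpart_vec es (fs ! q) (H q) $ p)"
  shows "hom_mat V es fs Y" "\<And>q. q < length fs \<Longrightarrow> col Y q = hpart_vec es (fs ! q) (H q)"
proof -
  show "hom_mat V es fs Y"
    by (rule hom_matI) (use assms(1) in \<open>auto simp: Y_def free_module_def hpart_polys keys_hpart\<close>)
  show "col Y q = hpart_vec es (fs ! q) (H q)" if "q < length fs" for q
    using that by (intro eq_vecI) (auto simp: Y_def)
qed

text \<open>Arbitrary preimages of the columns are replaced by their parts in the degree of the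
  column; as \<open>D\<close> has degree 0, these are still preimages.\<close>

lemma hom_lift:
  fixes D X :: "('v, 'k::comm_ring_1) mpoly mat"
  assumes D: "hom_mat V ds es D" and X: "hom_mat V ds fs X"
    and im: "\<And>q. q < length fs \<Longrightarrow> col X q \<in> (\<lambda>h. D *\<^sub>v h) ` free_module V (length es)"
  obtains Y where "hom_mat V es fs Y" "D * Y = X"
proof -
  have "\<exists>h. h \<in> free_module V (length es) \<and> col X q = D *\<^sub>v h" if "q < length fs" for q
    using im[OF that] by blast
  then obtain H where H: "\<And>q. q < length fs \<Longrightarrow> H q \<in> free_module V (length es)"
    "\<And>q. q < length fs \<Longrightarrow> col X q = D *\<^sub>v H q" by metis
  define Y where "Y = mat (length es) (length fs) (\<lambda>(p, q). hpart_vec es (fs ! q) (H q) $ p)"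
  have Y: "hom_mat V es fs Y" "\<And>q. q < length fs \<Longrightarrow> col Y q = hpart_vec es (fs ! q) (H q)"
    unfolding Y_def using hom_mat_of_cols[of fs H V es, OF H(1)] by blast+
  have "D * Y = X"
  proof (rule mat_col_eqI)
    fix q assume "q < dim_col X"
    then have q: "q < length fs" using hom_matD(3)[OF X] by simp
    have c: "H q \<in> carrier_vec (length es)" using H(1)[OF q] by (simp add: free_module_def)
    have "col (D * Y) q = D *\<^sub>v hpart_vec es (fs ! q) (H q)"
      using mult_mat_vec_col[OF hom_matD(1)[OF D] hom_matD(1)[OF Y(1)] q] Y(2)[OF q] by simp
    also have "\<dots> = hpart_vec ds (fs ! q) (col X q)"
      unfolding H(2)[OF q] by (rule hpart_vec_mult[OF D c, symmetric])
    also have "\<dots> = col X q" by (rule hpart_vec_col[OF X q])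
    finally show "col (D * Y) q = col X q" .
  qed (use hom_matD[OF D] hom_matD[OF X] hom_matD[OF Y(1)] in auto)
  then show ?thesis using that Y(1) by blast
qed

section \<open>The comparison theorem for graded resolutions\<close>

locale graded_ideal =
  fixes V :: "'v set" and I :: "('v, 'k::comm_ring_1) mpoly set"
  assumes zero_mem: "0 \<in> I"
    and add_mem: "f \<in> I \<Longrightarrow> g \<in> I \<Longrightarrow> f + g \<in> I"
    and mult_mem: "c \<in> polys V \<Longrightarrow> f \<in> I \<Longrightarrow> c * f \<in> I"
    and hpart_mem: "f \<in> I \<Longrightarrow> hpart 0 d f \<in> I"
begin

lemma sum_mem: "(\<And>i. i \<in> A \<Longrightarrow> f i \<in> I) \<Longrightarrow> (\<Sum>i\<in>A. f i) \<in> I"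
  by (induction A rule: infinite_finite_induct) (auto intro: add_mem zero_mem)

lemma diff_mem: "f \<in> I \<Longrightarrow> g \<in> I \<Longrightarrow> f - g \<in> I"
  using add_mem[of f "(-1) * g"] mult_mem[OF polys_uminus[OF polys_1], of g] by simp

lemma scalar_prod_transfer:
  assumes P: "P \<in> carrier_mat (length ds') (length ds)"
    and v: "v \<in> free_module V (length ds)" and g: "g \<in> carrier_vec (length ds)" "g' \<in> carrier_vec (length ds')"
    and aug: "\<And>q. q < length ds \<Longrightarrow> g $ q - g' \<bullet> col P q \<in> I"
  shows "g \<bullet> v - g' \<bullet> (P *\<^sub>v v) \<in> I"
proof -
  have "g' \<bullet> (P *\<^sub>v v) = (\<Sum>p\<in>{0..<length ds'}. \<Sum>q\<in>{0..<length ds}. v $ q * (g' $ p * P $$ (p, q)))"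
    using P v unfolding free_module_def
    by (auto simp: scalar_prod_def sum_distrib_left algebra_simps intro!: sum.cong)
  also have "\<dots> = (\<Sum>q\<in>{0..<length ds}. v $ q * (\<Sum>p\<in>{0..<length ds'}. g' $ p * P $$ (p, q)))"
    by (subst sum.swap) (simp add: sum_distrib_left)
  also have "\<dots> = (\<Sum>q\<in>{0..<length ds}. v $ q * (g' \<bullet> col P q))"
    using P by (intro sum.cong refl) (simp add: scalar_prod_def)
  finally have "g \<bullet> v - g' \<bullet> (P *\<^sub>v v) = (\<Sum>q\<in>{0..<length ds}. v $ q * (g $ q - g' \<bullet> col P q))"
    using v by (auto simp: scalar_prod_def[of g v] free_module_def sum_subtractf algebra_simps)
  also have "\<dots> \<in> I"
    using v aug by (intro sum_mem mult_mem) (auto simp: free_module_def)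
  finally show ?thesis .
qed

end

locale resolution = graded_ideal V I for V :: "'v set" and I :: "('v, 'k::comm_ring_1) mpoly set" +
  fixes ds :: "nat \<Rightarrow> nat list" and g :: "('v, 'k) mpoly vec" and D :: "nat \<Rightarrow> ('v, 'k) mpoly mat"
  assumes res: "graded_free_resolution V I ds g D"
begin

lemmas res_unfolded = res[unfolded graded_free_resolution_def Let_def]

lemma D_hom: "hom_mat V (ds i) (ds (Suc i)) (D i)"
  using conjunct1[OF conjunct2[OF res_unfolded]] unfolding hom_mat_def by simp

lemma D_carrier: "D i \<in> carrier_mat (length (ds i)) (length (ds (Suc i)))"
  using hom_matD(1)[OF D_hom] .

lemma g_free: "g \<in> free_module V (length (ds 0))"
  using res_unfolded by (elim conjE)

lemma g_carrier: "g \<in> carrier_vec (length (ds 0))"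
  using g_free by (simp add: free_module_def)

lemma g_hom: "hom_vec 0 (ds 0) g"
  using conjunct2[OF conjunct1[OF res_unfolded]] g_carrier unfolding hom_vec_def by auto

lemma surj: "f \<in> polys V \<Longrightarrow> \<exists>h\<in>free_module V (length (ds 0)). f - g \<bullet> h \<in> I"
  using conjunct1[OF conjunct2[OF conjunct2[OF res_unfolded]]] by (rule bspec)

lemma exact_0_eq: "{h \<in> free_module V (length (ds 0)). g \<bullet> h \<in> I} = (\<lambda>h. D 0 *\<^sub>v h) ` free_module V (length (ds 1))"
  using res_unfolded by (elim conjE) simp

lemma exact_Suc_eq: "{h \<in> free_module V (length (ds (Suc i))). D i *\<^sub>v h = 0\<^sub>v (length (ds i))} =
    (\<lambda>h. D (Suc i) *\<^sub>v h) ` free_module V (length (ds (Suc (Suc i))))"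
  using res_unfolded by (elim conjE) (erule spec)

lemma exact_0: "h \<in> free_module V (length (ds 0)) \<Longrightarrow> g \<bullet> h \<in> I \<Longrightarrow> h \<in> (\<lambda>h. D 0 *\<^sub>v h) ` free_module V (length (ds 1))"
  unfolding exact_0_eq[symmetric] by simp

lemma g_D: "h \<in> free_module V (length (ds 1)) \<Longrightarrow> g \<bullet> (D 0 *\<^sub>v h) \<in> I"
  using exact_0_eq by blast

lemma exact_Suc: "h \<in> free_module V (length (ds (Suc i))) \<Longrightarrow> D i *\<^sub>v h = 0\<^sub>v (length (ds i)) \<Longrightarrow>
    h \<in> (\<lambda>h. D (Suc i) *\<^sub>v h) ` free_module V (length (ds (Suc (Suc i))))"
  unfolding exact_Suc_eq[symmetric] by simp

lemma D_D_vec: "h \<in> free_module V (length (ds (Suc (Suc i)))) \<Longrightarrow> D i *\<^sub>v (D (Suc i) *\<^sub>v h) = 0\<^sub>v (length (ds i))"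
  using exact_Suc_eq[of i] by blast

lemma unit_vec_free: "(unit_vec n q :: ('v, 'k) mpoly vec) \<in> free_module V n"
  by (auto simp: free_module_def unit_vec_def)

lemma col_D: "q < length (ds (Suc i)) \<Longrightarrow> col (D i) q = D i *\<^sub>v unit_vec (length (ds (Suc i))) q"
  using D_carrier[of i] by (intro eq_vecI) auto

lemma D_D: "D i * D (Suc i) = 0\<^sub>m (length (ds i)) (length (ds (Suc (Suc i))))"
proof (rule mat_col_eqI)
  fix q assume q: "q < dim_col (0\<^sub>m (length (ds i)) (length (ds (Suc (Suc i)))) :: ('v, 'k) mpoly mat)"
  then show "col (D i * D (Suc i)) q = col (0\<^sub>m (length (ds i)) (length (ds (Suc (Suc i))))) q"
    using mult_mat_vec_col[OF D_carrier D_carrier, of q i] col_D[of q "Suc i"] D_D_vec[OF unit_vec_free, of i q]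
    by (simp add: col_zero)
qed (use D_carrier in auto)

lemma image_of_kernel:
  assumes X: "hom_mat V (ds (Suc i)) fs X" and 0: "D i * X = 0\<^sub>m (length (ds i)) (length fs)" and q: "q < length fs"
  shows "col X q \<in> (\<lambda>h. D (Suc i) *\<^sub>v h) ` free_module V (length (ds (Suc (Suc i))))"
proof (rule exact_Suc[OF hom_mat_col[OF X q]])
  show "D i *\<^sub>v col X q = 0\<^sub>v (length (ds i))"
    using mult_mat_vec_col[OF D_carrier hom_matD(1)[OF X] q] q unfolding 0 by (simp add: col_zero)
qed

end

text \<open>The comparison map is kept homogeneous, so that constant terms of its entries can link
  only generators of equal degree.\<close>

lemma (in graded_ideal) chain_map:
  assumes "resolution V I ds g D" "resolution V I ds' g' D'"
  obtains P where "\<And>i. hom_mat V (ds' i) (ds i) (P i)"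
    "\<And>q. q < length (ds 0) \<Longrightarrow> g $ q - g' \<bullet> col (P 0) q \<in> I"
    "\<And>i. D' i * P (Suc i) = P i * D i"
proof -
  interpret R: resolution V I ds g D by fact
  interpret R': resolution V I ds' g' D' by fact
  define aug where "aug P \<longleftrightarrow> (\<forall>q<length (ds 0). g $ q - g' \<bullet> col P q \<in> I)" for P
  \<comment> \<open>The invariant of the recursion: it is exactly what lets \<open>P * D n\<close>
    be lifted through \<open>D' n\<close> to the next map.\<close>
  define im where "im n P \<longleftrightarrow> (\<forall>q<length (ds (Suc n)). col (P * D n) q \<in> (\<lambda>h. D' n *\<^sub>v h) ` free_module V (length (ds' (Suc n))))" for n P
  have "\<exists>P. \<forall>n. (hom_mat V (ds' n) (ds n) (P n) \<and> (n = 0 \<longrightarrow> aug (P n)) \<and> im n (P n)) \<and> D' n * P (Suc n) = P n * D n"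
  proof (rule dependent_nat_choice)
    have "\<exists>h. h \<in> free_module V (length (ds' 0)) \<and> g $ q - g' \<bullet> h \<in> I" if "q < length (ds 0)" for q
      using R'.surj[of "g $ q"] R.g_free that by (auto simp: free_module_def)
    then obtain H where H: "\<And>q. q < length (ds 0) \<Longrightarrow> H q \<in> free_module V (length (ds' 0))"
      "\<And>q. q < length (ds 0) \<Longrightarrow> g $ q - g' \<bullet> H q \<in> I" by metis
    define P where "P = mat (length (ds' 0)) (length (ds 0)) (\<lambda>(p, q). hpart_vec (ds' 0) (ds 0 ! q) (H q) $ p)"
    have P: "hom_mat V (ds' 0) (ds 0) P" "\<And>q. q < length (ds 0) \<Longrightarrow> col P q = hpart_vec (ds' 0) (ds 0 ! q) (H q)"
      unfolding P_def using hom_mat_of_cols[of "ds 0" H V "ds' 0", OF H(1)] by blast+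
    have aug: "g $ q - g' \<bullet> col P q \<in> I" if q: "q < length (ds 0)" for q
    proof -
      have c: "H q \<in> carrier_vec (length (ds' 0))" using H(1)[OF q] by (simp add: free_module_def)
      have "hpart 0 (ds 0 ! q) (g $ q) = g $ q"
        by (rule hpart_id) (use R.g_hom q in \<open>simp add: hom_vec_def\<close>)
      then have "hpart 0 (ds 0 ! q) (g $ q - g' \<bullet> H q) = g $ q - g' \<bullet> col P q"
        using hpart_scalar_prod[OF R'.g_hom c] P(2)[OF q] by (simp add: hpart_diff)
      then show ?thesis using hpart_mem[OF H(2)[OF q], of "ds 0 ! q"] by simp
    qed
    have "im 0 P"
      unfolding im_def
    proof (intro allI impI)
      fix q assume q: "q < length (ds (Suc 0))"
      have PD: "hom_mat V (ds' 0) (ds (Suc 0)) (P * D 0)" by (rule hom_mat_mult[OF P(1) R.D_hom])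
      have cD: "col (D 0) q \<in> free_module V (length (ds 0))" using hom_mat_col[OF R.D_hom] q by simp
      have eq: "col (P * D 0) q = P *\<^sub>v col (D 0) q"
        by (rule mult_mat_vec_col[OF hom_matD(1)[OF P(1)] R.D_carrier q])
      have "g \<bullet> col (D 0) q - g' \<bullet> col (P * D 0) q \<in> I"
        unfolding eq by (rule scalar_prod_transfer[OF hom_matD(1)[OF P(1)] cD R.g_carrier R'.g_carrier aug])
      moreover have "g \<bullet> col (D 0) q \<in> I"
        using R.g_D[OF R.unit_vec_free, of q] R.col_D[OF q] by simp
      ultimately have "g' \<bullet> col (P * D 0) q \<in> I"
        using diff_mem[of "g \<bullet> col (D 0) q" "g \<bullet> col (D 0) q - g' \<bullet> col (P * D 0) q"] by simp
      then show "col (P * D 0) q \<in> (\<lambda>h. D' 0 *\<^sub>v h) ` free_module V (length (ds' (Suc 0)))"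
        using R'.exact_0[OF hom_mat_col[OF PD q]] by simp
    qed
    then show "\<exists>P. hom_mat V (ds' 0) (ds 0) P \<and> (0 = 0 \<longrightarrow> aug P) \<and> im 0 P"
      using P(1) aug aug_def by blast
  next
    fix P and n :: nat assume P: "hom_mat V (ds' n) (ds n) P \<and> (n = 0 \<longrightarrow> aug P) \<and> im n P"
    have PD: "hom_mat V (ds' n) (ds (Suc n)) (P * D n)" using hom_mat_mult[OF _ R.D_hom] P by blast
    obtain Y where Y: "hom_mat V (ds' (Suc n)) (ds (Suc n)) Y" "D' n * Y = P * D n"
      by (rule hom_lift[OF R'.D_hom PD]) (use P in \<open>auto simp: im_def\<close>)
    have cP: "P \<in> carrier_mat (length (ds' n)) (length (ds n))" using P hom_matD(1) by blast
    have "im (Suc n) Y"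
      unfolding im_def
    proof (intro allI impI, rule R'.image_of_kernel)
      show "hom_mat V (ds' (Suc n)) (ds (Suc (Suc n))) (Y * D (Suc n))"
        by (rule hom_mat_mult[OF Y(1) R.D_hom])
      have "D' n * (Y * D (Suc n)) = D' n * Y * D (Suc n)"
        using assoc_mult_mat[OF R'.D_carrier hom_matD(1)[OF Y(1)] R.D_carrier] by simp
      also have "\<dots> = P * (D n * D (Suc n))"
        unfolding Y(2) by (rule assoc_mult_mat[OF cP R.D_carrier R.D_carrier])
      also have "\<dots> = 0\<^sub>m (length (ds' n)) (length (ds (Suc (Suc n))))"
        unfolding R.D_D using right_mult_zero_mat[OF cP] .
      finally show "D' n * (Y * D (Suc n)) = 0\<^sub>m (length (ds' n)) (length (ds (Suc (Suc n))))" .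
    qed
    then show "\<exists>Y. (hom_mat V (ds' (Suc n)) (ds (Suc n)) Y \<and> (Suc n = 0 \<longrightarrow> aug Y) \<and> im (Suc n) Y) \<and> D' n * Y = P * D n"
      using Y by blast
  qed
  then obtain P where "\<And>n. hom_mat V (ds' n) (ds n) (P n)" "aug (P 0)" "\<And>n. D' n * P (Suc n) = P n * D n" by blast
  then show ?thesis using that unfolding aug_def by blast
qed

lemma coeff0_mat_mult:
  fixes X Y :: "('v, 'k::comm_ring_1) mpoly mat"
  assumes "X \<in> carrier_mat n m" "Y \<in> carrier_mat m l" "p < n" "q < l"
  shows "coeff0 ((X * Y) $$ (p, q)) = (\<Sum>r\<in>{0..<m}. coeff0 (X $$ (p, r)) * coeff0 (Y $$ (r, q)))"
  using assms by (simp add: scalar_prod_def coeff0_sum coeff0_mult)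

text \<open>An endomorphism of a minimal resolution that lifts \<open>0\<close> is null-homotopic, hence it vanishes
  modulo the variables.\<close>

lemma (in resolution) null_homotopic:
  assumes E: "\<And>i. hom_mat V (ds i) (ds i) (E i)"
    and aug: "\<And>q. q < length (ds 0) \<Longrightarrow> g \<bullet> col (E 0) q \<in> I"
    and comm: "\<And>i. D i * E (Suc i) = E i * D i"
    and minimal: "\<And>i p q. p < length (ds i) \<Longrightarrow> q < length (ds (Suc i)) \<Longrightarrow> coeff0 (D i $$ (p, q)) = 0"
    and pq: "p < length (ds i)" "q < length (ds i)"
  shows "coeff0 (E i $$ (p, q)) = 0"
proof -
  note cE = hom_matD(1)[OF E] and cD = D_carrier
  \<comment> \<open>The homotopy is built by choice. The last invariant says that \<open>D n\<close>
    kills the error left by \<open>h n\<close>, so exactness provides the next component.\<close>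
  have "\<exists>h. \<forall>n. (hom_mat V (ds (Suc n)) (ds n) (h n) \<and> (n = 0 \<longrightarrow> D 0 * h n = E 0) \<and>
       D n * (E (Suc n) - h n * D n) = 0\<^sub>m (length (ds n)) (length (ds (Suc n)))) \<and>
     D (Suc n) * h (Suc n) = E (Suc n) - h n * D n"
  proof (rule dependent_nat_choice)
    obtain h where h: "hom_mat V (ds (Suc 0)) (ds 0) h" "D 0 * h = E 0"
      by (rule hom_lift[OF D_hom E[of 0]]) (use exact_0[OF hom_mat_col[OF E] aug] in auto)
    note ch = hom_matD(1)[OF h(1)]
    have "D 0 * (E (Suc 0) - h * D 0) = D 0 * E (Suc 0) - D 0 * (h * D 0)"
      by (rule mult_minus_distrib_mat[OF cD cE mult_carrier_mat[OF ch cD]])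
    also have "D 0 * (h * D 0) = E 0 * D 0"
      using assoc_mult_mat[OF cD ch cD] h(2) by simp
    finally have "D 0 * (E (Suc 0) - h * D 0) = 0\<^sub>m (length (ds 0)) (length (ds (Suc 0)))"
      unfolding comm using minus_r_inv_mat[OF mult_carrier_mat[OF cE cD]] by simp
    then show "\<exists>h. hom_mat V (ds (Suc 0)) (ds 0) h \<and> (0 = 0 \<longrightarrow> D 0 * h = E 0) \<and>
        D 0 * (E (Suc 0) - h * D 0) = 0\<^sub>m (length (ds 0)) (length (ds (Suc 0)))"
      using h by blast
  next
    fix h and n :: nat
    assume h: "hom_mat V (ds (Suc n)) (ds n) h \<and> (n = 0 \<longrightarrow> D 0 * h = E 0) \<and>
       D n * (E (Suc n) - h * D n) = 0\<^sub>m (length (ds n)) (length (ds (Suc n)))"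
    then have hh: "hom_mat V (ds (Suc n)) (ds n) h" by blast
    note ch = hom_matD(1)[OF hh]
    have X: "hom_mat V (ds (Suc n)) (ds (Suc n)) (E (Suc n) - h * D n)"
      by (intro hom_mat_diff E hom_mat_mult[OF hh D_hom])
    obtain k where k: "hom_mat V (ds (Suc (Suc n))) (ds (Suc n)) k" "D (Suc n) * k = E (Suc n) - h * D n"
      by (rule hom_lift[OF D_hom X]) (use image_of_kernel[OF X] h in auto)
    note ck = hom_matD(1)[OF k(1)]
    have "D (Suc n) * (E (Suc (Suc n)) - k * D (Suc n)) = D (Suc n) * E (Suc (Suc n)) - D (Suc n) * (k * D (Suc n))"
      by (rule mult_minus_distrib_mat[OF cD cE mult_carrier_mat[OF ck cD]])
    also have "D (Suc n) * (k * D (Suc n)) = (E (Suc n) - h * D n) * D (Suc n)"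
      using assoc_mult_mat[OF cD ck cD] k(2) by simp
    also have "\<dots> = E (Suc n) * D (Suc n) - h * D n * D (Suc n)"
      by (rule minus_mult_distrib_mat[OF cE mult_carrier_mat[OF ch cD] cD])
    also have "h * D n * D (Suc n) = 0\<^sub>m (length (ds (Suc n))) (length (ds (Suc (Suc n))))"
      using assoc_mult_mat[OF ch cD cD] right_mult_zero_mat[OF ch] by (simp add: D_D)
    also have "D (Suc n) * E (Suc (Suc n)) - (E (Suc n) * D (Suc n) - 0\<^sub>m (length (ds (Suc n))) (length (ds (Suc (Suc n)))))
      = 0\<^sub>m (length (ds (Suc n))) (length (ds (Suc (Suc n))))"
      unfolding comm using mult_carrier_mat[OF cE[of "Suc n"] cD[of "Suc n"]] by (intro eq_matI) auto
    finally show "\<exists>k. (hom_mat V (ds (Suc (Suc n))) (ds (Suc n)) k \<and> (Suc n = 0 \<longrightarrow> D 0 * k = E 0) \<and>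
       D (Suc n) * (E (Suc (Suc n)) - k * D (Suc n)) = 0\<^sub>m (length (ds (Suc n))) (length (ds (Suc (Suc n))))) \<and>
       D (Suc n) * k = E (Suc n) - h * D n"
      using k by blast
  qed
  then obtain h where h: "\<And>n. hom_mat V (ds (Suc n)) (ds n) (h n)" "D 0 * h 0 = E 0"
     "\<And>n. D (Suc n) * h (Suc n) = E (Suc n) - h n * D n" by blast
  note ch = hom_matD(1)[OF h(1)]
  \<comment> \<open>\<open>E i\<close> is a sum of products having an entry of a differential as a
    factor, and those entries have constant term zero by minimality.\<close>
  have Dh: "coeff0 ((D i * h i) $$ (p, q)) = 0"
    unfolding coeff0_mat_mult[OF cD ch pq] using minimal pq by (intro sum.neutral) auto
  show ?thesis
  proof (cases i)
    case 0
    then show ?thesis using Dh h(2) by simp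
  next
    case (Suc n)
    have "coeff0 ((h n * D n) $$ (p, q)) = 0"
      unfolding coeff0_mat_mult[OF ch cD pq[unfolded Suc]] using minimal pq Suc by (intro sum.neutral) auto
    moreover have "coeff0 ((D i * h i) $$ (p, q)) = coeff0 (E i $$ (p, q)) - coeff0 ((h n * D n) $$ (p, q))"
      using h(3)[of n] carrier_matD[OF ch[of n]] carrier_matD[OF cD[of n]] pq by (simp add: Suc lookup_minus)
    ultimately show ?thesis using Dh by simp
  qed
qed

text \<open>\<open>Q * P\<close> minus the identity lifts the zero map on the quotient, so its
  constant part vanishes. Only diagonal entries are recorded, since only traces are compared
  later.\<close>

lemma (in graded_ideal) homotopy_inverse:
  assumes R: "resolution V I ds g D" "resolution V I ds' g' D'"
    and minimal: "\<And>i p q. p < length (ds i) \<Longrightarrow> q < length (ds (Suc i)) \<Longrightarrow> coeff0 (D i $$ (p, q)) = 0"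
    and P: "\<And>i. hom_mat V (ds' i) (ds i) (P i)" "\<And>q. q < length (ds 0) \<Longrightarrow> g $ q - g' \<bullet> col (P 0) q \<in> I"
      "\<And>i. D' i * P (Suc i) = P i * D i"
    and Q: "\<And>i. hom_mat V (ds i) (ds' i) (Q i)" "\<And>q. q < length (ds' 0) \<Longrightarrow> g' $ q - g \<bullet> col (Q 0) q \<in> I"
      "\<And>i. D i * Q (Suc i) = Q i * D' i"
    and q: "q < length (ds i)"
  shows "(\<Sum>p\<in>{0..<length (ds' i)}. coeff0 (Q i $$ (q, p)) * coeff0 (P i $$ (p, q))) = 1"
proof -
  interpret R: resolution V I ds g D by fact
  interpret R': resolution V I ds' g' D' by fact
  note cP = hom_matD(1)[OF P(1)] and cQ = hom_matD(1)[OF Q(1)]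
  note cQP = mult_carrier_mat[OF cQ cP]
  define E where "E i = Q i * P i - 1\<^sub>m (length (ds i))" for i
  have E: "hom_mat V (ds i) (ds i) (E i)" for i
    unfolding E_def by (intro hom_mat_diff hom_mat_mult[OF Q(1) P(1)] hom_mat_one)
  have aug: "g \<bullet> col (E 0) q \<in> I" if q: "q < length (ds 0)" for q
  proof -
    have colE: "col (E 0) q = Q 0 *\<^sub>v col (P 0) q - unit_vec (length (ds 0)) q"
      using carrier_matD[OF cQ[of 0]] carrier_matD[OF cP[of 0]] q
      by (intro eq_vecI) (auto simp: E_def)
    have c: "Q 0 *\<^sub>v col (P 0) q \<in> carrier_vec (length (ds 0))"
      by (rule mult_mat_vec_carrier[OF cQ]) (rule free_module_carrier[OF hom_mat_col[OF P(1) q]])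
    have eq: "g \<bullet> col (E 0) q = g \<bullet> (Q 0 *\<^sub>v col (P 0) q) - g $ q"
      unfolding colE scalar_prod_minus_distrib[OF R.g_carrier c unit_vec_carrier] scalar_prod_right_unit[OF q] ..
    have "g' \<bullet> col (P 0) q - g \<bullet> (Q 0 *\<^sub>v col (P 0) q) \<in> I"
      by (rule scalar_prod_transfer[OF cQ hom_mat_col[OF P(1) q] R'.g_carrier R.g_carrier Q(2)])
    from diff_mem[OF zero_mem add_mem[OF this P(2)[OF q]]]
    show ?thesis unfolding eq by (simp add: algebra_simps)
  qed
  have comm: "D i * E (Suc i) = E i * D i" for i
  proof -
    note cD = R.D_carrier and cD' = R'.D_carrier
    have "D i * E (Suc i) = D i * (Q (Suc i) * P (Suc i)) - D i"
      unfolding E_def using mult_minus_distrib_mat[OF cD cQP one_carrier_mat] right_mult_one_mat[OF cD] by simp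
    also have "D i * (Q (Suc i) * P (Suc i)) = D i * Q (Suc i) * P (Suc i)"
      using assoc_mult_mat[OF cD cQ cP] by simp
    also have "\<dots> = Q i * (D' i * P (Suc i))" unfolding Q(3) by (rule assoc_mult_mat[OF cQ cD' cP])
    also have "\<dots> = Q i * P i * D i" unfolding P(3) using assoc_mult_mat[OF cQ cP cD] by simp
    also have "\<dots> - D i = E i * D i"
      unfolding E_def using minus_mult_distrib_mat[OF cQP one_carrier_mat cD] left_mult_one_mat[OF cD] by simp
    finally show ?thesis .
  qed
  have "coeff0 (E i $$ (q, q)) = 0"
    by (rule R.null_homotopic[OF E aug comm minimal q q])
  then show ?thesis
    using q cQP[of i] coeff0_mat_mult[OF cQ cP q q] by (simp add: E_def lookup_minus)
qed

text \<open>The constant parts of mutually inverse homotopy equivalences are block matrices that are inverse to each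
  other; taking traces of the blocks avoids any appeal to dimensions of vector spaces.\<close>

lemma minimal_resolution_unique:
  fixes I :: "('v, 'k::field_char_0) mpoly set"
  assumes I: "graded_ideal V I"
    and R: "minimal_graded_free_resolution V I ds g D" "minimal_graded_free_resolution V I ds' g' D'"
  shows "count_list (ds i) j = count_list (ds' i) j"
proof -
  interpret graded_ideal V I by fact
  have R1: "resolution V I ds g D" and m1: "\<And>i p q. p < length (ds i) \<Longrightarrow> q < length (ds (Suc i)) \<Longrightarrow> coeff0 (D i $$ (p, q)) = 0"
    and R2: "resolution V I ds' g' D'" and m2: "\<And>i p q. p < length (ds' i) \<Longrightarrow> q < length (ds' (Suc i)) \<Longrightarrow> coeff0 (D' i $$ (p, q)) = 0"
    using R I unfolding minimal_graded_free_resolution_def resolution_def resolution_axioms_def by blast+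
  obtain P where P: "\<And>i. hom_mat V (ds' i) (ds i) (P i)" "\<And>q. q < length (ds 0) \<Longrightarrow> g $ q - g' \<bullet> col (P 0) q \<in> I"
      "\<And>i. D' i * P (Suc i) = P i * D i"
    using chain_map[OF R1 R2] by blast
  obtain Q where Q: "\<And>i. hom_mat V (ds i) (ds' i) (Q i)" "\<And>q. q < length (ds' 0) \<Longrightarrow> g' $ q - g \<bullet> col (Q 0) q \<in> I"
      "\<And>i. D i * Q (Suc i) = Q i * D' i"
    using chain_map[OF R2 R1] by blast
  define A where "A p q = coeff0 (P i $$ (p, q))" for p q
  define B where "B q p = coeff0 (Q i $$ (q, p))" for p q
  let ?n = "length (ds i)" and ?n' = "length (ds' i)"
  have BA: "(\<Sum>p\<in>{0..<?n'}. B q p * A p q) = 1" if "q < ?n" for q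
    unfolding A_def B_def by (rule homotopy_inverse[OF R1 R2 m1 P Q that])
  have AB: "(\<Sum>q\<in>{0..<?n}. A p q * B q p) = 1" if "p < ?n'" for p
    unfolding A_def B_def by (rule homotopy_inverse[OF R2 R1 m2 Q P that])
  \<comment> \<open>A nonzero constant term has degree 0, so in a homogeneous entry it forces the
    two basis degrees to agree.\<close>
  have A0: "A p q = 0" if "p < ?n'" "q < ?n" "ds' i ! p \<noteq> ds i ! q" for p q
  proof (rule ccontr)
    assume "A p q \<noteq> 0"
    then have "0 \<in> Poly_Mapping.keys (P i $$ (p, q))" by (simp add: A_def in_keys_iff)
    then show False using hom_matD(5)[OF P(1) that(1,2)] that(3) by force
  qed
  let ?S = "{q\<in>{0..<?n}. ds i ! q = j}" and ?S' = "{p\<in>{0..<?n'}. ds' i ! p = j}"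
  have "of_nat (card ?S) = (\<Sum>q\<in>?S. \<Sum>p\<in>{0..<?n'}. B q p * A p q)" using BA by simp
  also have "\<dots> = (\<Sum>q\<in>?S. \<Sum>p\<in>?S'. A p q * B q p)"
    by (intro sum.cong refl sum.mono_neutral_cong_right) (auto simp: A0 mult.commute)
  also have "\<dots> = (\<Sum>p\<in>?S'. \<Sum>q\<in>?S. A p q * B q p)" by (rule sum.swap)
  also have "\<dots> = (\<Sum>p\<in>?S'. \<Sum>q\<in>{0..<?n}. A p q * B q p)"
    by (intro sum.cong refl sum.mono_neutral_left) (auto simp: A0[OF _ _ not_sym])
  also have "\<dots> = of_nat (card ?S')" using AB by simp
  \<comment> \<open>Traces give the equality in the field; characteristic zero brings it back to
    natural numbers.\<close>
  finally have "card ?S = card ?S'" by simp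
  moreover have "count_list xs j = card {q\<in>{0..<length xs}. xs ! q = j}" for xs :: "nat list"
    unfolding count_list_eq_length_filter length_filter_conv_card by (rule arg_cong[of _ _ card]) auto
  ultimately show ?thesis by simp
qed

section \<open>Graded resolutions from squarefree ones\<close>

definition sqf :: "'v set \<Rightarrow> 'v \<Rightarrow>\<^sub>0 nat" where
  "sqf A = (\<Sum>v\<in>A. Poly_Mapping.single v 1)"

lemma lookup_sqf: "finite A \<Longrightarrow> Poly_Mapping.lookup (sqf A) v = (if v \<in> A then 1 else 0)"
  by (simp add: sqf_def lookup_sum lookup_single when_def)

lemma keys_sqf: "finite A \<Longrightarrow> Poly_Mapping.keys (sqf A) = A"
  by (auto simp: in_keys_iff lookup_sqf split: if_splits)

lemma monom_degree_sqf: "finite A \<Longrightarrow> monom_degree (sqf A) = card A"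
  by (simp add: monom_degree_def keys_sqf lookup_sqf)

lemma sqf_diff_add:
  assumes "finite A" "A \<subseteq> Poly_Mapping.keys m"
  shows "m - sqf A + sqf A = m"
proof (rule poly_mapping_eqI)
  fix v show "Poly_Mapping.lookup (m - sqf A + sqf A) v = Poly_Mapping.lookup m v"
  proof (cases "v \<in> A")
    case True
    then have "Poly_Mapping.lookup m v \<noteq> 0" using assms(2) by (auto simp: in_keys_iff)
    then show ?thesis using assms(1) True by (simp add: lookup_add lookup_minus lookup_sqf)
  qed (use assms(1) in \<open>simp add: lookup_add lookup_minus lookup_sqf\<close>)
qed

lemma sqf_split:
  assumes "finite B" "A \<subseteq> B" "B \<subseteq> Poly_Mapping.keys m"
  shows "m - sqf A = sqf (B - A) + (m - sqf B)"
proof (rule poly_mapping_eqI)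
  fix v
  have fA: "finite A" using assms finite_subset by blast
  have "Poly_Mapping.lookup m v \<noteq> 0" if "v \<in> B" using assms(3) that by (auto simp: in_keys_iff)
  then show "Poly_Mapping.lookup (m - sqf A) v = Poly_Mapping.lookup (sqf (B - A) + (m - sqf B)) v"
    using assms(1,2) fA by (auto simp: lookup_add lookup_minus lookup_sqf)
qed

lemma prod_Var: "finite e \<Longrightarrow> (\<Prod>v\<in>e. Var v :: ('v, 'k::comm_ring_1) mpoly) = Poly_Mapping.single (sqf e) 1"
  by (induction e rule: finite_induct) (simp_all add: sqf_def Var_def mult_single)

lemma lookup_single_mult:
  fixes f :: "('v, 'k::comm_ring_1) mpoly"
  shows "Poly_Mapping.lookup (Poly_Mapping.single m c * f) (m + k) = c * Poly_Mapping.lookup f k"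
proof -
  have "Poly_Mapping.lookup (Poly_Mapping.single m c * f) (m + k)
      = (\<Sum>l. (c when m = l) * (\<Sum>q. Poly_Mapping.lookup f q when m + k = l + q))"
    by (simp add: lookup_mult lookup_single)
  also have "\<dots> = (\<Sum>l. (c * (\<Sum>q. Poly_Mapping.lookup f q when m + k = l + q)) when l = m)"
    by (rule arg_cong[of _ _ Sum_any]) (auto simp: when_def)
  also have "\<dots> = c * (\<Sum>q. Poly_Mapping.lookup f q when q = k)"
    by (simp add: eq_commute[of k])
  finally show ?thesis by simp
qed

lemma lookup_single_mult_0:
  fixes f :: "('v, 'k::comm_ring_1) mpoly"
  assumes "\<And>b. k \<noteq> m + b"
  shows "Poly_Mapping.lookup (Poly_Mapping.single m c * f) k = 0"
proof (rule ccontr)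
  assume "\<not> ?thesis"
  then have "k \<in> Poly_Mapping.keys (Poly_Mapping.single m c * f)" by (simp add: in_keys_iff)
  then show False by (rule keys_multD) (use assms in \<open>auto split: if_splits\<close>)
qed

lemma sum_monomials: "(\<Sum>m\<in>Poly_Mapping.keys f. Poly_Mapping.single m (Poly_Mapping.lookup f m)) = f"
  by (rule poly_mapping_eqI) (auto simp: lookup_sum lookup_single when_def in_keys_iff)

lemma polys_single: "Poly_Mapping.keys m \<subseteq> V \<Longrightarrow> Poly_Mapping.single m c \<in> polys V"
  by (auto simp: polys_def split: if_splits)

lemma keys_sumD:
  "m \<in> Poly_Mapping.keys (\<Sum>i\<in>A. f i) \<Longrightarrow> \<exists>i\<in>A. m \<in> Poly_Mapping.keys (f i :: ('v, 'k::comm_ring_1) mpoly)"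
  unfolding in_keys_iff lookup_sum by (meson sum.not_neutral_contains_not_neutral)

text \<open>Membership in a monomial ideal is decided monomial by monomial: each one is divisible by
  an edge monomial, and multiplication by coefficients only enlarges supports.\<close>

lemma edge_ideal_iff:
  assumes G: "simple_graph V E"
  shows "f \<in> (edge_ideal V E :: ('v, 'k::comm_ring_1) mpoly set) \<longleftrightarrow>
    f \<in> polys V \<and> (\<forall>m\<in>Poly_Mapping.keys f. \<exists>e\<in>E. e \<subseteq> Poly_Mapping.keys m)"
proof -
  have fe: "finite e" "e \<subseteq> V" if "e \<in> E" for e
    using G that finite_subset unfolding simple_graph_def by blast+
  have gens: "(\<lambda>e. \<Prod>v\<in>e. Var v) ` E = (\<lambda>e. Poly_Mapping.single (sqf e) (1::'k)) ` E"
    by (rule image_cong) (use fe prod_Var in auto)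
  show ?thesis
  proof
    assume "f \<in> edge_ideal V E"
    then obtain T c where f: "f = (\<Sum>s\<in>T. c s * s)" and T: "T \<subseteq> (\<lambda>e. Poly_Mapping.single (sqf e) (1::'k)) ` E"
      and c: "\<forall>s\<in>T. c s \<in> polys V"
      unfolding edge_ideal_def ideal_generated_def gens by blast
    have Tp: "s \<in> polys V" if s: "s \<in> T" for s
    proof -
      obtain e where "e \<in> E" "s = Poly_Mapping.single (sqf e) 1" using T s by blast
      then show ?thesis using fe[of e] by (simp add: polys_single keys_sqf)
    qed
    have "f \<in> polys V" unfolding f using c Tp by (intro polys_sum polys_mult) auto
    moreover have "\<exists>e\<in>E. e \<subseteq> Poly_Mapping.keys m" if m: "m \<in> Poly_Mapping.keys f" for m
    proof -
      obtain s where s: "s \<in> T" "m \<in> Poly_Mapping.keys (c s * s)" using keys_sumD m unfolding f by blast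
      obtain e where e: "e \<in> E" "s = Poly_Mapping.single (sqf e) 1" using T s(1) by blast
      from s(2) obtain a b where "m = a + b" "b \<in> Poly_Mapping.keys s" by (rule keys_multD)
      then have "m = a + sqf e" using e(2) by (simp split: if_splits)
      then show ?thesis using e(1) keys_sqf[OF fe(1)[OF e(1)]] by (auto simp: keys_add_nat)
    qed
    ultimately show "f \<in> polys V \<and> (\<forall>m\<in>Poly_Mapping.keys f. \<exists>e\<in>E. e \<subseteq> Poly_Mapping.keys m)" by blast
  next
    assume f: "f \<in> polys V \<and> (\<forall>m\<in>Poly_Mapping.keys f. \<exists>e\<in>E. e \<subseteq> Poly_Mapping.keys m)"
    then obtain e where e: "\<And>m. m \<in> Poly_Mapping.keys f \<Longrightarrow> e m \<in> E \<and> e m \<subseteq> Poly_Mapping.keys m" by metis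
    define h where "h m = Poly_Mapping.single (sqf (e m)) (1::'k)" for m
    define t where "t m = Poly_Mapping.single (m - sqf (e m)) (Poly_Mapping.lookup f m)" for m
    \<comment> \<open>An ideal element is written with one coefficient per generator, so the
      monomials assigned to the same edge are collected.\<close>
    define c where "c s = (\<Sum>m\<in>{m \<in> Poly_Mapping.keys f. h m = s}. t m)" for s
    have th: "t m * h m = Poly_Mapping.single m (Poly_Mapping.lookup f m)" if "m \<in> Poly_Mapping.keys f" for m
      using sqf_diff_add[OF fe(1), of "e m" m] e[OF that] by (simp add: t_def h_def mult_single)
    have "(\<Sum>s\<in>h ` Poly_Mapping.keys f. c s * s) =
        (\<Sum>s\<in>h ` Poly_Mapping.keys f. \<Sum>m\<in>{m \<in> Poly_Mapping.keys f. h m = s}. t m * h m)"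
      unfolding c_def sum_distrib_right by (intro sum.cong refl) auto
    also have "\<dots> = (\<Sum>m\<in>Poly_Mapping.keys f. t m * h m)"
      by (rule sum.group) auto
    also have "\<dots> = f" using th sum_monomials[of f] by simp
    finally have eq: "f = (\<Sum>s\<in>h ` Poly_Mapping.keys f. c s * s)" ..
    have "t m \<in> polys V" if m: "m \<in> Poly_Mapping.keys f" for m
    proof -
      have "Poly_Mapping.keys (m - sqf (e m)) \<subseteq> Poly_Mapping.keys m"
        by (auto simp: in_keys_iff lookup_minus)
      then show ?thesis unfolding t_def using f m by (intro polys_single) (auto simp: polys_def)
    qed
    then have cp: "\<forall>s\<in>h ` Poly_Mapping.keys f. c s \<in> polys V"
      unfolding c_def by (auto intro!: polys_sum)
    have hE: "h ` Poly_Mapping.keys f \<subseteq> (\<lambda>e. Poly_Mapping.single (sqf e) 1) ` E"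
      using e by (auto simp: h_def)
    show "f \<in> edge_ideal V E"
      unfolding edge_ideal_def ideal_generated_def gens
      by (intro CollectI exI[of _ "h ` Poly_Mapping.keys f"] exI[of _ c] conjI eq finite_imageI finite_keys hE cp)
  qed
qed

lemma graded_ideal_edge_ideal:
  assumes G: "simple_graph V E"
  shows "graded_ideal V (edge_ideal V E :: ('v, 'k::comm_ring_1) mpoly set)"
proof
  show "0 \<in> (edge_ideal V E :: ('v, 'k) mpoly set)" by (simp add: edge_ideal_iff[OF G])
next
  fix f g :: "('v, 'k) mpoly" assume fg: "f \<in> edge_ideal V E" "g \<in> edge_ideal V E"
  then have "f + g \<in> polys V" unfolding edge_ideal_iff[OF G] by (simp add: polys_add)
  moreover have "\<exists>e\<in>E. e \<subseteq> Poly_Mapping.keys m" if "m \<in> Poly_Mapping.keys (f + g)" for m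
    using subsetD[OF keys_add that] fg unfolding edge_ideal_iff[OF G] by (elim UnE) simp_all
  ultimately show "f + g \<in> edge_ideal V E" unfolding edge_ideal_iff[OF G] by simp
next
  fix c f :: "('v, 'k) mpoly" assume c: "c \<in> polys V" and f: "f \<in> edge_ideal V E"
  have "\<exists>e\<in>E. e \<subseteq> Poly_Mapping.keys m" if "m \<in> Poly_Mapping.keys (c * f)" for m
    using that
  proof (rule keys_multD)
    fix a b assume "m = a + b" "b \<in> Poly_Mapping.keys f"
    moreover from this obtain e where "e \<in> E" "e \<subseteq> Poly_Mapping.keys b"
      using f unfolding edge_ideal_iff[OF G] by blast
    ultimately show ?thesis by (intro bexI[of _ e]) (auto simp: keys_add_nat)
  qed
  then show "c * f \<in> edge_ideal V E"
    using polys_mult[OF c] f unfolding edge_ideal_iff[OF G] by simp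
next
  fix f :: "('v, 'k) mpoly" and d assume "f \<in> edge_ideal V E"
  then show "hpart 0 d f \<in> edge_ideal V E"
    unfolding edge_ideal_iff[OF G] by (simp add: hpart_polys keys_hpart)
qed

lemma mult_mat_vec_free_module:
  fixes D :: "('v, 'k::comm_ring_1) mpoly mat"
  assumes "D \<in> carrier_mat n m" "\<And>p q. p < n \<Longrightarrow> q < m \<Longrightarrow> D $$ (p, q) \<in> polys V" "h \<in> free_module V m"
  shows "D *\<^sub>v h \<in> free_module V n"
proof -
  have "(D *\<^sub>v h) $ p = (\<Sum>r\<in>{0..<m}. D $$ (p, r) * h $ r)" if "p < n" for p
    using that assms(1,3) by (auto simp: scalar_prod_def free_module_def)
  moreover have "(\<Sum>r\<in>{0..<m}. D $$ (p, r) * h $ r) \<in> polys V" if "p < n" for p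
    by (intro polys_sum polys_mult) (use that assms in \<open>auto simp: free_module_def\<close>)
  ultimately show ?thesis using assms(1,3) by (auto simp: free_module_def)
qed

section \<open>Monomial matrices attached to a squarefree resolution\<close>

context squarefree_resolution
begin

definition index :: "nat \<Rightarrow> nat \<Rightarrow> nat" where
  "index i p = sorted_list_of_set (J i) ! p"

definition position :: "nat \<Rightarrow> nat \<Rightarrow> nat" where
  "position i = the_inv_into {..<card (J i)} (index i)"

definition degrees :: "nat \<Rightarrow> nat list" where
  "degrees i = map (\<lambda>q. card (s i q)) (sorted_list_of_set (J i))"

text \<open>Each scalar is multiplied by the monomial that makes up the difference of
  multidegrees.\<close>

definition diff :: "nat \<Rightarrow> ('v, 'k) mpoly mat" where
  "diff i = mat (card (J i)) (card (J (Suc i))) (\<lambda>(p, q).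
     Poly_Mapping.single (sqf (s (Suc i) (index (Suc i) q) - s i (index i p))) (C i (index (Suc i) q) (index i p)))"

text \<open>The coefficients of \<open>h\<close> in multidegree \<open>a\<close>, where the \<open>q\<close>-th basis element has multidegree \<open>s i q\<close>.\<close>

definition coeffs_at :: "nat \<Rightarrow> ('v \<Rightarrow>\<^sub>0 nat) \<Rightarrow> ('v, 'k) mpoly vec \<Rightarrow> nat \<Rightarrow> 'k" where
  "coeffs_at i a h q = (if q \<in> J i \<and> s i q \<subseteq> Poly_Mapping.keys a
     then Poly_Mapping.lookup (h $ position i q) (a - sqf (s i q)) else 0)"

lemma bij_index: "bij_betw (index i) {..<card (J i)} (J i)"
  unfolding index_def by (rule bij_betw_nth) (simp_all add: finite_J)

lemma index_in: "p < card (J i) \<Longrightarrow> index i p \<in> J i"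
  using bij_index[of i] by (auto simp: bij_betw_def)

lemma position_index [simp]: "p < card (J i) \<Longrightarrow> position i (index i p) = p"
  unfolding position_def using bij_index[of i] by (simp add: bij_betw_def the_inv_into_f_f)

lemma position_less: "q \<in> J i \<Longrightarrow> position i q < card (J i)"
  unfolding position_def using bij_index[of i] the_inv_into_into[of "index i" "{..<card (J i)}" q]
  by (auto simp: bij_betw_def)

lemma index_position [simp]: "q \<in> J i \<Longrightarrow> index i (position i q) = q"
  unfolding position_def using bij_index[of i] by (simp add: bij_betw_def f_the_inv_into_f)

lemma finite_s: "q \<in> J i \<Longrightarrow> finite (s i q)"
  using s_subset finite_V finite_subset by blast

lemma length_degrees [simp]: "length (degrees i) = card (J i)"
  by (simp add: degrees_def)

lemma nth_degrees: "p < card (J i) \<Longrightarrow> degrees i ! p = card (s i (index i p))"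
  by (simp add: degrees_def index_def)

lemma coeffs_at_graded_part: "coeffs_at i a h \<in> graded_part (J i) (s i) (Poly_Mapping.keys a)"
  by (simp add: graded_part_def coeffs_at_def)

lemma coeffs_at_index:
  assumes "p < card (J i)"
  shows "coeffs_at i (m + sqf (s i (index i p))) h (index i p) = Poly_Mapping.lookup (h $ p) m"
  using assms keys_sqf[OF finite_s[OF index_in[OF assms]]]
  by (simp add: coeffs_at_def index_in keys_add_nat)

lemma coeffs_at_eqI:
  assumes "h \<in> carrier_vec (card (J i))" "h' \<in> carrier_vec (card (J i))" "\<And>a. coeffs_at i a h = coeffs_at i a h'"
  shows "h = h'"
proof (rule eq_vecI)
  fix p assume "p < dim_vec h'"
  then have p: "p < card (J i)" using assms(2) by simp
  show "h $ p = h' $ p"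
    by (rule poly_mapping_eqI) (metis assms(3) coeffs_at_index[OF p])
qed (use assms in simp)

lemma coeffs_at_outside:
  assumes h: "h \<in> free_module V (card (J i))" and a: "\<not> Poly_Mapping.keys a \<subseteq> V"
  shows "coeffs_at i a h q = 0"
proof (rule ccontr)
  assume "coeffs_at i a h q \<noteq> 0"
  then have q: "q \<in> J i" "s i q \<subseteq> Poly_Mapping.keys a" "a - sqf (s i q) \<in> Poly_Mapping.keys (h $ position i q)"
    by (auto simp: coeffs_at_def in_keys_iff split: if_splits)
  then have "Poly_Mapping.keys (a - sqf (s i q)) \<subseteq> V"
    using h position_less[OF q(1)] by (auto simp: free_module_def polys_def)
  moreover have "Poly_Mapping.keys a = Poly_Mapping.keys (a - sqf (s i q)) \<union> s i q"
    using sqf_diff_add[OF finite_s[OF q(1)] q(2)] keys_sqf[OF finite_s[OF q(1)]] keys_add_nat by metis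
  ultimately show False using a s_subset[OF q(1)] by blast
qed

lemma coeffs_at_finite:
  assumes "h \<in> carrier_vec (card (J i))"
  shows "finite {a. coeffs_at i a h \<noteq> (\<lambda>_. 0)}"
proof (rule finite_subset)
  show "{a. coeffs_at i a h \<noteq> (\<lambda>_. 0)} \<subseteq>
      (\<Union>q\<in>J i. (\<lambda>m. m + sqf (s i q)) ` Poly_Mapping.keys (h $ position i q))"
  proof safe
    fix a assume "coeffs_at i a h \<noteq> (\<lambda>_. 0)"
    then obtain q where "coeffs_at i a h q \<noteq> 0" by (auto simp: fun_eq_iff)
    then have q: "q \<in> J i" "s i q \<subseteq> Poly_Mapping.keys a" "a - sqf (s i q) \<in> Poly_Mapping.keys (h $ position i q)"
      by (auto simp: coeffs_at_def in_keys_iff split: if_splits)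
    then show "a \<in> (\<Union>q\<in>J i. (\<lambda>m. m + sqf (s i q)) ` Poly_Mapping.keys (h $ position i q))"
      using sqf_diff_add[OF finite_s[OF q(1)] q(2)] by (intro UN_I[OF q(1)] image_eqI[OF _ q(3)]) simp
  qed
qed (simp add: finite_J)

lemma diff_carrier: "diff i \<in> carrier_mat (card (J i)) (card (J (Suc i)))"
  by (simp add: diff_def)

lemma index_diff:
  "p < card (J i) \<Longrightarrow> q < card (J (Suc i)) \<Longrightarrow> diff i $$ (p, q) =
     Poly_Mapping.single (sqf (s (Suc i) (index (Suc i) q) - s i (index i p))) (C i (index (Suc i) q) (index i p))"
  by (simp add: diff_def)

text \<open>In a fixed multidegree the monomial factors cancel and the polynomial matrix acts as the
  scalar matrix \<open>C i\<close>. Hence exactness over the ring can be tested strand by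
  strand.\<close>

lemma coeffs_at_diff:
  assumes h: "h \<in> carrier_vec (card (J (Suc i)))"
  shows "coeffs_at i a (diff i *\<^sub>v h) = lin_comb (J (Suc i)) (C i) (coeffs_at (Suc i) a h)"
proof
  fix q
  show "coeffs_at i a (diff i *\<^sub>v h) q = lin_comb (J (Suc i)) (C i) (coeffs_at (Suc i) a h) q"
  proof (cases "q \<in> J i \<and> s i q \<subseteq> Poly_Mapping.keys a")
    case False
    have "coeffs_at (Suc i) a h r * C i r q = 0" if "r \<in> J (Suc i)" for r
    proof (cases "C i r q = 0")
      case C: False
      then have "\<not> s (Suc i) r \<subseteq> Poly_Mapping.keys a" using strict[OF that C] False by blast
      then show ?thesis by (simp add: coeffs_at_def)
    qed simp
    then have "lin_comb (J (Suc i)) (C i) (coeffs_at (Suc i) a h) q = 0"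
      unfolding lin_comb_def by (intro sum.neutral ballI)
    moreover have "coeffs_at i a (diff i *\<^sub>v h) q = 0"
      using False unfolding coeffs_at_def by (rule if_not_P)
    ultimately show ?thesis by simp
  next
    case True
    let ?p = "position i q"
    have p: "?p < card (J i)" using True position_less by blast
    have entry: "Poly_Mapping.lookup (diff i $$ (?p, r) * h $ r) (a - sqf (s i q)) =
        coeffs_at (Suc i) a h (index (Suc i) r) * C i (index (Suc i) r) q" if r: "r < card (J (Suc i))" for r
    proof (cases "C i (index (Suc i) r) q = 0")
      case True
      then show ?thesis using index_diff[OF p r] \<open>q \<in> J i \<and> _\<close> by simp
    next
      case C: False
      let ?B = "s (Suc i) (index (Suc i) r)" and ?A = "s i q"
      have rJ: "index (Suc i) r \<in> J (Suc i)" using index_in[OF r] .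
      have AB: "?A \<subset> ?B" using strict[OF rJ C] by blast
      have fB: "finite ?B" using finite_s[OF rJ] .
      have D: "diff i $$ (?p, r) = Poly_Mapping.single (sqf (?B - ?A)) (C i (index (Suc i) r) q)"
        using index_diff[OF p r] True by simp
      show ?thesis
      proof (cases "?B \<subseteq> Poly_Mapping.keys a")
        case B: True
        have eq: "a - sqf ?A = sqf (?B - ?A) + (a - sqf ?B)"
          by (rule sqf_split[OF fB _ B]) (use AB in blast)
        show ?thesis unfolding D eq lookup_single_mult using B rJ r
          by (simp add: coeffs_at_def mult.commute)
      next
        case B: False
        have "a - sqf ?A \<noteq> sqf (?B - ?A) + b" for b
        proof
          assume "a - sqf ?A = sqf (?B - ?A) + b"
          then have "?B - ?A \<subseteq> Poly_Mapping.keys (a - sqf ?A)"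
            using fB by (simp add: keys_add_nat keys_sqf)
          also have "\<dots> \<subseteq> Poly_Mapping.keys a" by (auto simp: in_keys_iff lookup_minus)
          finally show False using B True by blast
        qed
        then show ?thesis unfolding D using B by (simp add: lookup_single_mult_0 coeffs_at_def)
      qed
    qed
    have "coeffs_at i a (diff i *\<^sub>v h) q = Poly_Mapping.lookup ((diff i *\<^sub>v h) $ ?p) (a - sqf (s i q))"
      using True by (simp add: coeffs_at_def)
    also have "(diff i *\<^sub>v h) $ ?p = (\<Sum>r\<in>{..<card (J (Suc i))}. diff i $$ (?p, r) * h $ r)"
      using p h diff_carrier[of i] by (simp add: scalar_prod_def lessThan_atLeast0)
    also have "Poly_Mapping.lookup \<dots> (a - sqf (s i q)) =
        (\<Sum>r\<in>{..<card (J (Suc i))}. coeffs_at (Suc i) a h (index (Suc i) r) * C i (index (Suc i) r) q)"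
      by (simp add: lookup_sum entry)
    also have "\<dots> = lin_comb (J (Suc i)) (C i) (coeffs_at (Suc i) a h) q"
      unfolding lin_comb_def by (rule sum.reindex_bij_betw[OF bij_index])
    finally show ?thesis .
  qed
qed

text \<open>Preimages are found in every multidegree \<open>a\<close> separately, from exactness in
  the squarefree degree given by the support of \<open>a\<close>, and then assembled.\<close>

lemma image_diff_iff:
  assumes h: "h \<in> free_module V (card (J i))"
  shows "h \<in> (\<lambda>h. diff i *\<^sub>v h) ` free_module V (card (J (Suc i))) \<longleftrightarrow>
    (\<forall>a. Poly_Mapping.keys a \<subseteq> V \<longrightarrow> coeffs_at i a h \<in> syzygies N J s C i (Poly_Mapping.keys a))"
proof
  assume "h \<in> (\<lambda>h. diff i *\<^sub>v h) ` free_module V (card (J (Suc i)))"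
  then obtain h' where h': "h' \<in> free_module V (card (J (Suc i)))" "h = diff i *\<^sub>v h'" by blast
  then have h'c: "h' \<in> carrier_vec (card (J (Suc i)))" by (simp add: free_module_def)
  show "\<forall>a. Poly_Mapping.keys a \<subseteq> V \<longrightarrow> coeffs_at i a h \<in> syzygies N J s C i (Poly_Mapping.keys a)"
    unfolding h'(2) coeffs_at_diff[OF h'c] by (auto simp: exact coeffs_at_graded_part)
next
  assume *: "\<forall>a. Poly_Mapping.keys a \<subseteq> V \<longrightarrow> coeffs_at i a h \<in> syzygies N J s C i (Poly_Mapping.keys a)"
  have hc: "h \<in> carrier_vec (card (J i))" using h by (simp add: free_module_def)
  \<comment> \<open>Choosing 0 wherever the strand of \<open>h\<close> vanishes makes the assembled
    vector finitely supported and keeps its variables in \<open>V\<close>.\<close>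
  have "\<exists>y. y \<in> graded_part (J (Suc i)) (s (Suc i)) (Poly_Mapping.keys a) \<and>
      lin_comb (J (Suc i)) (C i) y = coeffs_at i a h \<and> (coeffs_at i a h = (\<lambda>_. 0) \<longrightarrow> y = (\<lambda>_. 0))" for a
  proof (cases "coeffs_at i a h = (\<lambda>_. 0)")
    case True
    then show ?thesis by (intro exI[of _ "\<lambda>_. 0"]) (auto simp: graded_part_def fun_eq_iff)
  next
    case False
    then have "Poly_Mapping.keys a \<subseteq> V" using coeffs_at_outside[OF h] by (auto simp: fun_eq_iff)
    then have "coeffs_at i a h \<in> lin_comb (J (Suc i)) (C i) ` graded_part (J (Suc i)) (s (Suc i)) (Poly_Mapping.keys a)"
      using * exact by simp
    then show ?thesis using False by auto
  qed
  then obtain y where y: "\<And>a. y a \<in> graded_part (J (Suc i)) (s (Suc i)) (Poly_Mapping.keys a)"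
    "\<And>a. lin_comb (J (Suc i)) (C i) (y a) = coeffs_at i a h"
    "\<And>a. coeffs_at i a h = (\<lambda>_. 0) \<Longrightarrow> y a = (\<lambda>_. 0)" by metis
  \<comment> \<open>The inverse of \<open>coeffs_at\<close>: the coefficient of \<open>m\<close> in
    entry \<open>r\<close> comes from the solution in multidegree \<open>m\<close> times the degree
    of that basis element.\<close>
  define F where "F r m = y (m + sqf (s (Suc i) (index (Suc i) r))) (index (Suc i) r)" for r m
  have fin: "finite {m. F r m \<noteq> 0}" for r
  proof (rule finite_subset)
    show "{m. F r m \<noteq> 0} \<subseteq> (\<lambda>m. m + sqf (s (Suc i) (index (Suc i) r))) -` {a. coeffs_at i a h \<noteq> (\<lambda>_. 0)}"
      using y(3) by (auto simp: F_def)
    show "finite ((\<lambda>m. m + sqf (s (Suc i) (index (Suc i) r))) -` {a. coeffs_at i a h \<noteq> (\<lambda>_. 0)})"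
      by (rule finite_vimageI[OF coeffs_at_finite[OF hc]]) (simp add: inj_def)
  qed
  define h' where "h' = vec (card (J (Suc i))) (\<lambda>r. Abs_poly_mapping (F r))"
  have h'_lookup: "Poly_Mapping.lookup (h' $ r) m = F r m" if "r < card (J (Suc i))" for r m
    using that fin[of r] by (simp add: h'_def)
  have h'c: "h' \<in> carrier_vec (card (J (Suc i)))" by (simp add: h'_def)
  have "h' \<in> free_module V (card (J (Suc i)))"
    unfolding free_module_def polys_def
  proof (safe, rule h'c)
    fix r m v assume r: "r < card (J (Suc i))" and m: "m \<in> Poly_Mapping.keys (h' $ r)" and v: "v \<in> Poly_Mapping.keys m"
    then have "y (m + sqf (s (Suc i) (index (Suc i) r))) (index (Suc i) r) \<noteq> 0"
      by (simp add: in_keys_iff h'_lookup F_def)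
    then have "coeffs_at i (m + sqf (s (Suc i) (index (Suc i) r))) h \<noteq> (\<lambda>_. 0)" using y(3) by fastforce
    then have "Poly_Mapping.keys (m + sqf (s (Suc i) (index (Suc i) r))) \<subseteq> V"
      using coeffs_at_outside[OF h] by (auto simp: fun_eq_iff)
    then show "v \<in> V" using v by (auto simp: keys_add_nat)
  qed
  moreover have "diff i *\<^sub>v h' = h"
  proof (rule coeffs_at_eqI[OF _ hc])
    show "diff i *\<^sub>v h' \<in> carrier_vec (card (J i))" by (rule mult_mat_vec_carrier[OF diff_carrier h'c])
    fix a
    have "coeffs_at (Suc i) a h' = y a"
    proof
      fix q show "coeffs_at (Suc i) a h' q = y a q"
      proof (cases "q \<in> J (Suc i) \<and> s (Suc i) q \<subseteq> Poly_Mapping.keys a")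
        case True
        then show ?thesis
          using sqf_diff_add[OF finite_s, of q "Suc i" a]
          by (simp add: coeffs_at_def h'_lookup position_less F_def)
      next
        case False
        then show ?thesis using y(1)[of a] by (auto simp: coeffs_at_def graded_part_def)
      qed
    qed
    then show "coeffs_at i a (diff i *\<^sub>v h') = coeffs_at i a h"
      unfolding coeffs_at_diff[OF h'c] by (simp add: y(2))
  qed
  ultimately show "h \<in> (\<lambda>h. diff i *\<^sub>v h) ` free_module V (card (J (Suc i)))" by blast
qed

lemma diff_polys:
  assumes "p < card (J i)" "q < card (J (Suc i))"
  shows "diff i $$ (p, q) \<in> polys V"
  using s_subset[OF index_in[OF assms(2)]] finite_s[OF index_in[OF assms(2)]]
  unfolding index_diff[OF assms] by (intro polys_single) (auto simp: keys_sqf)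

lemma minimal_resolution:
  assumes G: "simple_graph V E" and N: "\<And>W. W \<subseteq> V \<Longrightarrow> N W \<longleftrightarrow> (\<exists>e\<in>E. e \<subseteq> W)"
  shows "minimal_graded_free_resolution V (edge_ideal V E) degrees (vec 1 (\<lambda>_. 1)) diff"
proof -
  let ?g = "vec 1 (\<lambda>_. 1) :: ('v, 'k) mpoly vec"
  have J0: "card (J 0) = 1" by (simp add: J_0)
  have idx0: "index 0 0 = 0" using index_in[of 0 0] J_0 by simp
  have pos0: "position 0 0 = 0" using position_less[of 0 0] J_0 by simp
  have g_prod: "?g \<bullet> h = h $ 0" if "h \<in> carrier_vec 1" for h
    using that by (simp add: scalar_prod_def)
  have hom: "monom_degree m + degrees i ! p = degrees (Suc i) ! q"
    if pq: "p < card (J i)" "q < card (J (Suc i))" and m: "m \<in> Poly_Mapping.keys (diff i $$ (p, q))" for i p q m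
  proof -
    let ?A = "s i (index i p)" and ?B = "s (Suc i) (index (Suc i) q)"
    have m': "m = sqf (?B - ?A)" "C i (index (Suc i) q) (index i p) \<noteq> 0"
      using m unfolding index_diff[OF pq] by (auto split: if_splits)
    have "?A \<subset> ?B" using strict[OF index_in[OF pq(2)] m'(2)] by blast
    moreover have "finite ?B" using finite_s[OF index_in[OF pq(2)]] .
    ultimately show ?thesis
      using card_mono[of ?B ?A] finite_subset[of ?A ?B] unfolding m'(1) nth_degrees[OF pq(1)] nth_degrees[OF pq(2)]
      by (simp add: monom_degree_sqf card_Diff_subset psubset_imp_subset)
  qed
  have min: "coeff0 (diff i $$ (p, q)) = 0" if pq: "p < card (J i)" "q < card (J (Suc i))" for i p q
  proof (rule ccontr)
    let ?A = "s i (index i p)" and ?B = "s (Suc i) (index (Suc i) q)"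
    assume "coeff0 (diff i $$ (p, q)) \<noteq> 0"
    then have m': "sqf (?B - ?A) = 0" "C i (index (Suc i) q) (index i p) \<noteq> 0"
      unfolding index_diff[OF pq] by (auto simp: lookup_single when_def split: if_splits)
    have "?A \<subset> ?B" using strict[OF index_in[OF pq(2)] m'(2)] by blast
    moreover have "?B - ?A = {}"
      using keys_sqf[of "?B - ?A"] finite_s[OF index_in[OF pq(2)]] unfolding m'(1) by simp
    ultimately show False by blast
  qed
  have ex0: "{h \<in> free_module V 1. ?g \<bullet> h \<in> edge_ideal V E} = (\<lambda>h. diff 0 *\<^sub>v h) ` free_module V (card (J (Suc 0)))"
  proof (rule Set.set_eqI)
    fix h :: "('v, 'k) mpoly vec"
    show "h \<in> {h \<in> free_module V 1. ?g \<bullet> h \<in> edge_ideal V E} \<longleftrightarrow> h \<in> (\<lambda>h. diff 0 *\<^sub>v h) ` free_module V (card (J (Suc 0)))"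
    proof (cases "h \<in> free_module V 1")
      case True
      then have h: "h \<in> carrier_vec 1" "h $ 0 \<in> polys V" by (auto simp: free_module_def)
      have cf: "coeffs_at 0 a h q = (if q = 0 then Poly_Mapping.lookup (h $ 0) a else 0)" for a q
        by (simp add: coeffs_at_def J_0 s_0 pos0 sqf_def)
      have "h $ 0 \<in> edge_ideal V E \<longleftrightarrow>
        (\<forall>a. Poly_Mapping.keys a \<subseteq> V \<longrightarrow> coeffs_at 0 a h \<in> syzygies N J s C 0 (Poly_Mapping.keys a))"
        (is "_ \<longleftrightarrow> ?R")
      proof -
        have "?R \<longleftrightarrow> (\<forall>a. Poly_Mapping.keys a \<subseteq> V \<longrightarrow> a \<in> Poly_Mapping.keys (h $ 0) \<longrightarrow> N (Poly_Mapping.keys a))"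
          by (auto simp: syzygies_def nonface_part_def cf in_keys_iff split: if_splits)
        also have "\<dots> \<longleftrightarrow> (\<forall>a\<in>Poly_Mapping.keys (h $ 0). \<exists>e\<in>E. e \<subseteq> Poly_Mapping.keys a)"
          using h(2) N unfolding polys_def by blast
        also have "\<dots> \<longleftrightarrow> h $ 0 \<in> edge_ideal V E"
          unfolding edge_ideal_iff[OF G] using h(2) by blast
        finally show ?thesis ..
      qed
      then show ?thesis using True g_prod[OF h(1)] image_diff_iff[of h 0] J0 by simp
    next
      case False
      have "diff 0 *\<^sub>v k \<in> free_module V 1" if "k \<in> free_module V (card (J (Suc 0)))" for k
        using mult_mat_vec_free_module[OF diff_carrier diff_polys that] J0 by simp
      then show ?thesis using False by blast
    qed
  qed
  have exS: "{h \<in> free_module V (card (J (Suc i))). diff i *\<^sub>v h = 0\<^sub>v (card (J i))} =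
      (\<lambda>h. diff (Suc i) *\<^sub>v h) ` free_module V (card (J (Suc (Suc i))))" for i
  proof (rule Set.set_eqI)
    fix h :: "('v, 'k) mpoly vec"
    show "h \<in> {h \<in> free_module V (card (J (Suc i))). diff i *\<^sub>v h = 0\<^sub>v (card (J i))} \<longleftrightarrow>
      h \<in> (\<lambda>h. diff (Suc i) *\<^sub>v h) ` free_module V (card (J (Suc (Suc i))))"
    proof (cases "h \<in> free_module V (card (J (Suc i)))")
      case True
      then have h: "h \<in> carrier_vec (card (J (Suc i)))" by (simp add: free_module_def)
      have z: "coeffs_at i a (0\<^sub>v (card (J i))) = (\<lambda>_. 0)" for a
        by (auto simp: coeffs_at_def position_less)
      have "diff i *\<^sub>v h = 0\<^sub>v (card (J i)) \<longleftrightarrow> (\<forall>a. coeffs_at i a (diff i *\<^sub>v h) = (\<lambda>_. 0))"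
        using coeffs_at_eqI[of "diff i *\<^sub>v h" i "0\<^sub>v (card (J i))"] mult_mat_vec_carrier[OF diff_carrier h] z by auto
      also have "\<dots> \<longleftrightarrow> (\<forall>a. Poly_Mapping.keys a \<subseteq> V \<longrightarrow> lin_comb (J (Suc i)) (C i) (coeffs_at (Suc i) a h) = (\<lambda>_. 0))"
      proof -
        have "lin_comb (J (Suc i)) (C i) (coeffs_at (Suc i) a h) = (\<lambda>_. 0)" if "\<not> Poly_Mapping.keys a \<subseteq> V" for a
          by (rule ext) (simp add: lin_comb_def coeffs_at_outside[OF True that])
        then show ?thesis unfolding coeffs_at_diff[OF h] by blast
      qed
      also have "\<dots> \<longleftrightarrow> (\<forall>a. Poly_Mapping.keys a \<subseteq> V \<longrightarrow> coeffs_at (Suc i) a h \<in> syzygies N J s C (Suc i) (Poly_Mapping.keys a))"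
        by (simp add: syzygies_def coeffs_at_graded_part fun_eq_iff)
      finally show ?thesis using True image_diff_iff[OF True] by simp
    next
      case False
      have "diff (Suc i) *\<^sub>v k \<in> free_module V (card (J (Suc i)))" if "k \<in> free_module V (card (J (Suc (Suc i))))" for k
        using mult_mat_vec_free_module[OF diff_carrier diff_polys that] by simp
      then show ?thesis using False by blast
    qed
  qed
  have surj: "\<exists>h\<in>free_module V 1. f - ?g \<bullet> h \<in> edge_ideal V E" if f: "f \<in> polys V" for f
  proof (rule bexI[of _ "vec 1 (\<lambda>_. f)"])
    show "vec 1 (\<lambda>_. f) \<in> free_module V 1" using f by (simp add: free_module_def)
    show "f - ?g \<bullet> vec 1 (\<lambda>_. f) \<in> edge_ideal V E"
      using g_prod[of "vec 1 (\<lambda>_. f)"] by (simp add: edge_ideal_iff[OF G])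
  qed
  have d0: "degrees 0 ! 0 = 0" using nth_degrees[of 0 0] by (simp add: J0 idx0 s_0)
  have g: "?g \<in> free_module V 1" by (simp add: free_module_def)
  have "graded_free_resolution V (edge_ideal V E) degrees ?g diff"
    unfolding graded_free_resolution_def Let_def length_degrees J0
  proof (intro conjI allI impI ballI)
    show "monom_degree m = degrees 0 ! p" if "p < 1" "m \<in> Poly_Mapping.keys (?g $ p)" for p m
      using that d0 by (auto split: if_splits)
  qed (use g diff_carrier diff_polys hom ex0 exS surj in auto)
  then show ?thesis
    unfolding minimal_graded_free_resolution_def length_degrees using min by blast
qed

lemma count_list_degrees: "count_list (degrees i) j = card {q \<in> J i. card (s i q) = j}"
proof -
  have "count_list (map f xs) j = length (filter (\<lambda>q. f q = j) xs)" for f :: "nat \<Rightarrow> nat" and xs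
    by (induction xs) auto
  then have "count_list (degrees i) j = length (filter (\<lambda>q. card (s i q) = j) (sorted_list_of_set (J i)))"
    by (simp add: degrees_def)
  also have "\<dots> = card (set (filter (\<lambda>q. card (s i q) = j) (sorted_list_of_set (J i))))"
    by (rule distinct_card[symmetric]) simp
  finally show ?thesis by (simp add: finite_J)
qed

end

text \<open>The monomial matrices give existence and the comparison theorem uniqueness, so the
  definite description denotes the number of generators of the given size.\<close>

lemma graded_betti_eq:
  fixes C :: "nat \<Rightarrow> nat \<Rightarrow> nat \<Rightarrow> 'k::field_char_0"
  assumes S: "squarefree_resolution V N J s C" and G: "simple_graph V E"
    and N: "\<And>W. W \<subseteq> V \<Longrightarrow> N W \<longleftrightarrow> (\<exists>e\<in>E. e \<subseteq> W)"
  shows "graded_betti V (edge_ideal V E :: ('v, 'k) mpoly set) i j = card {q \<in> J i. card (s i q) = j}"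
proof -
  interpret squarefree_resolution V N J s C by fact
  note m = minimal_resolution[OF G N]
  show ?thesis
    unfolding graded_betti_def count_list_degrees[symmetric]
  proof (rule the_equality)
    show "\<exists>ds g D. minimal_graded_free_resolution V (edge_ideal V E :: ('v, 'k) mpoly set) ds g D \<and>
        count_list (degrees i) j = count_list (ds i) j"
      using m by blast
  next
    fix b assume "\<exists>ds g D. minimal_graded_free_resolution V (edge_ideal V E :: ('v, 'k) mpoly set) ds g D \<and>
        b = count_list (ds i) j"
    then show "b = count_list (degrees i) j"
      using minimal_resolution_unique[OF graded_ideal_edge_ideal[OF G] _ m] by blast
  qed
qed

section \<open>Jump sequences of joins\<close>

text \<open>A single resolution for the large graph serves its induced subgraphs: it is restricted
  and pulled back along the inverse \<open>u\<close> of the embedding. All Betti numbers become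
  counts in the same sets \<open>J i\<close>.\<close>

lemma graded_betti_induced:
  fixes C :: "nat \<Rightarrow> nat \<Rightarrow> nat \<Rightarrow> 'k::field_char_0" and f :: "'v \<Rightarrow> 'w"
  assumes S: "squarefree_resolution VK (\<lambda>W. \<exists>e\<in>EK. e \<subseteq> W) J s C"
    and G: "simple_graph V E" and inj: "inj_on f V" and sub: "f ` V \<subseteq> VK"
    and induced: "\<And>e. e \<subseteq> f ` V \<Longrightarrow> e \<in> EK \<longleftrightarrow> e \<in> image f ` E"
  shows "graded_betti V (edge_ideal V E :: ('v, 'k) mpoly set) i j =
    card {q \<in> J i. s i q \<subseteq> f ` V \<and> card (s i q) = j}"
proof -
  interpret K: squarefree_resolution VK "\<lambda>W. \<exists>e\<in>EK. e \<subseteq> W" J s C by fact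
  define u where "u = the_inv_into V f"
  have uf: "u (f v) = v" if "v \<in> V" for v using the_inv_into_f_f[OF inj that] by (simp add: u_def)
  have uV: "u ` f ` V = V" using uf by force
  have inju: "inj_on u (f ` V)" by (auto simp: inj_on_def uf)
  have EV: "e \<subseteq> V" if "e \<in> E" for e using G that by (auto simp: simple_graph_def)
  have iff: "(\<exists>e\<in>E. e \<subseteq> u ` W) \<longleftrightarrow> (\<exists>e\<in>EK. e \<subseteq> W)" if W: "W \<subseteq> f ` V" for W
  proof
    assume "\<exists>e\<in>E. e \<subseteq> u ` W"
    then obtain e where e: "e \<in> E" "e \<subseteq> u ` W" by blast
    have "f ` e \<subseteq> W" using e(2) W uf by force
    moreover have "f ` e \<in> EK" using induced[of "f ` e"] EV[OF e(1)] e(1) by blast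
    ultimately show "\<exists>e\<in>EK. e \<subseteq> W" by blast
  next
    assume "\<exists>e\<in>EK. e \<subseteq> W"
    then obtain e where e: "e \<in> EK" "e \<subseteq> W" by blast
    then obtain e0 where e0: "e0 \<in> E" "e = f ` e0" using induced[of e] W by blast
    have "e0 \<subseteq> u ` W"
    proof
      fix v assume v: "v \<in> e0"
      then have "u (f v) = v" "f v \<in> W" using uf EV[OF e0(1)] e(2) e0(2) by auto
      then show "v \<in> u ` W" by force
    qed
    then show "\<exists>e\<in>E. e \<subseteq> u ` W" using e0(1) by blast
  qed
  have R: "squarefree_resolution (u ` f ` V) (\<lambda>W. \<exists>e\<in>E. e \<subseteq> W) (\<lambda>i. {q \<in> J i. s i q \<subseteq> f ` V})
      (\<lambda>i q. u ` s i q) C"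
    by (rule K.restrict[OF sub inju]) (rule iff)
  have "graded_betti V (edge_ideal V E :: ('v, 'k) mpoly set) i j =
      card {q \<in> {q \<in> J i. s i q \<subseteq> f ` V}. card (u ` s i q) = j}"
    by (rule graded_betti_eq[OF R[unfolded uV] G refl])
  also have "{q \<in> {q \<in> J i. s i q \<subseteq> f ` V}. card (u ` s i q) = j} = {q \<in> J i. s i q \<subseteq> f ` V \<and> card (s i q) = j}"
    using card_image[OF inj_on_subset[OF inju]] by auto
  finally show ?thesis .
qed

section \<open>Corner sums as arithmetic of Betti tables\<close>

definition jump_condition :: "(nat \<Rightarrow> nat \<Rightarrow> nat) \<Rightarrow> nat \<Rightarrow> nat list \<Rightarrow> bool" where
  "jump_condition \<beta> k as \<longleftrightarrow> (\<exists>i. \<beta> i (i + k) \<noteq> 0) \<and> (\<forall>i j. \<beta> i j \<noteq> 0 \<longrightarrow> j \<le> i + k) \<and> length as + 1 = k \<and>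
     (\<forall>r. 1 \<le> r \<longrightarrow> r \<le> k - 1 \<longrightarrow> \<beta> (as ! (r - 1) + 1) (as ! (r - 1) + 1 + r + 1) \<noteq> 0 \<and>
       (\<forall>i. \<beta> i (i + r + 1) \<noteq> 0 \<longrightarrow> as ! (r - 1) + 1 \<le> i))"

lemma has_jump_sequence_iff: "has_jump_sequence V I (k, as) \<longleftrightarrow> jump_condition (graded_betti V I) k as"
proof -
  have "int k + 1 \<in> {int j - int i + 1 | i j. graded_betti V I i j \<noteq> 0} \<longleftrightarrow> (\<exists>i. graded_betti V I i (i + k) \<noteq> 0)"
  proof
    assume "int k + 1 \<in> {int j - int i + 1 | i j. graded_betti V I i j \<noteq> 0}"
    then obtain i j where ij: "int k + 1 = int j - int i + 1" "graded_betti V I i j \<noteq> 0" by blast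
    then have "j = i + k" by linarith
    then show "\<exists>i. graded_betti V I i (i + k) \<noteq> 0" using ij by blast
  next
    assume "\<exists>i. graded_betti V I i (i + k) \<noteq> 0"
    then obtain i where "graded_betti V I i (i + k) \<noteq> 0" by blast
    then show "int k + 1 \<in> {int j - int i + 1 | i j. graded_betti V I i j \<noteq> 0}"
      by (intro CollectI exI[of _ i] exI[of _ "i + k"]) simp
  qed
  moreover have "(\<forall>s\<in>{int j - int i + 1 | i j. graded_betti V I i j \<noteq> 0}. s \<le> int k + 1) \<longleftrightarrow>
      (\<forall>i j. graded_betti V I i j \<noteq> 0 \<longrightarrow> j \<le> i + k)"
  proof -
    have "(\<forall>s\<in>{int j - int i + 1 | i j. graded_betti V I i j \<noteq> 0}. s \<le> int k + 1) \<longleftrightarrow>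
      (\<forall>i j. graded_betti V I i j \<noteq> 0 \<longrightarrow> int j - int i + 1 \<le> int k + 1)" by blast
    moreover have "int j - int i + 1 \<le> int k + 1 \<longleftrightarrow> j \<le> i + k" for i j by linarith
    ultimately show ?thesis by simp
  qed
  ultimately show ?thesis
    unfolding has_jump_sequence_def has_regularity_def jump_condition_def Let_def by auto
qed

text \<open>By the assumption on \<open>\<beta>K\<close>, every entry off the linear strand has an
  entry of one of the other tables weakly to its left on the same strand. So the leftmost entries
  are minima, and for \<open>r \<ge> k\<close> only the second table contributes.\<close>

lemma jump_condition_min:
  assumes a: "jump_condition \<beta>G k as" and b: "jump_condition \<beta>H l bs" and kl: "k \<le> l"
    and G: "\<And>i j. \<beta>G i j \<noteq> 0 \<Longrightarrow> \<beta>K i j \<noteq> 0" and H: "\<And>i j. \<beta>H i j \<noteq> 0 \<Longrightarrow> \<beta>K i j \<noteq> 0"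
    and K: "\<And>i j. \<beta>K i j \<noteq> 0 \<Longrightarrow> i + 2 \<le> j \<Longrightarrow> \<exists>d\<le>i. \<beta>G (i - d) (j - d) \<noteq> 0 \<or> \<beta>H (i - d) (j - d) \<noteq> 0"
  shows "jump_condition \<beta>K l (map2 min as bs @ drop (k - 1) bs)"
proof -
  let ?cs = "map2 min as bs @ drop (k - 1) bs"
  have len: "length as + 1 = k" "length bs + 1 = l" using a b by (auto simp: jump_condition_def)
  have Gb: "j \<le> i + k" if "\<beta>G i j \<noteq> 0" for i j using a that by (auto simp: jump_condition_def)
  have Hb: "j \<le> i + l" if "\<beta>H i j \<noteq> 0" for i j using b that by (auto simp: jump_condition_def)
  have Gr: "\<beta>G (as ! (r - 1) + 1) (as ! (r - 1) + 1 + r + 1) \<noteq> 0" "\<And>i. \<beta>G i (i + r + 1) \<noteq> 0 \<Longrightarrow> as ! (r - 1) + 1 \<le> i"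
    if "1 \<le> r" "r \<le> k - 1" for r
    using a that unfolding jump_condition_def by blast+
  have Hr: "\<beta>H (bs ! (r - 1) + 1) (bs ! (r - 1) + 1 + r + 1) \<noteq> 0" "\<And>i. \<beta>H i (i + r + 1) \<noteq> 0 \<Longrightarrow> bs ! (r - 1) + 1 \<le> i"
    if "1 \<le> r" "r \<le> l - 1" for r
    using b that unfolding jump_condition_def by blast+
  have split: "\<exists>d\<le>i. \<beta>G (i - d) (i - d + r + 1) \<noteq> 0 \<or> \<beta>H (i - d) (i - d + r + 1) \<noteq> 0"
    if nz: "\<beta>K i (i + r + 1) \<noteq> 0" and r1: "1 \<le> r" for i r
  proof -
    obtain d where "d \<le> i" "\<beta>G (i - d) (i + r + 1 - d) \<noteq> 0 \<or> \<beta>H (i - d) (i + r + 1 - d) \<noteq> 0"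
      using K[OF nz] r1 by auto
    moreover from this have "i + r + 1 - d = i - d + r + 1" by simp
    ultimately show ?thesis by metis
  qed
  have top: "\<exists>i. \<beta>K i (i + l) \<noteq> 0" using b H unfolding jump_condition_def by blast
  have bound: "j \<le> i + l" if nz: "\<beta>K i j \<noteq> 0" for i j
  proof (cases "i + 2 \<le> j")
    case True
    then obtain d where "d \<le> i" "\<beta>G (i - d) (j - d) \<noteq> 0 \<or> \<beta>H (i - d) (j - d) \<noteq> 0" using K[OF nz] by blast
    then show ?thesis using Gb[of "i - d" "j - d"] Hb[of "i - d" "j - d"] kl by linarith
  next
    \<comment> \<open>Here \<open>j \<le> i + 1\<close>, and \<open>l\<close> is at least 1 because
      \<open>length bs + 1 = l\<close>.\<close>
    case False
    then show ?thesis using len by linarith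
  qed
  have jump: "\<beta>K (?cs ! (r - 1) + 1) (?cs ! (r - 1) + 1 + r + 1) \<noteq> 0 \<and>
      (\<forall>i. \<beta>K i (i + r + 1) \<noteq> 0 \<longrightarrow> ?cs ! (r - 1) + 1 \<le> i)" if r: "1 \<le> r" "r \<le> l - 1" for r
  proof (cases "r \<le> k - 1")
    case True
    have "r - 1 < length as" "r - 1 < length bs" using True r len by linarith+
    then have cs: "?cs ! (r - 1) = min (as ! (r - 1)) (bs ! (r - 1))"
      by (simp add: nth_append)
    have "\<beta>K (?cs ! (r - 1) + 1) (?cs ! (r - 1) + 1 + r + 1) \<noteq> 0"
      unfolding cs using G[OF Gr(1)[OF r(1) True]] H[OF Hr(1)[OF r]] by (simp add: min_def)
    moreover have "?cs ! (r - 1) + 1 \<le> i" if nz: "\<beta>K i (i + r + 1) \<noteq> 0" for i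
    proof -
      obtain d where "d \<le> i" "\<beta>G (i - d) (i - d + r + 1) \<noteq> 0 \<or> \<beta>H (i - d) (i - d + r + 1) \<noteq> 0"
        using split[OF nz r(1)] by blast
      then show ?thesis unfolding cs using Gr(2)[OF r(1) True] Hr(2)[OF r] by fastforce
    qed
    ultimately show ?thesis by blast
  next
    case False
    have cs: "?cs ! (r - 1) = bs ! (r - 1)"
      using False r len kl by (auto simp: nth_append min_def)
    have "\<beta>K (?cs ! (r - 1) + 1) (?cs ! (r - 1) + 1 + r + 1) \<noteq> 0"
      unfolding cs using H[OF Hr(1)[OF r]] by simp
    moreover have "?cs ! (r - 1) + 1 \<le> i" if nz: "\<beta>K i (i + r + 1) \<noteq> 0" for i
    proof -
      obtain d where d: "d \<le> i" "\<beta>G (i - d) (i - d + r + 1) \<noteq> 0 \<or> \<beta>H (i - d) (i - d + r + 1) \<noteq> 0"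
        using split[OF nz r(1)] by blast
      \<comment> \<open>The strand \<open>r + 1\<close> lies above the last nonzero strand
        \<open>k\<close> of this table.\<close>
      have "\<beta>G (i - d) (i - d + r + 1) = 0" using Gb[of "i - d" "i - d + r + 1"] False len by linarith
      then have "bs ! (r - 1) + 1 \<le> i - d" using d(2) Hr(2)[OF r] by blast
      then show ?thesis unfolding cs by linarith
    qed
    ultimately show ?thesis by blast
  qed
  have "length ?cs + 1 = l" using len kl by simp
  then show ?thesis unfolding jump_condition_def using top bound jump by blast
qed

lemma map2_min_commute: "map2 min xs ys = map2 min ys (xs :: nat list)"
  by (induction xs ys rule: list_induct2') (simp_all add: min.commute)

lemma jump_condition_corner_sum:
  assumes a: "jump_condition \<beta>G k as" and b: "jump_condition \<beta>H l bs"
    and G: "\<And>i j. \<beta>G i j \<noteq> 0 \<Longrightarrow> \<beta>K i j \<noteq> 0" and H: "\<And>i j. \<beta>H i j \<noteq> 0 \<Longrightarrow> \<beta>K i j \<noteq> 0"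
    and K: "\<And>i j. \<beta>K i j \<noteq> 0 \<Longrightarrow> i + 2 \<le> j \<Longrightarrow> \<exists>d\<le>i. \<beta>G (i - d) (j - d) \<noteq> 0 \<or> \<beta>H (i - d) (j - d) \<noteq> 0"
  shows "case corner_sum (k, as) (l, bs) of (n, cs) \<Rightarrow> jump_condition \<beta>K n cs"
proof (cases "k \<le> l")
  case True
  have "jump_condition \<beta>K l (map2 min as bs @ drop (k - 1) bs)"
    by (rule jump_condition_min[OF a b True G H K])
  then show ?thesis using True by (simp add: corner_sum_def)
next
  case False
  have K': "\<exists>d\<le>i. \<beta>H (i - d) (j - d) \<noteq> 0 \<or> \<beta>G (i - d) (j - d) \<noteq> 0"
    if "\<beta>K i j \<noteq> 0" "i + 2 \<le> j" for i j
    using K[OF that] by blast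
  have "jump_condition \<beta>K k (map2 min bs as @ drop (l - 1) as)"
    by (rule jump_condition_min[OF b a _ H G K']) (use False in simp)
  then show ?thesis using False by (simp add: corner_sum_def map2_min_commute[of as])
qed

theorem proposition5p3:
  fixes VG :: "'a set" and EG :: "'a set set"
    and VH :: "'b set" and EH :: "'b set set"
    and a b :: jump_seq
  assumes "simple_graph VG EG" and "EG \<noteq> {}"
    and "simple_graph VH EH" and "EH \<noteq> {}"
    and "has_jump_sequence VG (edge_ideal VG EG :: ('a, 'k::field_char_0) mpoly set) a"
    and "has_jump_sequence VH (edge_ideal VH EH :: ('b, 'k) mpoly set) b"
  shows "\<exists>(VK :: nat set) (EK :: nat set set).
           simple_graph VK EK \<and> EK \<noteq> {} \<and>
           has_jump_sequence VK (edge_ideal VK EK :: (nat, 'k) mpoly set) (corner_sum a b)"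
proof -
  note G = assms(1) and H = assms(3)
  have fin: "finite VG" "finite VH" using G H by (auto simp: simple_graph_def)
  obtain f :: "'a \<Rightarrow> nat" and n where f: "f ` VG = {i. i < n}" "inj_on f VG"
    using finite_imp_inj_to_nat_seg[OF fin(1)] by blast
  obtain h0 :: "'b \<Rightarrow> nat" and m where h0: "h0 ` VH = {i. i < m}" "inj_on h0 VH"
    using finite_imp_inj_to_nat_seg[OF fin(2)] by blast
  \<comment> \<open>The shift by \<open>n\<close> moves the second vertex set past the
    first.\<close>
  define h where "h v = n + h0 v" for v
  have h: "inj_on h VH" using h0(2) by (auto simp: inj_on_def h_def)
  define V1 where "V1 = f ` VG"
  define V2 where "V2 = h ` VH"
  have disj: "V1 \<inter> V2 = {}" using f(1) by (auto simp: V1_def V2_def h_def)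
  define VK where "VK = V1 \<union> V2"
  define EK where "EK = image f ` EG \<union> image h ` EH \<union> {{x, y} | x y. x \<in> V1 \<and> y \<in> V2}"
  have EG: "e \<subseteq> VG" "card e = 2" if "e \<in> EG" for e using G that by (auto simp: simple_graph_def)
  have EH: "e \<subseteq> VH" "card e = 2" if "e \<in> EH" for e using H that by (auto simp: simple_graph_def)
  have e1: "f ` e \<subseteq> V1" "card (f ` e) = 2" if "e \<in> EG" for e
    using EG[OF that] card_image[OF inj_on_subset[OF f(2)], of e] by (auto simp: V1_def)
  have e2: "h ` e \<subseteq> V2" "card (h ` e) = 2" if "e \<in> EH" for e
    using EH[OF that] card_image[OF inj_on_subset[OF h], of e] by (auto simp: V2_def)
  have finK: "finite VK" using fin by (simp add: VK_def V1_def V2_def)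
  have card2: "e \<subseteq> VK \<and> card e = 2" if eK: "e \<in> EK" for e
  proof -
    consider e' where "e' \<in> EG" "e = f ` e'" | e' where "e' \<in> EH" "e = h ` e'" | x y where "x \<in> V1" "y \<in> V2" "e = {x, y}"
      using eK unfolding EK_def by blast
    then show ?thesis
    proof cases
      case 1
      then show ?thesis using e1[OF 1(1)] by (auto simp: VK_def)
    next
      case 2
      then show ?thesis using e2[OF 2(1)] by (auto simp: VK_def)
    next
      case 3
      then have "x \<noteq> y" using disj by blast
      then show ?thesis using 3 by (simp add: VK_def)
    qed
  qed
  have SK: "simple_graph VK EK" using finK card2 by (simp add: simple_graph_def)
  let ?N = "\<lambda>W. \<exists>e\<in>EK. e \<subseteq> W"
  have "\<exists>J s (C :: nat \<Rightarrow> nat \<Rightarrow> nat \<Rightarrow> 'k). squarefree_resolution VK ?N J s C"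
  proof (rule squarefree_resolution_exists[OF finK])
    show "\<not> ?N {}" using card2 by fastforce
  qed blast
  then obtain J s and C :: "nat \<Rightarrow> nat \<Rightarrow> nat \<Rightarrow> 'k" where R: "squarefree_resolution VK ?N J s C" by blast
  interpret squarefree_resolution_nat VK ?N J s C
    unfolding squarefree_resolution_nat_def by (rule R)
  have bG: "graded_betti VG (edge_ideal VG EG :: ('a, 'k) mpoly set) i j = card {q \<in> J i. s i q \<subseteq> V1 \<and> card (s i q) = j}" for i j
    unfolding V1_def
  proof (rule graded_betti_induced[OF R G f(2)])
    fix e assume "e \<subseteq> f ` VG"
    then have e: "e \<subseteq> V1" by (simp add: V1_def)
    \<comment> \<open>A set of two elements cannot lie in both disjoint parts, so edges inside
      \<open>V1\<close> come from \<open>EG\<close> alone: the first graph is an induced subgraph of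
      the join.\<close>
    have "\<not> (e \<subseteq> V2 \<and> card e = 2)"
    proof
      assume "e \<subseteq> V2 \<and> card e = 2"
      moreover from this have "e = {}" using e disj by blast
      ultimately show False by simp
    qed
    then have "e \<notin> image h ` EH" using e2 by blast
    moreover have "e \<notin> {{x, y} | x y. x \<in> V1 \<and> y \<in> V2}"
    proof
      assume "e \<in> {{x, y} | x y. x \<in> V1 \<and> y \<in> V2}"
      then obtain x y where "x \<in> V1" "y \<in> V2" "e = {x, y}" by blast
      then show False using e disj by auto
    qed
    ultimately show "e \<in> EK \<longleftrightarrow> e \<in> image f ` EG" unfolding EK_def by (simp only: Un_iff simp_thms)
  qed (simp add: VK_def V1_def)
  have bH: "graded_betti VH (edge_ideal VH EH :: ('b, 'k) mpoly set) i j = card {q \<in> J i. s i q \<subseteq> V2 \<and> card (s i q) = j}" for i j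
    unfolding V2_def
  proof (rule graded_betti_induced[OF R H h])
    fix e assume "e \<subseteq> h ` VH"
    then have e: "e \<subseteq> V2" by (simp add: V2_def)
    have "\<not> (e \<subseteq> V1 \<and> card e = 2)"
    proof
      assume "e \<subseteq> V1 \<and> card e = 2"
      moreover from this have "e = {}" using e disj by blast
      ultimately show False by simp
    qed
    then have "e \<notin> image f ` EG" using e1 by blast
    moreover have "e \<notin> {{x, y} | x y. x \<in> V1 \<and> y \<in> V2}"
    proof
      assume "e \<in> {{x, y} | x y. x \<in> V1 \<and> y \<in> V2}"
      then obtain x y where "x \<in> V1" "y \<in> V2" "e = {x, y}" by blast
      then show False using e disj by auto
    qed
    ultimately show "e \<in> EK \<longleftrightarrow> e \<in> image h ` EH" unfolding EK_def by (simp only: Un_iff simp_thms)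
  qed (simp add: VK_def V2_def)
  have bK: "graded_betti VK (edge_ideal VK EK :: (nat, 'k) mpoly set) i j = card {q \<in> J i. card (s i q) = j}" for i j
    by (rule graded_betti_eq[OF R SK refl])
  have nz: "card {q \<in> J i. P q} \<noteq> 0 \<longleftrightarrow> (\<exists>q\<in>J i. P q)" for i P
    using finite_J[of i] by auto
  obtain k as l bs where ab: "a = (k, as)" "b = (l, bs)" by (cases a, cases b)
  have "case corner_sum (k, as) (l, bs) of (n, cs) \<Rightarrow> jump_condition (graded_betti VK (edge_ideal VK EK :: (nat, 'k) mpoly set)) n cs"
  proof (rule jump_condition_corner_sum)
    show "jump_condition (graded_betti VG (edge_ideal VG EG :: ('a, 'k) mpoly set)) k as"
      and "jump_condition (graded_betti VH (edge_ideal VH EH :: ('b, 'k) mpoly set)) l bs"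
      using assms(5,6) unfolding ab has_jump_sequence_iff .
  next
    fix i j assume "graded_betti VG (edge_ideal VG EG :: ('a, 'k) mpoly set) i j \<noteq> 0"
    then show "graded_betti VK (edge_ideal VK EK :: (nat, 'k) mpoly set) i j \<noteq> 0"
      unfolding bG bK nz by blast
  next
    fix i j assume "graded_betti VH (edge_ideal VH EH :: ('b, 'k) mpoly set) i j \<noteq> 0"
    then show "graded_betti VK (edge_ideal VK EK :: (nat, 'k) mpoly set) i j \<noteq> 0"
      unfolding bH bK nz by blast
  next
    fix i j assume ij: "graded_betti VK (edge_ideal VK EK :: (nat, 'k) mpoly set) i j \<noteq> 0" "i + 2 \<le> j"
    then obtain q where q: "q \<in> J i" "card (s i q) = j" unfolding bK nz by blast
    have join: "?N T" if T: "T \<subseteq> VK" "\<not> T \<subseteq> V1" "\<not> T \<subseteq> V2" for T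
    proof -
      obtain x y where xy: "x \<in> T" "x \<in> V1" "y \<in> T" "y \<in> V2" using T unfolding VK_def by blast
      then have "{x, y} \<in> EK" unfolding EK_def by blast
      then show ?thesis using xy by (intro bexI[of _ "{x, y}"]) auto
    qed
    have "\<exists>d\<le>i. \<exists>q'\<in>J (i - d). card (s (i - d) q') = card (s i q) - d \<and> (s (i - d) q' \<subseteq> V1 \<or> s (i - d) q' \<subseteq> V2)"
      by (rule join_generator[OF VK_def disj join q(1)]) (use q(2) ij(2) in auto)
    then show "\<exists>d\<le>i. graded_betti VG (edge_ideal VG EG :: ('a, 'k) mpoly set) (i - d) (j - d) \<noteq> 0 \<or>
        graded_betti VH (edge_ideal VH EH :: ('b, 'k) mpoly set) (i - d) (j - d) \<noteq> 0"
      unfolding bG bH nz q(2) by blast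
  qed
  then have "has_jump_sequence VK (edge_ideal VK EK :: (nat, 'k) mpoly set) (corner_sum a b)"
    unfolding ab by (cases "corner_sum (k, as) (l, bs)") (simp add: has_jump_sequence_iff)
  moreover have "EK \<noteq> {}" using assms(2) by (auto simp: EK_def)
  ultimately show ?thesis using SK by blast
qed

end
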